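(* Let $E$ be an infinite-dimensional Banach space with a $C^1$ (away from the origin) strictly convex equivalent norm $\|\cdot\|$ and with a $1$-suppression unconditional basis $\{e_n\}_{n\in\mathbb{N}}$. Let $U$ be an open subset of $E$, $f:U\to\mathbb{R}^d$ a $C^1$ function and $\varepsilon:U\to(0,\infty)$ a continuous function. Then there exists a $C^1$ function $g:U\to\mathbb{R}^d$ such that: (1) $\|f(x)-g(x)\|\leq\varepsilon(x)$ for every $x\in U$; (2) $\|Df(x)-Dg(x)\|\leq\varepsilon(x)$ for every $x\in U$; (3) the critical set $C_g:=\{x\in U: Dg(x)\ \text{is not surjective}\}$ is locally contained in a finite union of complemented subspaces of infinite codimension in $E$: for every $x\in U$ there exist an open neighbourhood $V_x$ of $x$ and finitely many closed subspaces $E_1,\dots,E_{n_x}$ of $E$, each complemented in $E$ and of infinite codimension, with $C_g\cap V_x\subseteq\bigcup_{j=1}^{n_x}E_j$.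
   Context: A basis $\{e_n\}$ is $1$-suppression unconditional if it is a Schauder basis such that for every $x=\sum_j x_je_j\in E$ and every $j_0\in\mathbb{N}$, $\left\|\sum_{j\neq j_0}x_je_j\right\|\leq\left\|\sum_j x_je_j\right\|$. The norm on $\mathbb{R}^d$ is Euclidean; norms of linear maps are operator norms. *)

theory Defs
  imports "HOL-Analysis.Analysis"
begin

definition C1_on :: "'a::real_normed_vector set \<Rightarrow> ('a \<Rightarrow> 'b::real_normed_vector) \<Rightarrow> bool" where
  "C1_on S f \<longleftrightarrow> (\<exists>f' :: 'a \<Rightarrow> ('a \<Rightarrow>\<^sub>L 'b).
      (\<forall>x\<in>S. (f has_derivative blinfun_apply (f' x)) (at x)) \<and> continuous_on S f')"

definition infinite_dimensional :: "'a::real_vector itself \<Rightarrow> bool" where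
  "infinite_dimensional TYPE('a) \<longleftrightarrow> \<not> (\<exists>B :: 'a set. finite B \<and> span B = UNIV)"

definition strictly_convex_norm :: "'a::real_normed_vector itself \<Rightarrow> bool" where
  "strictly_convex_norm TYPE('a) \<longleftrightarrow>
     (\<forall>x y :: 'a. norm x = 1 \<longrightarrow> norm y = 1 \<longrightarrow> x \<noteq> y \<longrightarrow> norm ((1/2) *\<^sub>R (x + y)) < 1)"

definition schauder_basis :: "(nat \<Rightarrow> 'a::real_normed_vector) \<Rightarrow> bool" where
  "schauder_basis e \<longleftrightarrow> (\<forall>x. \<exists>!c :: nat \<Rightarrow> real. (\<lambda>j. c j *\<^sub>R e j) sums x)"

definition one_suppression_unconditional :: "(nat \<Rightarrow> 'a::real_normed_vector) \<Rightarrow> bool" where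
  "one_suppression_unconditional e \<longleftrightarrow> schauder_basis e \<and>
     (\<forall>x c j0. (\<lambda>j. c j *\<^sub>R e j) sums x \<longrightarrow>
        norm (\<Sum>j. if j = j0 then 0 else c j *\<^sub>R e j) \<le> norm x)"

definition complemented :: "'a::real_normed_vector set \<Rightarrow> bool" where
  "complemented F \<longleftrightarrow> (\<exists>G. closed G \<and> subspace G \<and> F \<inter> G = {0} \<and> F + G = UNIV)"

definition infinite_codim :: "'a::real_vector set \<Rightarrow> bool" where
  "infinite_codim F \<longleftrightarrow> \<not> (\<exists>S. finite S \<and> F + span S = UNIV)"

end

theory Submission
  imports Defs
begin

text \<open>
  Let \<open>proj n\<close> be the basis projections and let \<open>L\<close> be a \<open>C\<^sup>1\<close> approximation of \<open>f'\<close> such that,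
  locally, \<open>L x (e m)\<close> is a positive multiple of \<open>w (e m)\<close> for all late \<open>m\<close>. Here \<open>w\<close> is a fixed
  operator that vanishes at infinitely many \<open>e m\<close> and maps infinitely many \<open>e m\<close> to each positive
  coordinate half-axis. The functions \<open>f (proj j x) + L (proj j x) (x - proj j x)\<close> are \<open>C\<^sup>1\<close> close to
  \<open>f\<close> where \<open>proj j x\<close> is close to \<open>x\<close>, and affine along \<open>e m\<close> for \<open>m \<ge> j\<close>. Componentwise smooth
  minima of finitely many of them are the stages \<open>G n\<close>, and \<open>g\<close> passes from \<open>G n\<close> to \<open>G (Suc n)\<close> by a
  cutoff of a scalar function, the clock.

  The clock at stage \<open>n\<close> is a smooth minimum over \<open>i \<le> n\<close> of the squared distance from \<open>x\<close> to \<open>proj i x\<close>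
  in the scale \<open>\<eta>\<close>, diminished by the oscillation that the stages have accumulated since \<open>i\<close>. Hence the
  clock drops, from one stage to the next, in proportion to \<open>G (Suc n) - G n\<close>. This leaves room for
  a cutoff whose derivative times \<open>G (Suc n) - G n\<close> is of order \<open>\<epsilon>\<close>, and no two passages overlap.

  Let \<open>c\<close> be orthogonal to the range of the derivative of \<open>g\<close> at \<open>x\<close>. If \<open>w (e m) = 0\<close> and
  \<open>coord x m \<noteq> 0\<close> for some late \<open>m\<close>, then along \<open>e m\<close> the stages are stationary, whereas the clock is
  not, by strict convexity. So the cutoff term is orthogonal to \<open>c\<close>. Then the derivative of the
  stages along an \<open>e m\<close> that \<open>w\<close> maps to the \<open>l\<close>-th half-axis gives \<open>c $ l = 0\<close>. Thus near any
  point all critical points lie in one space \<open>vanishing {m. q \<le> m \<and> w (e m) = 0}\<close>.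
\<close>

section \<open>Continuously differentiable maps\<close>

text \<open>The obstacle is the product rule: a cutoff between two stages contributes its derivative
  times the increment \<open>G (Suc n) - G n\<close>, so the passage must be as wide as the
  increment is large, in units of \<open>\<beta>\<close>. Infinitely many disjoint passages fit into
  a clock of bounded range only if the increments at a point have a bounded sum, and for plain
  approximants along \<open>proj n\<close> no such bound is available. Smooth minima supply it: with
  a fixed set of candidates the value only rises with \<open>n\<close>, and a new candidate only
  lowers it. Rise plus fall bounds an increment, and supermodularity lets these quantities
  accumulate to at most a multiple of \<open>\<beta>\<close>.

  The operators \<open>L\<close> exist because the derivative of the squared norm at a finite
  combination of basis vectors annihilates all later \<open>e m\<close>, by suppression, and because
  such derivatives are dense in the dual, by Ekeland's principle. Adding a small multiple of
  \<open>w\<close> prescribes the tail. All constants depend on the dimension of the target alone;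
  they are absorbed by replacing the given tolerance with a smaller, nearly constant one.\<close>

definition C1_at :: "('a::real_normed_vector \<Rightarrow> 'b::real_normed_vector) \<Rightarrow> 'a \<Rightarrow> bool" where
  "C1_at F x \<longleftrightarrow> (\<exists>W. open W \<and> x \<in> W \<and> C1_on W F)"

lemma C1_atI:
  assumes "open W" "x \<in> W" "\<And>y. y \<in> W \<Longrightarrow> (F has_derivative blinfun_apply (F' y)) (at y)"
    "continuous_on W F'"
  shows "C1_at F x"
  using assms unfolding C1_at_def C1_on_def by blast

lemma C1_atE:
  assumes "C1_at F x"
  obtains W F' where "open W" "x \<in> W"
    "\<And>y. y \<in> W \<Longrightarrow> (F has_derivative blinfun_apply (F' y)) (at y)" "continuous_on W F'"
  using assms unfolding C1_at_def C1_on_def by blast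

lemma C1_at_eventually:
  assumes "C1_at F x" shows "\<forall>\<^sub>F y in nhds x. C1_at F y"
  using assms unfolding C1_at_def eventually_nhds by blast

lemma C1_at_derivative:
  assumes "C1_at F x" obtains D where "(F has_derivative blinfun_apply D) (at x)"
  using assms by (auto elim!: C1_atE)

lemma C1_at_isCont: "C1_at F x \<Longrightarrow> isCont F x"
  by (metis C1_at_derivative has_derivative_continuous)

lemma C1_at_continuous_on: "(\<And>x. x \<in> S \<Longrightarrow> C1_at F x) \<Longrightarrow> continuous_on S F"
  by (simp add: C1_at_isCont continuous_at_imp_continuous_on)

lemma C1_at_tendsto: "C1_at F x \<Longrightarrow> (F \<longlongrightarrow> F x) (nhds x)"
  using C1_at_isCont isCont_def tendsto_at_iff_tendsto_nhds by blast

lemma C1_at_cong: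
  assumes "C1_at F x" "\<forall>\<^sub>F y in nhds x. F y = G y" shows "C1_at G x"
proof -
  obtain W F' where W: "open W" "x \<in> W"
    "\<And>y. y \<in> W \<Longrightarrow> (F has_derivative blinfun_apply (F' y)) (at y)" "continuous_on W F'"
    using assms(1) by (rule C1_atE) blast
  obtain V where V: "open V" "x \<in> V" "\<And>y. y \<in> V \<Longrightarrow> F y = G y"
    using assms(2) unfolding eventually_nhds by blast
  show ?thesis
  proof (rule C1_atI)
    show "open (W \<inter> V)" "x \<in> W \<inter> V" using W V by auto
    show "(G has_derivative blinfun_apply (F' y)) (at y)" if "y \<in> W \<inter> V" for y
      using has_derivative_transform_within_open[OF W(3) V(1)] that V(3) by auto
    show "continuous_on (W \<inter> V) F'" using W(4) continuous_on_subset by blast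
  qed
qed

text \<open>The local witnesses are different functions. The Frechet derivative is one global
  choice, and uniqueness of derivatives makes it agree with each local witness, so it inherits their
  continuity.\<close>

lemma C1_on_iff_C1_at:
  assumes "open U" shows "C1_on U F \<longleftrightarrow> (\<forall>x\<in>U. C1_at F x)"
proof
  assume L: "\<forall>x\<in>U. C1_at F x"
  define F' where "F' x = Blinfun (frechet_derivative F (at x))" for x
  have F': "F' x = D" if "(F has_derivative blinfun_apply D) (at x)" for x D
    using frechet_derivative_at[OF that] unfolding F'_def by (metis blinfun_apply_inverse)
  have "continuous (at x) F'" if "x \<in> U" for x
  proof -
    have "C1_at F x" using L that by blast
    then obtain W G where W: "open W" "x \<in> W"
      "\<And>y. y \<in> W \<Longrightarrow> (F has_derivative blinfun_apply (G y)) (at y)" "continuous_on W G"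
      by (rule C1_atE) blast
    have "\<forall>y\<in>W. F' y = G y" using W F' by blast
    then have "continuous_on W F'" using W(4) by (simp cong: continuous_on_cong)
    then show ?thesis using W by (simp add: continuous_on_eq_continuous_at)
  qed
  moreover have "(F has_derivative blinfun_apply (F' x)) (at x)" if "x \<in> U" for x
    using L that F' by (metis C1_at_derivative)
  ultimately show "C1_on U F" unfolding C1_on_def
    by (meson continuous_at_imp_continuous_on)
qed (use assms in \<open>auto simp: C1_at_def\<close>)

lemma C1_at_const [simp]: "C1_at (\<lambda>y. c) x"
  by (rule C1_atI[where W=UNIV and F'="\<lambda>_. 0"]) (auto simp: zero_blinfun.rep_eq)

lemma C1_at_linear: assumes "bounded_linear f" shows "C1_at f x"
  by (rule C1_atI[where W=UNIV and F'="\<lambda>_. Blinfun f"])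
    (auto simp: bounded_linear_Blinfun_apply[OF assms] assms intro: bounded_linear_imp_has_derivative)

lemma C1_at_compose:
  assumes F: "C1_at F x" and G: "C1_at G (F x)" shows "C1_at (\<lambda>y. G (F y)) x"
proof -
  obtain W F' where W: "open W" "x \<in> W"
    "\<And>y. y \<in> W \<Longrightarrow> (F has_derivative blinfun_apply (F' y)) (at y)" "continuous_on W F'"
    by (rule C1_atE[OF F]) blast
  obtain V G' where V: "open V" "F x \<in> V"
    "\<And>y. y \<in> V \<Longrightarrow> (G has_derivative blinfun_apply (G' y)) (at y)" "continuous_on V G'"
    by (rule C1_atE[OF G]) blast
  have cF: "continuous_on W F"
    using W(3) by (meson continuous_at_imp_continuous_on has_derivative_continuous)
  let ?X = "W \<inter> F -` V"
  have "open ?X" using W(1) V(1) cF by (metis Int_commute continuous_open_vimage continuous_on_open_vimage)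
  moreover have "((\<lambda>y. G (F y)) has_derivative blinfun_apply (G' (F y) o\<^sub>L F' y)) (at y)" if "y \<in> ?X" for y
    using has_derivative_compose[OF W(3) V(3)] that by (simp add: o_def blinfun_compose.rep_eq)
  moreover have "continuous_on ?X (\<lambda>y. G' (F y) o\<^sub>L F' y)"
    by (intro bounded_bilinear.continuous_on[OF bounded_bilinear_blinfun_compose]
        continuous_on_compose2[OF V(4)] continuous_on_subset[OF cF] continuous_on_subset[OF W(4)]) auto
  ultimately show ?thesis using C1_atI[of ?X x "\<lambda>y. G (F y)" "\<lambda>y. G' (F y) o\<^sub>L F' y"] W V by simp
qed

lemma C1_at_linear_compose: "bounded_linear f \<Longrightarrow> C1_at F x \<Longrightarrow> C1_at (\<lambda>y. f (F y)) x"
  by (rule C1_at_compose[OF _ C1_at_linear])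

lemma C1_at_add:
  assumes F: "C1_at F x" and G: "C1_at G x" shows "C1_at (\<lambda>y. F y + G y) x"
proof -
  obtain W F' where W: "open W" "x \<in> W"
    "\<And>y. y \<in> W \<Longrightarrow> (F has_derivative blinfun_apply (F' y)) (at y)" "continuous_on W F'"
    by (rule C1_atE[OF F]) blast
  obtain V G' where V: "open V" "x \<in> V"
    "\<And>y. y \<in> V \<Longrightarrow> (G has_derivative blinfun_apply (G' y)) (at y)" "continuous_on V G'"
    by (rule C1_atE[OF G]) blast
  show ?thesis
    by (rule C1_atI[where W="W \<inter> V" and F'="\<lambda>y. F' y + G' y"])
      (use W V in \<open>auto simp: plus_blinfun.rep_eq intro!: has_derivative_add continuous_on_add
         intro: continuous_on_subset\<close>)
qed

lemma C1_at_id [simp]: "C1_at (\<lambda>y. y) x"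
  by (rule C1_at_linear) (rule bounded_linear_ident)

lemma C1_at_uminus: "C1_at F x \<Longrightarrow> C1_at (\<lambda>y. - F y) x"
  by (rule C1_at_linear_compose[OF bounded_linear_minus[OF bounded_linear_ident]])

lemma C1_at_diff: "C1_at F x \<Longrightarrow> C1_at G x \<Longrightarrow> C1_at (\<lambda>y. F y - G y) x"
  using C1_at_add[OF _ C1_at_uminus, of F x G] by simp

lemma C1_at_sum: "(\<And>i. i \<in> I \<Longrightarrow> C1_at (F i) x) \<Longrightarrow> C1_at (\<lambda>y. \<Sum>i\<in>I. F i y) x"
  by (induction I rule: infinite_finite_induct) (auto intro: C1_at_add)

lemma C1_at_bilinear:
  assumes B: "bounded_bilinear B" and F: "C1_at F x" and G: "C1_at G x"
  shows "C1_at (\<lambda>y. B (F y) (G y)) x"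
proof -
  interpret bounded_bilinear B by fact
  obtain W F' where W: "open W" "x \<in> W"
    "\<And>y. y \<in> W \<Longrightarrow> (F has_derivative blinfun_apply (F' y)) (at y)" "continuous_on W F'"
    by (rule C1_atE[OF F]) blast
  obtain V G' where V: "open V" "x \<in> V"
    "\<And>y. y \<in> V \<Longrightarrow> (G has_derivative blinfun_apply (G' y)) (at y)" "continuous_on V G'"
    by (rule C1_atE[OF G]) blast
  let ?D = "\<lambda>y. (prod_right (F y) o\<^sub>L G' y) + (prod_left (G y) o\<^sub>L F' y)"
  have cont: "continuous_on W F" "continuous_on V G"
    using W(3) V(3) by (meson continuous_at_imp_continuous_on has_derivative_continuous)+
  show ?thesis
  proof (rule C1_atI[where W="W \<inter> V" and F'="?D"])
    show "((\<lambda>y. B (F y) (G y)) has_derivative blinfun_apply (?D y)) (at y)" if "y \<in> W \<inter> V" for y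
      using FDERIV[OF W(3) V(3)] that by (simp add: plus_blinfun.rep_eq blinfun_compose.rep_eq prod_right.rep_eq prod_left.rep_eq o_def)
    show "continuous_on (W \<inter> V) ?D"
      by (intro continuous_on_add bounded_bilinear.continuous_on[OF bounded_bilinear_blinfun_compose]
        bounded_linear.continuous_on[OF bounded_linear_prod_right]
        bounded_linear.continuous_on[OF bounded_linear_prod_left])
        (use cont W V in \<open>auto intro: continuous_on_subset\<close>)
  qed (use W V in auto)
qed

lemmas C1_at_scaleR = C1_at_bilinear[OF bounded_bilinear_scaleR]
lemmas C1_at_mult = C1_at_bilinear[OF bounded_bilinear_mult]
lemmas C1_at_blinfun_apply = C1_at_bilinear[OF bounded_bilinear_blinfun_apply]

lemma C1_at_real:
  fixes g :: "real \<Rightarrow> real"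
  assumes "open W" "t \<in> W" "\<And>s. s \<in> W \<Longrightarrow> (g has_real_derivative g' s) (at s)" "continuous_on W g'"
  shows "C1_at g t"
proof (rule C1_atI[where W=W and F'="\<lambda>s. blinfun_mult_right (g' s)"])
  show "(g has_derivative blinfun_apply (blinfun_mult_right (g' s))) (at s)" if "s \<in> W" for s
    using assms(3)[OF that] by (simp add: has_field_derivative_def blinfun_mult_right.rep_eq)
  show "continuous_on W (\<lambda>s. blinfun_mult_right (g' s))"
    by (intro bounded_linear.continuous_on[OF bounded_linear_blinfun_mult_right] assms)
qed (use assms in auto)

lemma C1_at_divide:
  fixes F G :: "'a::real_normed_vector \<Rightarrow> real"
  assumes F: "C1_at F x" and G: "C1_at G x" and nz: "G x \<noteq> 0"
  shows "C1_at (\<lambda>y. F y / G y) x"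
proof -
  have "C1_at inverse (G x)"
    by (rule C1_at_real[where W="- {0}" and g'="\<lambda>s. - (inverse s ^ Suc (Suc 0))"])
      (use nz DERIV_inverse[where 'a=real] in \<open>auto intro!: continuous_intros\<close>)
  from C1_at_mult[OF F C1_at_compose[OF G this]] show ?thesis by (simp add: divide_inverse)
qed

lemma C1_at_prod:
  fixes F :: "'i \<Rightarrow> 'a::real_normed_vector \<Rightarrow> real"
  shows "(\<And>i. i \<in> I \<Longrightarrow> C1_at (F i) x) \<Longrightarrow> C1_at (\<lambda>y. \<Prod>i\<in>I. F i y) x"
  by (induction I rule: infinite_finite_induct) (auto intro: C1_at_mult)

lemma C1_at_vec_nth: "C1_at F x \<Longrightarrow> C1_at (\<lambda>y. F y $ i) x"
  for F :: "'a::real_normed_vector \<Rightarrow> real ^ 'n"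
  by (rule C1_at_linear_compose[OF bounded_linear_vec_nth])

lemma C1_at_vec_lambda:
  fixes F :: "'a::real_normed_vector \<Rightarrow> 'n::finite \<Rightarrow> real"
  assumes "\<And>i. C1_at (\<lambda>y. F y i) x" shows "C1_at (\<lambda>y. \<chi> i. F y i) x"
proof -
  have "(\<chi> i. F y i) = (\<Sum>i\<in>UNIV. F y i *\<^sub>R axis i 1)" for y
    by (simp add: vec_eq_iff axis_def if_distrib cong: if_cong)
  then show ?thesis using assms by (auto intro!: C1_at_sum C1_at_scaleR)
qed

section \<open>Piecewise quadratic step functions\<close>

definition sq_pos :: "real \<Rightarrow> real" where "sq_pos u = (max 0 u)\<^sup>2"

lemma sq_pos_derivative: "(sq_pos has_real_derivative 2 * max 0 u) (at u)"
proof -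
  have "((\<lambda>h. (sq_pos (u + h) - sq_pos u) / h) \<longlongrightarrow> 2 * max 0 u) (at 0)"
  proof (rule tendsto_sandwich[of "\<lambda>h. 2 * max 0 u - \<bar>h\<bar>" _ _ "\<lambda>h. 2 * max 0 u + \<bar>h\<bar>"])
    have *: "\<bar>sq_pos (u + h) - sq_pos u - 2 * max 0 u * h\<bar> \<le> h\<^sup>2" for h
    proof -
      consider "u \<le> 0" "u + h \<le> 0" | "u \<le> 0" "u + h > 0" | "u > 0" "u + h > 0" | "u > 0" "u + h \<le> 0"
        by linarith
      then show ?thesis
      proof cases
        case 2
        then have "(u + h)\<^sup>2 \<le> h\<^sup>2" by (intro power_mono) auto
        with 2 show ?thesis by (simp add: sq_pos_def max_def)
      next
        case 4
        have "u * (u + 2 * h) \<le> 0" using 4 by (intro mult_nonneg_nonpos) auto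
        moreover have "0 \<le> (u + h)\<^sup>2" by simp
        ultimately show ?thesis using 4
          by (simp add: sq_pos_def max_def power2_eq_square algebra_simps abs_le_iff)
      qed (auto simp: sq_pos_def max_def power2_eq_square algebra_simps)
    qed
    have **: "\<bar>(sq_pos (u + h) - sq_pos u) / h - 2 * max 0 u\<bar> \<le> \<bar>h\<bar>" if "h \<noteq> 0" for h
    proof -
      have "(sq_pos (u + h) - sq_pos u) / h - 2 * max 0 u = (sq_pos (u + h) - sq_pos u - 2 * max 0 u * h) / h"
        using that by (simp add: field_simps)
      then show ?thesis using *[of h] that
        by (simp add: abs_divide divide_le_eq power2_eq_square abs_mult_self_eq)
    qed
    show "\<forall>\<^sub>F h in at 0. 2 * max 0 u - \<bar>h\<bar> \<le> (sq_pos (u + h) - sq_pos u) / h"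
      "\<forall>\<^sub>F h in at 0. (sq_pos (u + h) - sq_pos u) / h \<le> 2 * max 0 u + \<bar>h\<bar>"
      unfolding eventually_at_filter using ** by (auto intro!: always_eventually simp: abs_le_iff algebra_simps)
  qed (auto intro!: tendsto_eq_intros)
  then show ?thesis by (simp add: DERIV_def)
qed

lemma C1_at_sq_pos: "C1_at F x \<Longrightarrow> C1_at (\<lambda>y. sq_pos (F y)) x"
  by (rule C1_at_compose[OF _ C1_at_real[where W=UNIV and g'="\<lambda>u. 2 * max 0 u"]])
    (auto intro!: continuous_intros simp: sq_pos_derivative)

text \<open>A monotone transition from 0 at \<open>u = 0\<close> to 1 at \<open>u = 1\<close> with
  slope at most 2. The combination of \<open>sq_pos\<close> makes it C1 by closure rules;
  \<open>step_eq\<close> shows the pieces.\<close>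

definition step :: "real \<Rightarrow> real" where
  "step u = 2 * sq_pos u - 4 * sq_pos (u - 1/2) + 2 * sq_pos (u - 1)"

lemma step_eq:
  "step u = (if u \<le> 0 then 0 else if u \<le> 1/2 then 2 * u\<^sup>2 else if u \<le> 1 then 1 - 2 * (1 - u)\<^sup>2 else 1)"
  by (auto simp: step_def sq_pos_def max_def power2_eq_square algebra_simps)

definition step_deriv :: "real \<Rightarrow> real" where
  "step_deriv u = 4 * max 0 u - 8 * max 0 (u - 1/2) + 4 * max 0 (u - 1)"

lemma step_derivative: "(step has_real_derivative step_deriv u) (at u)"
  unfolding step_def step_deriv_def
  by (auto intro!: derivative_eq_intros DERIV_chain2[OF sq_pos_derivative] simp: algebra_simps)

lemma step_deriv_bounds: "0 \<le> step_deriv u" "step_deriv u \<le> 2"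
  by (auto simp: step_deriv_def max_def)

lemma step_deriv_eq_0: "u \<le> 0 \<or> 1 \<le> u \<Longrightarrow> step_deriv u = 0"
  by (auto simp: step_deriv_def max_def)

lemma step_mono: "u \<le> v \<Longrightarrow> step u \<le> step v"
  by (rule DERIV_nonneg_imp_nondecreasing) (use step_derivative step_deriv_bounds in blast)+

lemma step_0 [simp]: "u \<le> 0 \<Longrightarrow> step u = 0" by (simp add: step_eq)
lemma step_1 [simp]: "1 \<le> u \<Longrightarrow> step u = 1" by (auto simp: step_eq)

lemma step_bounds: "0 \<le> step u" "step u \<le> 1"
  using step_mono[of 0 u] step_mono[of u 0] step_mono[of u 1] step_mono[of 1 u] step_0[of u] step_1[of u]
  by (cases "u \<le> 0"; cases "1 \<le> u"; simp)+

lemma C1_at_step: "C1_at F x \<Longrightarrow> C1_at (\<lambda>y. step (F y)) x"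
  unfolding step_def by (intro C1_at_add C1_at_diff C1_at_mult C1_at_sq_pos) auto

text \<open>Differentiation under the integral sign. Joint smoothness makes the partial derivative
  continuous on the product, as the Leibniz rule demands. The limits of integration are fixed, which
  is why smooth minima are later rewritten over a fixed interval.\<close>

lemma C1_at_integral:
  fixes F :: "'a::banach \<Rightarrow> real \<Rightarrow> real"
  assumes W: "open W" "x \<in> W" and F: "\<And>y t. y \<in> W \<Longrightarrow> C1_at (\<lambda>(y, t). F y t) (y, t)"
  shows "C1_at (\<lambda>y. integral {a..b} (F y)) x"
proof -
  have oW: "open (W \<times> (UNIV::real set))" using W by (intro open_Times) auto
  then have "C1_on (W \<times> UNIV) (\<lambda>(y, t). F y t)" using F by (auto simp: C1_on_iff_C1_at)
  then obtain F' where F': "\<And>z. z \<in> W \<times> UNIV \<Longrightarrow> ((\<lambda>(y, t). F y t) has_derivative blinfun_apply (F' z)) (at z)"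
    "continuous_on (W \<times> UNIV) F'" unfolding C1_on_def by blast
  define J :: "'a \<Rightarrow>\<^sub>L ('a \<times> real)" where "J = Blinfun (\<lambda>h. (h, 0))"
  have J: "blinfun_apply J h = (h, 0)" for h
    unfolding J_def by (subst bounded_linear_Blinfun_apply) (auto intro!: bounded_linear_intros)
  define D where "D y t = F' (y, t) o\<^sub>L J" for y t
  have D: "((\<lambda>y. F y t) has_derivative blinfun_apply (D y t)) (at y)" if "y \<in> W" for y t
  proof -
    have "((\<lambda>y. (y, t)) has_derivative (\<lambda>h. (h, 0))) (at y)"
      by (auto intro!: derivative_eq_intros)
    from has_derivative_compose[OF this F'(1)] that
    show ?thesis by (simp add: D_def o_def J blinfun_compose.rep_eq)
  qed
  have contD: "continuous_on (W \<times> cbox a b) (\<lambda>(y, t). D y t)"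
    unfolding D_def split_beta
    by (intro bounded_bilinear.continuous_on[OF bounded_bilinear_blinfun_compose] continuous_on_const
        continuous_on_compose2[OF F'(2)]) (auto intro!: continuous_intros)
  obtain r where r: "r > 0" "ball x r \<subseteq> W" using W open_contains_ball by blast
  show ?thesis
  proof (rule C1_atI[where W="ball x r" and F'="\<lambda>y. integral {a..b} (D y)"])
    fix y assume y: "y \<in> ball x r"
    have "((\<lambda>y. integral (cbox a b) (F y)) has_derivative integral (cbox a b) (D y)) (at y within ball x r)"
    proof (rule leibniz_rule)
      show "((\<lambda>y. F y t) has_derivative blinfun_apply (D y t)) (at y within ball x r)" if "y \<in> ball x r" for y t
        using D r that has_derivative_at_withinI by blast
      show "F y integrable_on cbox a b" if "y \<in> ball x r" for y
      proof (rule integrable_continuous)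
        have "continuous_on UNIV (\<lambda>t. (\<lambda>(y, t). F y t) (y, t))"
          by (rule continuous_on_compose2[OF C1_at_continuous_on[of "W \<times> UNIV"]])
            (use F r that in \<open>auto intro!: continuous_intros\<close>)
        then show "continuous_on (cbox a b) (F y)" using continuous_on_subset by auto
      qed
      show "continuous_on (ball x r \<times> cbox a b) (\<lambda>(x, t). D x t)"
        by (rule continuous_on_subset[OF contD]) (use r in auto)
    qed (use y in auto)
    then show "((\<lambda>y. integral {a..b} (F y)) has_derivative blinfun_apply (integral {a..b} (D y))) (at y)"
      using y by (simp add: at_within_open[of y "ball x r"])
  next
    have "continuous_on W (\<lambda>y. integral (cbox a b) (D y))"
      by (rule integral_continuous_on_param[OF contD])
    then show "continuous_on (ball x r) (\<lambda>y. integral {a..b} (D y))"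
      using r continuous_on_subset by auto
  qed (use r in auto)
qed

section \<open>A smooth minimum\<close>

text \<open>A smoothed indicator of the times below all \<open>v j\<close>: it is 1 as long as
  \<open>t\<close> stays below each \<open>v j\<close> by the width \<open>k j\<close>, and 0 once
  \<open>t\<close> reaches one of them.\<close>

definition cutoff :: "'i set \<Rightarrow> ('i \<Rightarrow> real) \<Rightarrow> ('i \<Rightarrow> real) \<Rightarrow> real \<Rightarrow> real" where
  "cutoff J v k t = (\<Prod>j\<in>J. step ((v j - t) / k j))"

text \<open>The integral \<open>\<integral> cutoff J v k\<close> over a large interval, measured from its left end: the
  product of indicator functions of \<open>{t. t < v j}\<close> would give exactly \<open>Min (v ` J)\<close>. The product
  form yields the supermodularity used in \<open>softmin_supermodular\<close>, which iterated binary smooth minima lack.\<close>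

definition softmin :: "'i set \<Rightarrow> ('i \<Rightarrow> real) \<Rightarrow> ('i \<Rightarrow> real) \<Rightarrow> real" where
  "softmin J v k = (let M = (\<Sum>j\<in>J. \<bar>v j\<bar> + \<bar>k j\<bar>) in integral {-M..M} (cutoff J v k) - M)"

lemma cutoff_bounds: "0 \<le> cutoff J v k t" "cutoff J v k t \<le> 1"
  unfolding cutoff_def by (auto intro!: prod_nonneg prod_le_1 step_bounds)

lemma cutoff_eq_0: "finite J \<Longrightarrow> i \<in> J \<Longrightarrow> k i > 0 \<Longrightarrow> v i \<le> t \<Longrightarrow> cutoff J v k t = 0"
  unfolding cutoff_def by (rule prod_zero) (auto intro!: bexI[of _ i] step_0 simp: divide_nonpos_pos)

lemma cutoff_eq_1: "(\<And>j. j \<in> J \<Longrightarrow> k j > 0 \<and> t \<le> v j - k j) \<Longrightarrow> cutoff J v k t = 1"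
  unfolding cutoff_def by (rule prod.neutral) (force intro!: step_1 simp: le_divide_eq)

lemma cutoff_Un: "finite J \<Longrightarrow> finite K \<Longrightarrow> J \<inter> K = {} \<Longrightarrow> cutoff (J \<union> K) v k t = cutoff J v k t * cutoff K v k t"
  unfolding cutoff_def by (rule prod.union_disjoint)

lemma cutoff_cong: "(\<And>j. j \<in> J \<Longrightarrow> v j = w j \<and> k j = l j) \<Longrightarrow> cutoff J v k t = cutoff J w l t"
  unfolding cutoff_def by (rule prod.cong) auto

lemma cutoff_mono:
  "(\<And>j. j \<in> J \<Longrightarrow> k j > 0 \<and> v j \<le> w j) \<Longrightarrow> cutoff J v k t \<le> cutoff J w k t"
  unfolding cutoff_def by (rule prod_mono) (force intro!: step_bounds step_mono divide_right_mono)

lemma cutoff_superset: "finite K \<Longrightarrow> J \<subseteq> K \<Longrightarrow> cutoff K v k t \<le> cutoff J v k t"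
  using cutoff_Un[of J "K - J" v k t] cutoff_bounds[of J v k t] cutoff_bounds[of "K - J" v k t]
  by (auto simp: Un_absorb1 finite_subset intro: mult_right_le_one_le)

lemma continuous_on_step [continuous_intros]: "continuous_on S f \<Longrightarrow> continuous_on S (\<lambda>t. step (f t))"
  by (rule continuous_on_compose2[of UNIV step])
    (auto intro!: DERIV_isCont[OF step_derivative] continuous_at_imp_continuous_on)

lemma continuous_on_cutoff: "(\<And>j. j \<in> J \<Longrightarrow> k j > 0) \<Longrightarrow> continuous_on S (cutoff J v k)"
  unfolding cutoff_def by (intro continuous_intros) force

lemma integrable_cutoff: "(\<And>j. j \<in> J \<Longrightarrow> k j > 0) \<Longrightarrow> cutoff J v k integrable_on {a..b}"
  by (intro integrable_continuous_real continuous_on_cutoff)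

lemma integral_cutoff_extend:
  assumes J: "finite J" "i \<in> J" "\<And>j. j \<in> J \<Longrightarrow> k j > 0 \<and> a \<le> v j - k j"
    and b: "v i \<le> b" and cd: "c \<le> a" "b \<le> d"
  shows "integral {c..d} (cutoff J v k) = a - c + integral {a..b} (cutoff J v k)"
proof -
  have ab: "a \<le> b" using J(2) J(3)[of i] b by force
  have "integral {c..a} (cutoff J v k) = integral {c..a} (\<lambda>_. 1)"
    by (rule integral_cong) (use J in \<open>auto intro!: cutoff_eq_1; force\<close>)
  moreover have "integral {b..d} (cutoff J v k) = integral {b..d} (\<lambda>_. 0)"
    by (rule integral_cong) (use J b in \<open>auto intro!: cutoff_eq_0[of J i]\<close>)
  moreover have "integral {c..a} (cutoff J v k) + integral {a..d} (cutoff J v k) = integral {c..d} (cutoff J v k)"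
    "integral {a..b} (cutoff J v k) + integral {b..d} (cutoff J v k) = integral {a..d} (cutoff J v k)"
    by (rule Henstock_Kurzweil_Integration.integral_combine;
      use ab cd J in \<open>auto intro!: integrable_cutoff\<close>)+
  ultimately show ?thesis using cd by simp
qed

text \<open>Left of \<open>a\<close> the integrand is 1 and right of \<open>b\<close> it is 0. This
  removes the data-dependent interval of the definition, so that different data can be compared, and
  differentiated, over one interval.\<close>

lemma softmin_eq:
  assumes J: "finite J" "i \<in> J" "\<And>j. j \<in> J \<Longrightarrow> k j > 0 \<and> a \<le> v j - k j" and b: "v i \<le> b"
  shows "softmin J v k = a + integral {a..b} (cutoff J v k)"
proof -
  define M :: real where "M = (\<Sum>j\<in>J. \<bar>v j\<bar> + \<bar>k j\<bar>)"
  have M: "\<bar>v j\<bar> + \<bar>k j\<bar> \<le> M" if "j \<in> J" for j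
    unfolding M_def by (rule member_le_sum) (use that J in auto)
  have kv: "k j > 0 \<and> -M \<le> v j - k j" if "j \<in> J" for j
    using M[OF that] J(3)[OF that] by linarith
  have "v i \<le> M" using M[OF J(2)] by linarith
  let ?c = "min a (-M)" and ?d = "max b M"
  have "integral {?c..?d} (cutoff J v k) = a - ?c + integral {a..b} (cutoff J v k)"
    by (rule integral_cutoff_extend[of J i k a v b]) (use J b in auto)
  moreover have "integral {?c..?d} (cutoff J v k) = -M - ?c + integral {-M..M} (cutoff J v k)"
    by (rule integral_cutoff_extend[of J i k "-M" v M]) (use J kv \<open>v i \<le> M\<close> in auto)
  ultimately show ?thesis unfolding softmin_def Let_def M_def[symmetric] by linarith
qed

lemma softmin_window:
  fixes v k :: "'i \<Rightarrow> real"
  assumes "finite J" "i \<in> J" "\<And>j. j \<in> J \<Longrightarrow> k j > 0"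
  obtains a b where "\<And>j. j \<in> J \<Longrightarrow> a \<le> v j - k j" "a \<le> L" "v i \<le> b" "U \<le> b"
proof
  let ?M = "\<Sum>j\<in>J. \<bar>v j\<bar> + \<bar>k j\<bar>"
  show "min L (- ?M) \<le> v j - k j" if "j \<in> J" for j
    using member_le_sum[of j J "\<lambda>j. \<bar>v j\<bar> + \<bar>k j\<bar>"] that assms by auto
qed (rule min.cobounded1, rule max.cobounded1, rule max.cobounded2)

lemma softmin_le:
  assumes "finite J" "i \<in> J" "\<And>j. j \<in> J \<Longrightarrow> k j > 0"
  shows "softmin J v k \<le> v i"
proof -
  obtain a where a: "\<And>j. j \<in> J \<Longrightarrow> a \<le> v j - k j"
    by (rule softmin_window[where J=J and i=i and k=k and v=v and L=0 and U=0]) (use assms in auto)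
  have "a \<le> v i" using a[of i] assms(2) assms(3)[of i] by fastforce
  have "integral {a..v i} (cutoff J v k) \<le> integral {a..v i} (\<lambda>_. 1)"
    by (intro integral_le integrable_cutoff) (use assms cutoff_bounds in auto)
  then show ?thesis
    using softmin_eq[OF assms(1,2), of k a v "v i"] a assms \<open>a \<le> v i\<close> by simp
qed

lemma softmin_ge:
  assumes J: "finite J" "i \<in> J" "\<And>j. j \<in> J \<Longrightarrow> k j > 0 \<and> m \<le> v j - k j"
  shows "m \<le> softmin J v k"
proof -
  have "0 \<le> integral {m..v i} (cutoff J v k)"
    by (intro integral_nonneg integrable_cutoff) (use assms cutoff_bounds in auto)
  then show ?thesis using softmin_eq[of J i k m v "v i"] J by simp
qed

text \<open>An order between integrands, up to a translation by \<open>d\<close>, passes to the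
  integrals over a common interval. Most comparisons of smooth minima reduce to this.\<close>

lemma softmin_cutoff_le:
  assumes J: "finite J" "i \<in> J" "\<And>j. j \<in> J \<Longrightarrow> k j > 0"
    and J': "finite J'" "i' \<in> J'" "\<And>j. j \<in> J' \<Longrightarrow> k' j > 0"
    and le: "\<And>t. cutoff J v k t \<le> cutoff J' v' k' (t - d)"
  shows "softmin J v k \<le> softmin J' v' k' + d"
proof -
  obtain a0 b0 where ab0: "\<And>j. j \<in> J \<Longrightarrow> a0 \<le> v j - k j" "v i \<le> b0"
    by (rule softmin_window[where J=J and i=i and k=k and v=v and L=0 and U=0]) (use J in auto)
  obtain a1 b1 where ab1: "\<And>j. j \<in> J' \<Longrightarrow> a1 \<le> v' j - k' j" "a1 \<le> a0 - d" "v' i' \<le> b1" "b0 - d \<le> b1"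
    by (rule softmin_window[where J=J' and i=i' and k=k' and v=v' and L="a0 - d" and U="b0 - d"]) (use J' in auto)
  let ?a = "a1 + d" and ?b = "b1 + d"
  have 1: "softmin J v k = ?a + integral {?a..?b} (cutoff J v k)"
  proof (rule softmin_eq[OF J(1,2)])
    show "0 < k j \<and> ?a \<le> v j - k j" if "j \<in> J" for j using ab0(1)[OF that] ab1(2) J(3)[OF that] by linarith
    show "v i \<le> ?b" using ab0 ab1 by linarith
  qed
  have 2: "softmin J' v' k' = a1 + integral {a1..b1} (cutoff J' v' k')"
    by (rule softmin_eq[OF J'(1,2)]) (use ab1 J' in auto)
  have "integral {?a..?b} (cutoff J v k) \<le> integral {?a..?b} (\<lambda>t. cutoff J' v' k' (t - d))"
    by (intro integral_le integrable_cutoff integrable_continuous_real le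
        continuous_on_compose2[OF continuous_on_cutoff[of J' k' UNIV v']])
      (use J J' in \<open>auto intro!: continuous_intros\<close>)
  also have "\<dots> = integral {a1..b1} (cutoff J' v' k')"
    using integral_shift[of "?a" "-d" "?b" "cutoff J' v' k'"] continuous_on_cutoff[of J' k'] J'
    by (simp add: o_def)
  finally show ?thesis using 1 2 by simp
qed

lemma softmin_shift:
  assumes J: "finite J" "i \<in> J" "\<And>j. j \<in> J \<Longrightarrow> k j > 0 \<and> k' j > 0"
    and d: "\<And>j. j \<in> J \<Longrightarrow> v j - v' j + \<bar>k j - k' j\<bar> \<le> d"
  shows "softmin J v k \<le> softmin J v' k' + d"
proof (rule softmin_cutoff_le[OF J(1,2) _ J(1,2)])
  fix t
  \<comment> \<open>Only ratios between 0 and 1 matter. There, replacing the width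
    \<open>k j\<close> by \<open>k' j\<close> moves the ratio times the width by at most the
    difference of the widths, hence the form of \<open>d\<close>.\<close>
  have "step ((v j - t) / k j) \<le> step ((v' j - (t - d)) / k' j)" if j: "j \<in> J" for j
  proof -
    let ?r = "(v j - t) / k j"
    have k: "k j > 0" "k' j > 0" using J(3)[OF j] by auto
    have r: "v j - t = ?r * k j" using k by simp
    have "v' j - (t - d) \<ge> ?r * k j + \<bar>k j - k' j\<bar>" using d[OF j] r by linarith
    moreover have "?r \<le> 1 \<Longrightarrow> 0 \<le> ?r \<Longrightarrow> ?r * (k' j - k j) \<le> \<bar>k j - k' j\<bar>"
      by (smt (verit) mult_left_le_one_le mult_nonneg_nonpos)
    moreover have "?r > 1 \<Longrightarrow> ?r * k j \<ge> k j" using k by simp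
    ultimately consider "?r \<le> 0" | "?r * k' j \<le> v' j - (t - d)" | "v' j - (t - d) \<ge> k' j"
      by (cases "?r \<le> 0"; cases "?r \<le> 1") (auto simp: right_diff_distrib)
    then show ?thesis by cases (use k in \<open>auto intro!: step_mono simp: step_bounds le_divide_eq\<close>)
  qed
  then show "cutoff J v k t \<le> cutoff J v' k' (t - d)"
    unfolding cutoff_def by (intro prod_mono) (auto intro: step_bounds)
qed (use J in auto)

lemma softmin_superset:
  assumes "finite K" "J \<subseteq> K" "i \<in> J" "\<And>j. j \<in> K \<Longrightarrow> k j > 0"
  shows "softmin K v k \<le> softmin J v k"
  using softmin_cutoff_le[of K i k J i k v v 0] cutoff_superset[of K J v k] assms
  by (auto intro: finite_subset)

text \<open>Where the factor of \<open>i\<close> is nonzero, \<open>t\<close> lies below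
  \<open>v i\<close>, hence below \<open>v j - k j\<close>, and the factor of \<open>j\<close> is
  already 1. The equality is exact, so an index set that varies with the point can be traded for a
  locally constant one.\<close>

lemma softmin_drop:
  assumes K: "finite K" "J \<subseteq> K" "i \<in> J" "\<And>j. j \<in> K \<Longrightarrow> k j > 0"
    and d: "\<And>j. j \<in> K - J \<Longrightarrow> v i \<le> v j - k j"
  shows "softmin K v k = softmin J v k"
proof (rule antisym[OF softmin_superset[OF K]])
  have fin: "finite J" using K finite_subset by blast
  have "cutoff J v k t \<le> cutoff K v k t" for t
  proof (cases "v i \<le> t")
    case True
    then show ?thesis using cutoff_eq_0[OF fin K(3)] K cutoff_bounds by (metis subsetD)
  next
    case False
    have "cutoff (K - J) v k t = 1" by (rule cutoff_eq_1) (use d K False in force)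
    then show ?thesis using cutoff_Un[of J "K - J" v k t] fin K by (simp add: Un_absorb1)
  qed
  then show "softmin J v k \<le> softmin K v k"
    using softmin_cutoff_le[of J i k K i k v v 0] K fin by (auto simp: subset_iff)
qed

text \<open>Raising the entries on \<open>J\<close> and shrinking it to \<open>J'\<close> increases
  the integrand; the common factors of \<open>K\<close>, which lie between 0 and 1, can only damp
  that increase. So more competitors mean a smaller rise.\<close>

lemma softmin_supermodular:
  assumes J: "finite J" "J' \<subseteq> J" "i \<in> J'" and K: "finite K" "J \<inter> K = {}"
    and k: "\<And>j. j \<in> J \<union> K \<Longrightarrow> k j > 0"
    and v: "\<And>j. j \<in> J' \<Longrightarrow> v j \<le> w j" "\<And>j. j \<in> K \<Longrightarrow> v j = w j"
  shows "softmin (J' \<union> K) w k - softmin (J \<union> K) v k \<le> softmin J' w k - softmin J v k"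
    "softmin J v k \<le> softmin J' w k"
proof -
  have fJ': "finite J'" using J finite_subset by blast
  obtain a b0 where a: "\<And>j. j \<in> J \<union> K \<Longrightarrow> a \<le> v j - k j" "v i \<le> b0"
    by (rule softmin_window[where J="J \<union> K" and i=i and k=k and v=v and L=0 and U=0]) (use J K k in auto)
  define b where "b = max b0 (w i)"
  have a': "a \<le> w j - k j" if "j \<in> J' \<union> K" for j
    using a(1)[of j] v(1)[of j] v(2)[of j] J that by auto
  have e: "softmin (J \<union> K) v k = a + integral {a..b} (cutoff (J \<union> K) v k)"
     "softmin (J' \<union> K) w k = a + integral {a..b} (cutoff (J' \<union> K) w k)"
     "softmin J v k = a + integral {a..b} (cutoff J v k)"
     "softmin J' w k = a + integral {a..b} (cutoff J' w k)"
    by (rule softmin_eq[where i=i]; use a a' J K k fJ' in \<open>auto simp: b_def le_max_iff_disj\<close>)+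
  have i: "cutoff (J \<union> K) v k integrable_on {a..b}" "cutoff (J' \<union> K) w k integrable_on {a..b}"
     "cutoff J v k integrable_on {a..b}" "cutoff J' w k integrable_on {a..b}"
    by (rule integrable_cutoff; use k J in auto)+
  have le: "cutoff J v k t \<le> cutoff J' w k t" for t
    using cutoff_superset[OF J(1,2), of v k t] cutoff_mono[of J' k v w t] v k J by (smt (verit) UnCI subsetD)
  then have "integral {a..b} (cutoff J v k) \<le> integral {a..b} (cutoff J' w k)"
    by (intro integral_le i)
  then show "softmin J v k \<le> softmin J' w k" using e by simp
  have "cutoff (J' \<union> K) w k t - cutoff (J \<union> K) v k t \<le> cutoff J' w k t - cutoff J v k t" for t
  proof -
    have "cutoff K w k t = cutoff K v k t" by (rule cutoff_cong) (use v in auto)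
    then have "cutoff (J' \<union> K) w k t - cutoff (J \<union> K) v k t = (cutoff J' w k t - cutoff J v k t) * cutoff K v k t"
      using J K fJ' by (subst (1 2) cutoff_Un) (auto simp: algebra_simps)
    then show ?thesis using le[of t] cutoff_bounds[of K v k t] by (simp add: mult_left_le)
  qed
  then have "integral {a..b} (\<lambda>t. cutoff (J' \<union> K) w k t - cutoff (J \<union> K) v k t)
    \<le> integral {a..b} (\<lambda>t. cutoff J' w k t - cutoff J v k t)"
    by (intro integral_le integrable_diff i)
  then show "softmin (J' \<union> K) w k - softmin (J \<union> K) v k \<le> softmin J' w k - softmin J v k"
    using e i by (simp add: integral_diff)
qed

lemma C1_at_softmin:
  fixes v k :: "'i \<Rightarrow> 'a::banach \<Rightarrow> real"
  assumes J: "finite J" "i \<in> J" and C: "\<And>j. j \<in> J \<Longrightarrow> C1_at (v j) x" "\<And>j. j \<in> J \<Longrightarrow> C1_at (k j) x"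
    and k: "\<And>j. j \<in> J \<Longrightarrow> k j x > 0"
  shows "C1_at (\<lambda>y. softmin J (\<lambda>j. v j y) (\<lambda>j. k j y)) x"
proof -
  obtain a0 where a0: "\<And>j. j \<in> J \<Longrightarrow> a0 \<le> v j x - k j x"
    by (rule softmin_window[where J=J and i=i and k="\<lambda>j. k j x" and v="\<lambda>j. v j x" and L=0 and U=0]) (use J k in auto)
  \<comment> \<open>The margin 1 keeps the interval valid at all points near \<open>x\<close>, so
    that a single one serves for the parametric integral.\<close>
  define a b where "a = a0 - 1" and "b = v i x + 1"
  define P where "P y \<longleftrightarrow> (\<forall>j\<in>J. C1_at (v j) y \<and> C1_at (k j) y \<and> k j y > 0 \<and> a < v j y - k j y) \<and> v i y < b" for y
  have ev: "\<forall>\<^sub>F y in nhds x. P y"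
    unfolding P_def
  proof (intro eventually_conj eventually_ball_finite ballI J)
    fix j assume j: "j \<in> J"
    show "\<forall>\<^sub>F y in nhds x. k j y > 0" "\<forall>\<^sub>F y in nhds x. a < v j y - k j y"
      by (rule order_tendstoD[OF C1_at_tendsto]; use j C k a0[OF j] in \<open>auto simp: a_def intro!: C1_at_diff\<close>)+
  qed (use C1_at_eventually C J in \<open>auto simp: b_def intro!: order_tendstoD[OF C1_at_tendsto]\<close>)
  then obtain W where W: "open W" "x \<in> W" "\<And>y. y \<in> W \<Longrightarrow> P y" unfolding eventually_nhds by blast
  have "C1_at (\<lambda>y. a + integral {a..b} (cutoff J (\<lambda>j. v j y) (\<lambda>j. k j y))) x"
  proof (intro C1_at_add C1_at_const C1_at_integral[OF W(1,2)])
    fix y and t :: real assume y: "y \<in> W"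
    have fst: "C1_at (\<lambda>z. g (fst z)) (y, t)" if "C1_at g y" for g :: "'a \<Rightarrow> real"
      by (rule C1_at_compose[of fst]) (use that in \<open>auto intro!: C1_at_linear bounded_linear_fst\<close>)
    have snd: "C1_at snd (y, t)" by (intro C1_at_linear bounded_linear_snd)
    show "C1_at (\<lambda>(y, t). cutoff J (\<lambda>j. v j y) (\<lambda>j. k j y) t) (y, t)"
      unfolding cutoff_def split_beta
      by (intro C1_at_prod C1_at_step C1_at_divide C1_at_diff fst snd)
        (use W(3)[OF y] in \<open>auto simp: P_def\<close>)
  qed
  then show ?thesis
  proof (rule C1_at_cong)
    show "\<forall>\<^sub>F y in nhds x. a + integral {a..b} (cutoff J (\<lambda>j. v j y) (\<lambda>j. k j y))
      = softmin J (\<lambda>j. v j y) (\<lambda>j. k j y)"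
      using ev
    proof eventually_elim
      case (elim y)
      show ?case
        by (rule softmin_eq[symmetric, OF J]) (use elim in \<open>auto simp: P_def intro: less_imp_le\<close>)
    qed
  qed
qed

section \<open>Pointwise Lipschitz estimates and derivatives\<close>

text \<open>An upper bound for the limsup of difference quotients at the single point
  \<open>x\<close>. It passes through smooth minima without a formula for their derivative and
  bounds the derivative wherever one exists.\<close>

definition calm :: "('a::real_normed_vector \<Rightarrow> 'b::real_normed_vector) \<Rightarrow> 'a \<Rightarrow> real \<Rightarrow> bool" where
  "calm F x K \<longleftrightarrow> (\<forall>k>K. \<forall>\<^sub>F y in nhds x. norm (F y - F x) \<le> k * norm (y - x))"

lemma calm_const [simp]: "0 \<le> K \<Longrightarrow> calm (\<lambda>y. c) x K"
  by (simp add: calm_def)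

lemma calm_mono: "calm F x K \<Longrightarrow> K \<le> L \<Longrightarrow> calm F x L"
  by (auto simp: calm_def)

lemma calm_uminus: "calm F x K \<Longrightarrow> calm (\<lambda>y. - F y) x K"
  by (simp add: calm_def norm_minus_commute)

lemma calm_add:
  assumes "calm F x K" "calm G x L" shows "calm (\<lambda>y. F y + G y) x (K + L)"
  unfolding calm_def
proof (intro allI impI)
  fix k assume k: "K + L < k"
  define d where "d = (k - (K + L)) / 2"
  have "K < K + d" "L < L + d" using k by (auto simp: d_def)
  then have "\<forall>\<^sub>F y in nhds x. norm (F y - F x) \<le> (K + d) * norm (y - x) \<and> norm (G y - G x) \<le> (L + d) * norm (y - x)"
    using assms unfolding calm_def by (auto intro: eventually_conj)
  then show "\<forall>\<^sub>F y in nhds x. norm (F y + G y - (F x + G x)) \<le> k * norm (y - x)"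
  proof eventually_elim
    case (elim y)
    have "norm (F y + G y - (F x + G x)) \<le> norm (F y - F x) + norm (G y - G x)"
      by (metis add_diff_add norm_triangle_ineq)
    also have "\<dots> \<le> (K + d + (L + d)) * norm (y - x)" using elim by (simp add: algebra_simps)
    also have "K + d + (L + d) = k" by (simp add: d_def field_simps)
    finally show ?case .
  qed
qed

lemma calm_diff: "calm F x K \<Longrightarrow> calm G x L \<Longrightarrow> calm (\<lambda>y. F y - G y) x (K + L)"
  using calm_add[OF _ calm_uminus, of F x K G L] by simp

lemma calm_sum: "(\<And>i. i \<in> I \<Longrightarrow> calm (F i) x (K i)) \<Longrightarrow> calm (\<lambda>y. \<Sum>i\<in>I. F i y) x (\<Sum>i\<in>I. K i)"
  by (induction I rule: infinite_finite_induct) (auto intro: calm_add)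

lemma calm_cong:
  assumes "calm F x K" "\<forall>\<^sub>F y in nhds x. F y = G y" shows "calm G x K"
proof -
  have [simp]: "F x = G x" using assms(2) eventually_nhds_x_imp_x by blast
  show ?thesis
    unfolding calm_def
  proof (intro allI impI)
    fix k assume "K < k"
    then have "\<forall>\<^sub>F y in nhds x. norm (F y - F x) \<le> k * norm (y - x)" using assms(1) by (simp add: calm_def)
    then show "\<forall>\<^sub>F y in nhds x. norm (G y - G x) \<le> k * norm (y - x)"
      using assms(2) by eventually_elim simp
  qed
qed

lemma calm_tendsto: assumes "calm F x K" shows "(F \<longlongrightarrow> F x) (nhds x)"
proof -
  have ev: "\<forall>\<^sub>F y in nhds x. norm (F y - F x) \<le> (K + 1) * norm (y - x)"
    using assms by (simp add: calm_def)
  have "((\<lambda>y. (K + 1) * norm (y - x)) \<longlongrightarrow> (K + 1) * norm (x - x)) (nhds x)"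
    by (intro tendsto_intros filterlim_ident)
  then have "((\<lambda>y. (K + 1) * norm (y - x)) \<longlongrightarrow> 0) (nhds x)" by simp
  then have "((\<lambda>y. F y - F x) \<longlongrightarrow> 0) (nhds x)"
    by (rule Lim_null_comparison[OF ev])
  then show ?thesis by (rule LIM_zero_cancel)
qed

lemma calm_compose:
  assumes F: "calm F x K" "0 \<le> K" and G: "calm G (F x) L" "0 \<le> L"
  shows "calm (\<lambda>y. G (F y)) x (L * K)"
  unfolding calm_def
proof (intro allI impI)
  fix k assume k: "L * K < k"
  obtain d where d: "d > 0" "(L + d) * (K + d) \<le> k"
  proof -
    have "((\<lambda>d. (L + d) * (K + d)) \<longlongrightarrow> (L + 0) * (K + 0)) (at_right 0)" by (intro tendsto_intros)
    then have "\<forall>\<^sub>F d in at_right 0. (L + d) * (K + d) < k" using order_tendstoD(2) k by fastforce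
    then have "\<forall>\<^sub>F d in at_right 0. (L + d) * (K + d) < k \<and> d > 0"
      by (intro eventually_conj) (auto simp: eventually_at_right_less)
    then obtain d where "(L + d) * (K + d) < k \<and> d > 0"
      using eventually_happens trivial_limit_at_right_real by blast
    then show ?thesis using that[of d] by simp
  qed
  have "\<forall>\<^sub>F z in nhds (F x). norm (G z - G (F x)) \<le> (L + d) * norm (z - F x)" using G d by (simp add: calm_def)
  then have "\<forall>\<^sub>F y in nhds x. norm (G (F y) - G (F x)) \<le> (L + d) * norm (F y - F x)"
    using calm_tendsto[OF F(1)] unfolding filterlim_iff by blast
  moreover have "\<forall>\<^sub>F y in nhds x. norm (F y - F x) \<le> (K + d) * norm (y - x)" using F d by (simp add: calm_def)
  ultimately show "\<forall>\<^sub>F y in nhds x. norm (G (F y) - G (F x)) \<le> k * norm (y - x)"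
  proof eventually_elim
    case (elim y)
    note elim(1)
    also have "(L + d) * norm (F y - F x) \<le> (L + d) * ((K + d) * norm (y - x))"
      using elim(2) G d by (intro mult_left_mono) auto
    also have "\<dots> \<le> k * norm (y - x)"
      using d by (simp add: mult.assoc[symmetric] mult_right_mono)
    finally show ?case .
  qed
qed

lemma calm_of_derivative:
  assumes D: "(F has_derivative D) (at x)" and K: "\<And>h. norm (D h) \<le> K * norm h"
  shows "calm F x K"
  unfolding calm_def
proof (intro allI impI)
  fix k assume k: "K < k"
  have "\<exists>d>0. \<forall>y. norm (y - x) < d \<longrightarrow> norm (F y - F x - D (y - x)) \<le> (k - K) * norm (y - x)"
    using D k by (simp add: has_derivative_at_alt)
  then obtain d where d: "d > 0" "\<And>y. norm (y - x) < d \<Longrightarrow> norm (F y - F x - D (y - x)) \<le> (k - K) * norm (y - x)"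
    by blast
  show "\<forall>\<^sub>F y in nhds x. norm (F y - F x) \<le> k * norm (y - x)"
    unfolding eventually_nhds_metric dist_norm
  proof (intro exI[of _ d] conjI allI impI d)
    fix y assume "norm (y - x) < d"
    from d(2)[OF this] K[of "y - x"] norm_triangle_sub[of "F y - F x" "D (y - x)"]
    show "norm (F y - F x) \<le> k * norm (y - x)" by (simp add: algebra_simps)
  qed
qed

lemma calm_Lipschitz: "(\<And>y. norm (F y - F x) \<le> K * norm (y - x)) \<Longrightarrow> calm F x K"
  unfolding calm_def
  by (intro allI impI always_eventually) (meson less_imp_le mult_right_mono norm_ge_zero order_trans)


text \<open>The derivative of a smooth minimum is never computed. Growth along a ray, which follows
  from monotonicity, is enough to bound it from below.\<close>

lemma derivative_ge:
  fixes F :: "'a::real_normed_vector \<Rightarrow> real"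
  assumes D: "(F has_derivative D) (at x)"
    and ge: "\<forall>\<^sub>F t in at_right 0. t * c \<le> F (x + t *\<^sub>R h) - F x"
  shows "c \<le> D h"
proof -
  have "((\<lambda>t. x + t *\<^sub>R h) has_derivative (\<lambda>t. t *\<^sub>R h)) (at 0 within {0<..})"
    by (auto intro!: derivative_eq_intros)
  from has_derivative_compose[OF this, of F D] D
  have "((\<lambda>t. F (x + t *\<^sub>R h)) has_derivative (\<lambda>t. D (t *\<^sub>R h))) (at 0 within {0<..})" by simp
  moreover have "(\<lambda>t. D (t *\<^sub>R h)) = (*) (D h)"
    using has_derivative_bounded_linear[OF D] by (auto simp: linear_cmul bounded_linear.linear)
  ultimately have "((\<lambda>t. F (x + t *\<^sub>R h)) has_field_derivative D h) (at 0 within {0<..})"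
    by (simp add: has_field_derivative_def)
  then have "((\<lambda>t. (F (x + t *\<^sub>R h) - F x) / t) \<longlongrightarrow> D h) (at_right 0)"
    by (simp add: has_field_derivative_iff)
  moreover have "\<forall>\<^sub>F t in at_right 0. c \<le> (F (x + t *\<^sub>R h) - F x) / t"
    using ge eventually_at_right_less[of 0] by eventually_elim (simp add: le_divide_eq mult.commute)
  ultimately show ?thesis by (rule tendsto_lowerbound) simp
qed

lemma derivative_0:
  fixes F :: "'a::real_normed_vector \<Rightarrow> real"
  assumes "(F has_derivative D) (at x)" "\<And>s. F (x + s *\<^sub>R h) = F x" shows "D h = 0"
proof -
  have "0 \<le> D h" by (rule derivative_ge[OF assms(1)]) (simp add: assms(2))
  moreover have "((\<lambda>y. - F y) has_derivative (\<lambda>h. - D h)) (at x)" by (rule has_derivative_minus[OF assms(1)])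
  then have "0 \<le> - D h" by (rule derivative_ge) (simp add: assms(2))
  ultimately show ?thesis by simp
qed

lemma calm_derivative:
  assumes D: "(F has_derivative D) (at x)" and K: "calm F x K"
  shows "norm (D h) \<le> K * norm h"
proof (rule field_le_epsilon)
  fix e :: real assume e: "e > 0"
  define d where "d = e / (2 * (norm h + 1))"
  have d: "d > 0" "2 * d * norm h \<le> e" using e by (auto simp: d_def field_simps add_pos_nonneg)
  have "\<exists>r>0. \<forall>y. norm (y - x) < r \<longrightarrow> norm (F y - F x - D (y - x)) \<le> d * norm (y - x)"
    using D d by (simp add: has_derivative_at_alt)
  then obtain r where r: "r > 0" "\<And>y. norm (y - x) < r \<Longrightarrow> norm (F y - F x - D (y - x)) \<le> d * norm (y - x)" by blast
  have "\<forall>\<^sub>F y in nhds x. norm (F y - F x) \<le> (K + d) * norm (y - x)" using K d by (simp add: calm_def)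
  then obtain s where s: "s > 0" "\<And>y. norm (y - x) < s \<Longrightarrow> norm (F y - F x) \<le> (K + d) * norm (y - x)"
    unfolding eventually_nhds_metric dist_norm by blast
  define t where "t = min r s / (2 * (norm h + 1))"
  have t: "t > 0" using r s by (auto simp: t_def intro!: divide_pos_pos add_nonneg_pos)
  have "t * norm h < min r s"
  proof -
    have "t * norm h \<le> t * (norm h + 1)" using t by simp
    also have "\<dots> = min r s / 2" using norm_ge_zero[of h] by (simp add: t_def field_simps add_nonneg_eq_0_iff)
    finally show ?thesis using r s by linarith
  qed
  then have n: "norm ((x + t *\<^sub>R h) - x) < r" "norm ((x + t *\<^sub>R h) - x) < s" using t by auto
  have lin: "D (t *\<^sub>R h) = t *\<^sub>R D h"
    using has_derivative_bounded_linear[OF D] by (simp add: linear_cmul bounded_linear.linear)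
  have "t * norm (D h) = norm (D ((x + t *\<^sub>R h) - x))" using t lin by simp
  also have "\<dots> \<le> norm (F (x + t *\<^sub>R h) - F x) + norm (F (x + t *\<^sub>R h) - F x - D ((x + t *\<^sub>R h) - x))"
    by (smt (verit) norm_minus_commute norm_triangle_sub)
  also have "\<dots> \<le> (K + d) * (t * norm h) + d * (t * norm h)"
    using r(2)[OF n(1)] s(2)[OF n(2)] t by simp
  also have "\<dots> = t * (K * norm h + 2 * d * norm h)" by (simp add: algebra_simps)
  finally have "norm (D h) \<le> K * norm h + 2 * d * norm h" using t by simp
  then show "norm (D h) \<le> K * norm h + e" using d by linarith
qed

lemma calm_mult:
  fixes F G :: "'a::real_normed_vector \<Rightarrow> real"
  assumes F: "C1_at F x" "calm F x K" and G: "C1_at G x" "calm G x L"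
  shows "calm (\<lambda>y. F y * G y) x (\<bar>F x\<bar> * L + \<bar>G x\<bar> * K)"
proof -
  obtain F' G' where D: "(F has_derivative blinfun_apply F') (at x)" "(G has_derivative blinfun_apply G') (at x)"
    using F G by (metis C1_at_derivative)
  show ?thesis
  proof (rule calm_of_derivative[OF has_derivative_mult[OF D]])
    fix h
    have "norm (F x * G' h + F' h * G x) \<le> \<bar>F x\<bar> * \<bar>G' h\<bar> + \<bar>G x\<bar> * \<bar>F' h\<bar>"
      by (metis abs_mult mult.commute norm_triangle_ineq real_norm_def)
    also have "\<dots> \<le> \<bar>F x\<bar> * (L * norm h) + \<bar>G x\<bar> * (K * norm h)"
      using calm_derivative[OF D(1) F(2), of h] calm_derivative[OF D(2) G(2), of h]
      by (intro add_mono mult_left_mono) auto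
    finally show "norm (F x * G' h + F' h * G x) \<le> (\<bar>F x\<bar> * L + \<bar>G x\<bar> * K) * norm h"
      by (simp add: algebra_simps)
  qed
qed

section \<open>Ekeland's variational principle\<close>

text \<open>An infimum need not be attained without compactness. This weak form yields a point that
  is minimal up to a cone of slope \<open>e\<close>, where a differentiable function has a
  derivative of norm at most \<open>e\<close>.\<close>

lemma ekeland:
  fixes F :: "'a::banach \<Rightarrow> real"
  assumes cont: "continuous_on UNIV F" and bdd: "\<And>x. m \<le> F x" and e: "e > 0"
  obtains x where "\<And>y. F x \<le> F y + e * norm (y - x)"
proof -
  \<comment> \<open>The points that improve on \<open>x\<close> even after paying for the distance.
    The sequence below nearly minimizes \<open>F\<close> over the successive sets, which
    shrink.\<close>
  define S where "S x = {y. F y + e * norm (y - x) \<le> F x}" for x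
  have S: "x \<in> S x" for x by (simp add: S_def)
  have bS: "bdd_below (F ` S x)" for x using bdd by (auto intro!: bdd_belowI)
  have ex: "\<exists>y. y \<in> S x \<and> F y \<le> Inf (F ` S x) + (1/2) ^ k" for x and k :: nat
  proof -
    have "Inf (F ` S x) < Inf (F ` S x) + (1/2) ^ k" by simp
    then show ?thesis using S bS by (subst (asm) cInf_less_iff) (auto intro: less_imp_le)
  qed
  obtain x where x: "\<And>k. x (Suc k) \<in> S (x k) \<and> F (x (Suc k)) \<le> Inf (F ` S (x k)) + (1/2) ^ k"
    using dependent_nat_choice[of "\<lambda>_ _. True" "\<lambda>k u v. v \<in> S u \<and> F v \<le> Inf (F ` S u) + (1/2) ^ k"] ex by auto
  have Strans: "z \<in> S u" if "y \<in> S u" "z \<in> S y" for u y z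
  proof -
    have "e * norm (z - u) \<le> e * (norm (z - y) + norm (y - u))"
      using e norm_triangle_ineq[of "z - y" "y - u"] by simp
    then show ?thesis using that by (simp add: S_def algebra_simps)
  qed
  have mono: "x n \<in> S (x k)" if "k \<le> n" for k n
    using that
  proof (induction n rule: dec_induct)
    case (step n)
    then show ?case using Strans[of "x n" "x k" "x (Suc n)"] x by blast
  qed (rule S)
  have "decseq (\<lambda>k. F (x k))"
    unfolding decseq_Suc_iff
  proof
    fix k
    have "F (x (Suc k)) + e * norm (x (Suc k) - x k) \<le> F (x k)" using x[of k] by (simp add: S_def)
    moreover have "0 \<le> e * norm (x (Suc k) - x k)" using e by simp
    ultimately show "F (x (Suc k)) \<le> F (x k)" by linarith
  qed
  then obtain L where L: "(\<lambda>k. F (x k)) \<longlonglongrightarrow> L" "\<And>k. L \<le> F (x k)"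
    using decseq_convergent[of "\<lambda>k. F (x k)" m] bdd by metis
  have "Cauchy x"
  proof (rule metric_CauchyI)
    fix d :: real assume d: "d > 0"
    have "\<forall>\<^sub>F k in sequentially. F (x k) < L + e * d / 2" using L(1) d e by (intro order_tendstoD(2)) auto
    then obtain K where K: "\<And>k. k \<ge> K \<Longrightarrow> F (x k) < L + e * d / 2" by (auto simp: eventually_sequentially)
    have near: "dist (x n) (x K) < d / 2" if "n \<ge> K" for n
    proof -
      have "e * norm (x n - x K) \<le> F (x K) - F (x n)" using mono[OF that] by (simp add: S_def)
      also have "\<dots> < e * (d / 2)" using K[of K] L(2)[of n] by simp
      finally show ?thesis using e by (simp add: dist_norm mult_less_cancel_left_pos)
    qed
    have "dist (x k) (x n) < d" if "k \<ge> K" "n \<ge> K" for k n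
      using dist_triangle_half_r[of "x K" "x k" d "x n"] near[OF that(1)] near[OF that(2)] by (simp add: dist_commute)
    then show "\<exists>M. \<forall>k\<ge>M. \<forall>n\<ge>M. dist (x k) (x n) < d" by blast
  qed
  then obtain z where z: "x \<longlonglongrightarrow> z" using Cauchy_convergent convergent_def by blast
  have Fz: "(\<lambda>k. F (x k)) \<longlonglongrightarrow> F z"
    by (rule continuous_on_tendsto_compose[OF cont z]) auto
  have zS: "z \<in> S (x k)" for k
  proof -
    have "(\<lambda>n. F (x n) + e * norm (x n - x k)) \<longlonglongrightarrow> F z + e * norm (z - x k)"
      by (intro tendsto_intros Fz z)
    moreover have "\<forall>\<^sub>F n in sequentially. F (x n) + e * norm (x n - x k) \<le> F (x k)"
      using mono[of k] by (auto simp: S_def eventually_sequentially)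
    ultimately have "F z + e * norm (z - x k) \<le> F (x k)" by (rule tendsto_upperbound) simp
    then show ?thesis by (simp add: S_def)
  qed
  show ?thesis
  proof (rule that, rule ccontr)
    fix y assume "\<not> F z \<le> F y + e * norm (y - z)"
    then have less: "F y + e * norm (y - z) < F z" by simp
    \<comment> \<open>A better point than the limit would belong to all the sets
      \<open>S (x k)\<close>, so its value would dominate their infima, to which the values along
      the sequence converge.\<close>
    have yS: "y \<in> S (x k)" for k using Strans[OF zS] less by (simp add: S_def)
    have "F (x (Suc k)) \<le> F y + (1/2) ^ k" for k
      using x[of k] cInf_lower[OF imageI[OF yS] bS, of k] by force
    moreover have "(\<lambda>k. F y + (1/2) ^ k) \<longlonglongrightarrow> F y + 0" by (intro tendsto_intros) auto
    ultimately have "F z \<le> F y + 0"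
      by (intro LIMSEQ_le[OF LIMSEQ_Suc[OF Fz]]) auto
    moreover have "0 \<le> e * norm (y - z)" using e by simp
    ultimately show False using less by linarith
  qed
qed

section \<open>Suppression unconditional bases\<close>

locale suppression_basis =
  fixes e :: "nat \<Rightarrow> 'a::banach"
  assumes suppression_basis: "one_suppression_unconditional e"
begin

definition coord :: "'a \<Rightarrow> nat \<Rightarrow> real" where
  "coord x = (THE c. (\<lambda>j. c j *\<^sub>R e j) sums x)"

definition proj :: "nat \<Rightarrow> 'a \<Rightarrow> 'a" where
  "proj n x = (\<Sum>j<n. coord x j *\<^sub>R e j)"

lemma ex1_coord: "\<exists>!c. (\<lambda>j. c j *\<^sub>R e j) sums x"
  using suppression_basis by (simp add: one_suppression_unconditional_def schauder_basis_def)

lemma coord_sums: "(\<lambda>j. coord x j *\<^sub>R e j) sums x"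
  unfolding coord_def by (rule theI'[OF ex1_coord])

lemma coord_unique: "(\<lambda>j. c j *\<^sub>R e j) sums x \<Longrightarrow> coord x = c"
  using coord_sums ex1_coord by blast

lemma coord_add: "coord (x + y) = (\<lambda>j. coord x j + coord y j)"
  by (rule coord_unique) (use sums_add[OF coord_sums[of x] coord_sums[of y]] in \<open>simp add: scaleR_add_left\<close>)

lemma coord_scaleR: "coord (r *\<^sub>R x) = (\<lambda>j. r * coord x j)"
  by (rule coord_unique) (use sums_scaleR_right[OF coord_sums[of x], of r] in simp)

lemma linear_coord: "linear (\<lambda>x. coord x j)"
  by (rule linearI) (auto simp: coord_add coord_scaleR)

lemmas coord_diff = linear_diff[OF linear_coord]
lemmas coord_zero [simp] = linear_0[OF linear_coord]
lemmas coord_sum = linear_sum[OF linear_coord]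

lemma coord_basis: "coord (e m) = (\<lambda>j. if j = m then 1 else 0)"
  by (rule coord_unique) (use sums_single[of m "\<lambda>j. e j"] in \<open>simp add: if_distrib[of "\<lambda>r. r *\<^sub>R _"] cong: if_cong\<close>)

lemma basis_nonzero: "e m \<noteq> 0"
proof
  assume "e m = 0"
  then have "coord (e m) m = 0" by simp
  then show False by (simp add: coord_basis)
qed

lemma suppress1: "norm (x - coord x m *\<^sub>R e m) \<le> norm x"
proof -
  have "(\<lambda>j. coord x j *\<^sub>R e j - (if j = m then coord x j *\<^sub>R e j else 0)) sums (x - coord x m *\<^sub>R e m)"
    by (intro sums_diff coord_sums sums_single)
  moreover have "(\<lambda>j. coord x j *\<^sub>R e j - (if j = m then coord x j *\<^sub>R e j else 0))
    = (\<lambda>j. if j = m then 0 else coord x j *\<^sub>R e j)" by auto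
  ultimately have "(\<Sum>j. if j = m then 0 else coord x j *\<^sub>R e j) = x - coord x m *\<^sub>R e m"
    using sums_unique by metis
  then show ?thesis
    using suppression_basis[unfolded one_suppression_unconditional_def, THEN conjunct2, rule_format, OF coord_sums[of x], of m]
    by simp
qed

lemma coord_sum_basis:
  assumes "finite A" shows "coord (\<Sum>m\<in>A. c m *\<^sub>R e m) j = (if j \<in> A then c j else 0)"
proof -
  have "coord (\<Sum>m\<in>A. c m *\<^sub>R e m) j = (\<Sum>m\<in>A. if j = m then c m else 0)"
    by (auto simp: coord_sum coord_scaleR coord_basis intro!: sum.cong)
  then show ?thesis using assms by (simp add: sum.delta)
qed

text \<open>Coordinates are removed one at a time; removing the others leaves the next coordinate
  unchanged, so the one-step inequality applies again.\<close>

lemma suppress: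
  assumes "finite A" shows "norm (x - (\<Sum>m\<in>A. coord x m *\<^sub>R e m)) \<le> norm x"
  using assms
proof (induction A)
  case (insert m A)
  let ?y = "x - (\<Sum>m\<in>A. coord x m *\<^sub>R e m)"
  have "coord ?y m = coord x m" using insert by (simp add: coord_diff coord_sum_basis)
  then show ?case using suppress1[of ?y m] insert by (simp add: algebra_simps)
qed simp

lemma coord_proj: "coord (proj n x) j = (if j < n then coord x j else 0)"
  by (simp add: proj_def coord_sum_basis)

lemma proj_add: "proj n (x + y) = proj n x + proj n y"
  by (simp add: proj_def coord_add scaleR_add_left sum.distrib)

lemma proj_scaleR: "proj n (r *\<^sub>R x) = r *\<^sub>R proj n x"
  by (simp add: proj_def coord_scaleR scaleR_sum_right)

lemma linear_proj: "linear (proj n)"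
  by (rule linearI) (auto simp: proj_add proj_scaleR)

lemmas proj_diff = linear_diff[OF linear_proj]

lemma proj_proj: "proj m (proj n x) = proj (min m n) x"
  unfolding proj_def[of m] proj_def[of "min m n"]
  by (rule sum.mono_neutral_cong_right) (auto simp: coord_proj)

lemma proj_basis: "proj n (e m) = (if m < n then e m else 0)"
  unfolding proj_def coord_basis by (auto simp: if_distrib[of "\<lambda>r. r *\<^sub>R _"] cong: if_cong)

lemma proj_tendsto: "(\<lambda>n. proj n x) \<longlonglongrightarrow> x"
  using coord_sums[of x] unfolding sums_def proj_def .

lemma norm_tail_le: "norm (x - proj n x) \<le> norm x"
  unfolding proj_def by (rule suppress) simp

lemma coord_eqI: "(\<And>j. coord x j = coord y j) \<Longrightarrow> x = y"
  using coord_sums[of x] coord_sums[of y] sums_unique2 by simp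

text \<open>Suppressing the coordinates from \<open>n\<close> to \<open>M - 1\<close> of the finite
  section \<open>proj M x\<close> leaves \<open>proj n x\<close>; then \<open>M\<close> tends to
  infinity.\<close>

lemma norm_proj_le: "norm (proj n x) \<le> norm x"
proof (rule tendsto_lowerbound[OF tendsto_norm[OF proj_tendsto]])
  show "\<forall>\<^sub>F M in sequentially. norm (proj n x) \<le> norm (proj M x)"
  proof (rule eventually_sequentiallyI[of n])
    fix M assume "n \<le> M"
    have "proj M x - (\<Sum>m\<in>{n..<M}. coord (proj M x) m *\<^sub>R e m) = proj n x"
      by (rule coord_eqI) (use \<open>n \<le> M\<close> in \<open>auto simp: coord_diff coord_sum_basis coord_proj\<close>)
    then show "norm (proj n x) \<le> norm (proj M x)" using suppress[of "{n..<M}" "proj M x"] by simp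
  qed
qed simp

lemma bounded_linear_proj: "bounded_linear (proj n)"
  by (rule bounded_linear_intro[of _ 1]) (auto simp: proj_add proj_scaleR norm_proj_le)

lemma norm_proj_diff_mono:
  assumes "j \<le> n" "n \<le> m" shows "norm (proj n x - proj j x) \<le> norm (proj m x - proj j x)"
  using norm_proj_le[of n "proj m x - proj j x"] assms by (simp add: proj_diff proj_proj min_absorb1 min_absorb2)

lemma norm_proj_diff_le_tail: "j \<le> n \<Longrightarrow> norm (proj n x - proj j x) \<le> norm (x - proj j x)"
  using norm_proj_le[of n "x - proj j x"] by (simp add: proj_diff proj_proj min_absorb1 min_absorb2)

lemma norm_tail_mono: "j \<le> n \<Longrightarrow> norm (x - proj n x) \<le> norm (x - proj j x)"
  using norm_tail_le[of "x - proj j x" n] by (simp add: proj_diff proj_proj min_absorb1 min_absorb2)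

lemma bounded_linear_coord: "bounded_linear (\<lambda>x. coord x m)"
proof (rule bounded_linear_intro[of _ "2 / norm (e m)"])
  fix x
  have "norm (coord x m *\<^sub>R e m) \<le> 2 * norm x"
    using norm_triangle_ineq4[of x "x - coord x m *\<^sub>R e m"] suppress1[of x m] by simp
  then show "norm (coord x m) \<le> norm x * (2 / norm (e m))"
    using basis_nonzero[of m] by (simp add: field_simps)
qed (auto simp: coord_add coord_scaleR)

text \<open>Each block of the restricted series arises by suppression from the same block of the
  convergent expansion, so the Cauchy criterion carries over.\<close>

lemma summable_restricted: "summable (\<lambda>j. if j \<in> A then coord x j *\<^sub>R e j else 0)"
  unfolding summable_Cauchy
proof (intro allI impI)
  fix d :: real assume "d > 0"
  then obtain N where N: "\<And>m n. m \<ge> N \<Longrightarrow> norm (\<Sum>j=m..<n. coord x j *\<^sub>R e j) < d"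
    using coord_sums[of x] unfolding sums_iff summable_Cauchy by blast
  have "norm (\<Sum>j=m..<n. if j \<in> A then coord x j *\<^sub>R e j else 0) < d" if "m \<ge> N" for m n
  proof -
    let ?y = "\<Sum>j=m..<n. coord x j *\<^sub>R e j"
    have "?y - (\<Sum>j\<in>{m..<n} - A. coord ?y j *\<^sub>R e j) = (\<Sum>j\<in>{m..<n} \<inter> A. coord x j *\<^sub>R e j)"
      by (rule coord_eqI) (auto simp: coord_diff coord_sum_basis)
    then show ?thesis
      using suppress[of "{m..<n} - A" ?y] N[OF that, of n] by (simp add: sum.inter_restrict)
  qed
  then show "\<exists>N. \<forall>m\<ge>N. \<forall>n. norm (\<Sum>j=m..<n. if j \<in> A then coord x j *\<^sub>R e j else 0) < d" by blast
qed

section \<open>Coordinate subspaces, and functionals with prescribed support\<close>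

definition vanishing :: "nat set \<Rightarrow> 'a set" where
  "vanishing A = {x. \<forall>m\<in>A. coord x m = 0}"

lemma subspace_vanishing: "subspace (vanishing A)"
  by (auto simp: vanishing_def subspace_def coord_add coord_scaleR)

lemma closed_vanishing: "closed (vanishing A)"
proof -
  have "vanishing A = (\<Inter>m\<in>A. (\<lambda>x. coord x m) -` {0})" by (auto simp: vanishing_def)
  also have "closed \<dots>"
    by (intro closed_INT ballI closed_vimage closed_singleton)
      (rule linear_continuous_on[OF bounded_linear_coord])
  finally show ?thesis .
qed

text \<open>The complement is spanned by the complementary coordinates. Splitting a vector needs
  convergence of its expansion over an arbitrary index set, which unconditionality provides.\<close>

lemma complemented_vanishing: "complemented (vanishing A)"
  unfolding complemented_def
proof (intro exI conjI)
  show "closed (vanishing (- A))" "subspace (vanishing (- A))"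
    by (rule closed_vanishing subspace_vanishing)+
  show "vanishing A \<inter> vanishing (- A) = {0}"
    by (auto simp: vanishing_def intro!: coord_eqI)
  show "vanishing A + vanishing (- A) = UNIV"
  proof -
    have "x \<in> vanishing A + vanishing (- A)" for x
    proof -
      define y where "y = (\<Sum>j. if j \<in> A then coord x j *\<^sub>R e j else 0)"
      have "(\<lambda>j. (if j \<in> A then coord x j else 0) *\<^sub>R e j) sums y"
        using summable_sums[OF summable_restricted[of A x]]
        by (simp add: y_def if_distrib[of "\<lambda>r. r *\<^sub>R _"] cong: if_cong)
      then have "coord y = (\<lambda>j. if j \<in> A then coord x j else 0)" by (rule coord_unique)
      then have "x - y \<in> vanishing A" "y \<in> vanishing (- A)"
        by (auto simp: vanishing_def coord_diff)
      then show ?thesis using set_plus_intro[of "x - y" _ y] by simp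
    qed
    then show ?thesis by blast
  qed
qed

text \<open>Modulo \<open>vanishing A\<close>, the vectors \<open>e m\<close> with \<open>m\<close>
  in \<open>A\<close> stay independent, as their coordinates in \<open>A\<close> are biorthogonal.
  More than \<open>card S\<close> of them would have independent representatives in
  \<open>span S\<close>.\<close>

lemma infinite_codim_vanishing:
  assumes "infinite A" shows "infinite_codim (vanishing A)"
  unfolding infinite_codim_def
proof
  assume "\<exists>S. finite S \<and> vanishing A + span S = UNIV"
  then obtain S where S: "finite S" "vanishing A + span S = UNIV" by blast
  obtain B where B: "B \<subseteq> A" "finite B" "card B = Suc (card S)"
    using infinite_arbitrarily_large[OF assms] by blast
  have "\<exists>s. s \<in> span S \<and> e m - s \<in> vanishing A" for m
  proof -
    have "e m \<in> vanishing A + span S" using S by simp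
    then obtain a s where "e m = a + s" "a \<in> vanishing A" "s \<in> span S" by (rule set_plus_elim)
    then show ?thesis by (intro exI[of _ s]) auto
  qed
  then obtain s where s: "\<And>m. s m \<in> span S" "\<And>m. e m - s m \<in> vanishing A" by metis
  have cs: "coord (s m) j = (if j = m then 1 else 0)" if "j \<in> A" for m j
  proof -
    have "coord (e m) j - coord (s m) j = 0"
      using s(2)[of m] that unfolding vanishing_def by (simp add: coord_diff)
    then show ?thesis by (simp add: coord_basis split: if_splits)
  qed
  have inj: "inj_on s B"
    by (rule inj_onI) (metis B(1) cs subsetD zero_neq_one)
  have "independent (s ` B)"
  proof
    assume "dependent (s ` B)"
    then obtain u v where u: "v \<in> s ` B" "u v \<noteq> 0" "(\<Sum>v\<in>s ` B. u v *\<^sub>R v) = 0"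
      using B(2) by (auto simp: dependent_finite)
    then obtain m where m: "m \<in> B" "v = s m" by blast
    have "0 = coord (\<Sum>i\<in>B. u (s i) *\<^sub>R s i) m" using u(3) inj by (simp add: sum.reindex)
    also have "\<dots> = (\<Sum>i\<in>B. u (s i) * coord (s i) m)" by (simp add: coord_sum coord_scaleR)
    also have "\<dots> = (\<Sum>i\<in>B. if m = i then u (s i) else 0)"
      using cs[OF subsetD[OF B(1) m(1)]] by (intro sum.cong) auto
    also have "\<dots> = u v" using m B by simp
    finally show False using u by simp
  qed
  then have "card (s ` B) \<le> card S"
    using independent_span_bound[of S "s ` B"] S s by blast
  then show False using B card_image[OF inj] by simp
qed

lemma ex_functional:
  obtains w :: "'a \<Rightarrow>\<^sub>L real" where "\<And>m. m \<in> A \<Longrightarrow> w (e m) > 0" "\<And>m. m \<notin> A \<Longrightarrow> w (e m) = 0"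
proof -
  define C where "C m = Blinfun (\<lambda>x. coord x m)" for m
  have C: "blinfun_apply (C m) = (\<lambda>x. coord x m)" for m
    unfolding C_def by (rule bounded_linear_Blinfun_apply[OF bounded_linear_coord])
  \<comment> \<open>The weights make the series of coordinate functionals converge absolutely;
    evaluation at \<open>e k\<close> then isolates the weight \<open>r k\<close>.\<close>
  define r where "r m = (if m \<in> A then (1/2) ^ m / (1 + norm (C m)) else 0)" for m
  have "summable (\<lambda>m. r m *\<^sub>R C m)"
  proof (rule summable_comparison_test'[of "\<lambda>m. (1/2) ^ m"])
    show "norm (r m *\<^sub>R C m) \<le> (1/2) ^ m" for m
    proof -
      have "norm (C m) / (1 + norm (C m)) \<le> 1" by (simp add: divide_le_eq add_pos_nonneg)
      then have "(1/2) ^ m * (norm (C m) / (1 + norm (C m))) \<le> (1/2) ^ m * 1"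
        by (intro mult_left_mono) auto
      then show ?thesis by (auto simp: r_def abs_of_pos add_pos_nonneg)
    qed
  qed (simp add: summable_geometric)
  then have "(\<lambda>m. blinfun_apply (r m *\<^sub>R C m) (e k)) sums blinfun_apply (\<Sum>m. r m *\<^sub>R C m) (e k)" for k
    by (intro bounded_linear.sums[OF blinfun.bounded_linear_left] summable_sums)
  moreover have "(\<lambda>m. blinfun_apply (r m *\<^sub>R C m) (e k)) = (\<lambda>m. if m = k then r m else 0)" for k
    by (auto simp: blinfun.scaleR_left C coord_basis)
  ultimately have "blinfun_apply (\<Sum>m. r m *\<^sub>R C m) (e k) = r k" for k
    using sums_unique2[OF _ sums_single[of k r]] by simp
  moreover have "r k > 0" if "k \<in> A" for k using that by (simp add: r_def add_pos_nonneg)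
  moreover have "r k = 0" if "k \<notin> A" for k using that by (simp add: r_def)
  ultimately show ?thesis using that by metis
qed

end

section \<open>The square of a smooth norm\<close>

text \<open>Squaring removes the singularity at the origin: the derivative of the norm is bounded by
  1, so its product with \<open>2 * norm y\<close> extends continuously by 0.\<close>

lemma C1_at_norm_sq:
  fixes x :: "'a::real_normed_vector"
  assumes "C1_on (- {0}) (norm :: 'a \<Rightarrow> real)"
  shows "C1_at (\<lambda>x::'a. (norm x)\<^sup>2) x"
proof -
  obtain n' :: "'a \<Rightarrow> 'a \<Rightarrow>\<^sub>L real" where n':
    "\<And>x. x \<noteq> 0 \<Longrightarrow> (norm has_derivative blinfun_apply (n' x)) (at x)" "continuous_on (- {0}) n'"
    using assms unfolding C1_on_def by auto
  define D where "D y = (if y = 0 then 0 else (2 * norm y) *\<^sub>R n' y)" for y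
  have n1: "norm (n' y) \<le> 1" if "y \<noteq> 0" for y
  proof (rule norm_blinfun_bound)
    have "calm norm y 1" by (rule calm_Lipschitz) (simp add: norm_triangle_ineq3)
    then show "norm (n' y h) \<le> 1 * norm h" for h by (rule calm_derivative[OF n'(1)[OF that]])
  qed simp
  have der: "((\<lambda>x. (norm x)\<^sup>2) has_derivative blinfun_apply (D y)) (at y)" for y :: 'a
  proof (cases "y = 0")
    case True
    have "\<exists>d>0. \<forall>z::'a. norm z < d \<longrightarrow> (norm z)\<^sup>2 \<le> r * norm z" if "r > 0" for r
      by (rule exI[of _ r]) (use that in \<open>auto simp: power2_eq_square intro: mult_right_mono less_imp_le\<close>)
    then show ?thesis using True by (simp add: D_def has_derivative_at_alt zero_blinfun.rep_eq)
  next
    case False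
    from has_derivative_power[OF n'(1)[OF False], of 2] show ?thesis
      using False by (simp add: D_def scaleR_blinfun.rep_eq mult_ac)
  qed
  have "isCont D y" for y
  proof (cases "y = 0")
    case True
    have "(D \<longlongrightarrow> 0) (at 0)"
    proof (rule Lim_null_comparison)
      show "\<forall>\<^sub>F z in at 0. norm (D z) \<le> 2 * norm z"
        using n1 by (intro always_eventually) (auto simp: D_def mult_left_le)
    qed (auto intro!: tendsto_eq_intros)
    then show ?thesis using True by (simp add: isCont_def D_def)
  next
    case False
    have "continuous_on (- {0}) D"
    proof (rule continuous_on_eq)
      show "continuous_on (- {0}) (\<lambda>y. (2 * norm y) *\<^sub>R n' y)" by (intro continuous_intros n'(2))
    qed (simp add: D_def)
    then show ?thesis using False by (simp add: continuous_on_eq_continuous_at open_Compl)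
  qed
  then show ?thesis
    using der by (intro C1_atI[where W=UNIV and F'=D]) (auto simp: continuous_at_imp_continuous_on)
qed

locale smooth_basis = suppression_basis e for e :: "nat \<Rightarrow> 'a::banach" +
  assumes C1_norm: "C1_on (- {0}) (norm :: 'a \<Rightarrow> real)"
    and strictly_convex: "strictly_convex_norm TYPE('a)"
begin

definition dsq :: "'a \<Rightarrow> 'a \<Rightarrow>\<^sub>L real" where
  "dsq = (SOME D. (\<forall>x. ((\<lambda>x. (norm x)\<^sup>2) has_derivative blinfun_apply (D x)) (at x)) \<and> continuous_on UNIV D)"

lemma dsq: "((\<lambda>x. (norm x)\<^sup>2) has_derivative blinfun_apply (dsq x)) (at x)" "continuous_on UNIV dsq"
proof -
  have "C1_on UNIV (\<lambda>x::'a. (norm x)\<^sup>2)"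
    using C1_at_norm_sq[OF C1_norm] by (simp add: C1_on_iff_C1_at)
  then have "\<exists>D. (\<forall>x. ((\<lambda>x::'a. (norm x)\<^sup>2) has_derivative blinfun_apply (D x)) (at x)) \<and> continuous_on UNIV D"
    unfolding C1_on_def by auto
  from someI_ex[OF this] show "((\<lambda>x. (norm x)\<^sup>2) has_derivative blinfun_apply (dsq x)) (at x)" "continuous_on UNIV dsq"
    unfolding dsq_def by auto
qed

lemma C1_at_norm_power2: "C1_at F x \<Longrightarrow> C1_at (\<lambda>y. (norm (F y :: 'a))\<^sup>2) x"
  by (rule C1_at_compose[OF _ C1_at_norm_sq[OF C1_norm]])

lemma calm_norm_sq: "calm (\<lambda>y::'a. (norm y)\<^sup>2) x (2 * norm x)"
  unfolding calm_def
proof (intro allI impI)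
  fix k assume k: "2 * norm x < k"
  show "\<forall>\<^sub>F y in nhds x. norm ((norm y)\<^sup>2 - (norm x)\<^sup>2) \<le> k * norm (y - x)"
    unfolding eventually_nhds_metric dist_norm
  proof (intro exI[of _ "k - 2 * norm x"] conjI allI impI)
    fix y assume y: "norm (y - x) < k - 2 * norm x"
    have "\<bar>(norm y)\<^sup>2 - (norm x)\<^sup>2\<bar> = (norm y + norm x) * \<bar>norm y - norm x\<bar>"
      by (simp add: power2_eq_square square_diff_square_factored abs_mult mult.commute)
    also have "\<dots> \<le> k * norm (y - x)"
      using y norm_triangle_ineq2[of y x] norm_triangle_ineq3[of y x] norm_ge_zero[of "y - x"] norm_ge_zero[of x]
      by (intro mult_mono) linarith+
    finally show "norm ((norm y)\<^sup>2 - (norm x)\<^sup>2) \<le> k * norm (y - x)" by simp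
  qed (use k in simp)
qed

lemma norm_dsq_le: "norm (dsq x) \<le> 2 * norm x"
  by (rule norm_blinfun_bound) (use calm_derivative[OF dsq(1) calm_norm_sq] in auto)

text \<open>By suppression the norm on the line through \<open>x\<close> in direction
  \<open>e m\<close> is minimal at \<open>x\<close>, so both one-sided derivatives are
  nonnegative.\<close>

lemma dsq_basis_eq_0:
  assumes "coord x m = 0" shows "dsq x (e m) = 0"
proof -
  have le: "norm x \<le> norm (x + t *\<^sub>R e m)" for t
    using suppress1[of "x + t *\<^sub>R e m" m] assms by (simp add: coord_add coord_scaleR coord_basis)
  have "0 \<le> dsq x (e m)" "0 \<le> dsq x (- e m)"
    by (rule derivative_ge[OF dsq(1)]; use le in \<open>auto intro!: always_eventually power_mono simp: le[of "- _", simplified]\<close>)+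
  then show ?thesis by (simp add: blinfun.minus_right)
qed

text \<open>Strict convexity makes the norm strictly larger after restoring a suppressed coordinate;
  convexity turns this into a sign for the derivative.\<close>

lemma norm_suppress_less:
  assumes "coord x m \<noteq> 0" shows "norm (x - coord x m *\<^sub>R e m) < norm x"
proof (rule ccontr)
  let ?y = "x - coord x m *\<^sub>R e m" and ?r = "norm x"
  assume "\<not> norm ?y < norm x"
  with suppress1[of x m] have eq: "norm ?y = ?r" by simp
  have r: "?r > 0" using assms by auto
  let ?z = "(1/2) *\<^sub>R (x + ?y)"
  have "coord ?z m = (1/2) * coord x m"
    by (simp add: coord_scaleR coord_add coord_diff coord_basis)
  moreover have "?z - (1/2 * coord x m) *\<^sub>R e m = ?y"
    by (simp add: algebra_simps scaleR_left_distrib[symmetric])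
  ultimately have "?z - coord ?z m *\<^sub>R e m = ?y" by (simp only:)
  then have ge: "?r \<le> norm ?z" using suppress1[of ?z m] eq by simp
  have ne: "(1 / ?r) *\<^sub>R x \<noteq> (1 / ?r) *\<^sub>R ?y" using r assms basis_nonzero[of m] by auto
  have "norm ((1/2) *\<^sub>R ((1 / ?r) *\<^sub>R x + (1 / ?r) *\<^sub>R ?y)) < 1"
    using strictly_convex[unfolded strictly_convex_norm_def, rule_format, of "(1 / ?r) *\<^sub>R x" "(1 / ?r) *\<^sub>R ?y"]
      ne r eq by simp
  also have "(1/2) *\<^sub>R ((1 / ?r) *\<^sub>R x + (1 / ?r) *\<^sub>R ?y) = (1 / ?r) *\<^sub>R ?z"
    by (simp add: scaleR_add_right mult.commute)
  finally have "norm ?z < ?r" using r by (simp add: divide_less_eq)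
  then show False using ge by simp
qed

text \<open>The subgradient inequality for the convex function \<open>(norm x)\<^sup>2\<close>, from
  its convexity along the segment.\<close>

lemma dsq_le_diff: "dsq x h \<le> (norm (x + h))\<^sup>2 - (norm x)\<^sup>2"
proof -
  have conv: "(norm (x + t *\<^sub>R h))\<^sup>2 \<le> (norm x)\<^sup>2 + t * ((norm (x + h))\<^sup>2 - (norm x)\<^sup>2)" if t: "0 < t" "t < 1" for t
  proof -
    have "x + t *\<^sub>R h = (1 - t) *\<^sub>R x + t *\<^sub>R (x + h)" by (simp add: algebra_simps)
    then have "norm (x + t *\<^sub>R h) \<le> (1 - t) * norm x + t * norm (x + h)"
      using norm_triangle_ineq[of "(1 - t) *\<^sub>R x" "t *\<^sub>R (x + h)"] t by simp
    then have "(norm (x + t *\<^sub>R h))\<^sup>2 \<le> ((1 - t) * norm x + t * norm (x + h))\<^sup>2"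
      by (intro power_mono) auto
    also have "\<dots> = (1 - t) * (norm x)\<^sup>2 + t * (norm (x + h))\<^sup>2 - t * (1 - t) * (norm x - norm (x + h))\<^sup>2"
      by (simp add: power2_eq_square algebra_simps)
    also have "\<dots> \<le> (1 - t) * (norm x)\<^sup>2 + t * (norm (x + h))\<^sup>2" using t by simp
    finally show ?thesis by (simp add: algebra_simps)
  qed
  have ev: "\<forall>\<^sub>F t in at_right 0. t * ((norm x)\<^sup>2 - (norm (x + h))\<^sup>2) \<le> - (norm (x + t *\<^sub>R h))\<^sup>2 - - (norm x)\<^sup>2"
    unfolding eventually_at_right_field
    by (intro exI[of _ 1]) (use conv in \<open>auto simp: algebra_simps\<close>)
  have "(norm x)\<^sup>2 - (norm (x + h))\<^sup>2 \<le> - dsq x h"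
    by (rule derivative_ge[OF has_derivative_minus[OF dsq(1)] ev])
  then show ?thesis by simp
qed

lemma dsq_basis_pos:
  assumes "coord x m \<noteq> 0" shows "0 < coord x m * dsq x (e m)"
proof -
  let ?y = "x - coord x m *\<^sub>R e m"
  have "(norm ?y)\<^sup>2 < (norm x)\<^sup>2" using norm_suppress_less[OF assms] by (intro power_strict_mono) auto
  then show ?thesis
    using dsq_le_diff[of x "- (coord x m *\<^sub>R e m)"] by (simp add: blinfun.minus_right blinfun.scaleR_right)
qed

text \<open>Ekeland's principle for the squared norm minus \<open>\<phi>\<close>, which is bounded
  below by completing the square, produces \<open>x\<close> with \<open>dsq x\<close> close to
  \<open>\<phi>\<close>. Continuity of \<open>dsq\<close> allows \<open>x\<close> to be cut to a
  finite section, and there the derivative annihilates all later basis vectors.\<close>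

lemma functional_approx:
  fixes \<phi> :: "'a \<Rightarrow>\<^sub>L real"
  assumes d: "d > 0"
  obtains \<psi> n where "norm (\<phi> - \<psi>) \<le> d" "\<And>m. m \<ge> n \<Longrightarrow> blinfun_apply \<psi> (e m) = 0"
proof -
  let ?F = "\<lambda>x. (norm x)\<^sup>2 - \<phi> x"
  have cont: "continuous_on UNIV ?F" by (intro continuous_intros)
  have bdd: "- ((norm \<phi>)\<^sup>2 / 4) \<le> ?F x" for x
  proof -
    have "\<phi> x \<le> norm \<phi> * norm x" using norm_blinfun[of \<phi> x] by simp
    moreover have "0 \<le> (norm x - norm \<phi> / 2)\<^sup>2" by simp
    ultimately show ?thesis by (simp add: power2_eq_square algebra_simps)
  qed
  obtain x where x: "\<And>y. ?F x \<le> ?F y + d / 2 * norm (y - x)"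
    using ekeland[OF cont bdd, of "d / 2"] d by auto
  have der: "(?F has_derivative (\<lambda>h. dsq x h - \<phi> h)) (at x)"
    by (intro has_derivative_diff dsq bounded_linear_imp_has_derivative blinfun.bounded_linear_right)
  have ge: "- (d / 2 * norm h) \<le> dsq x h - \<phi> h" for h
  proof (rule derivative_ge[OF der])
    show "\<forall>\<^sub>F t in at_right 0. t * - (d / 2 * norm h) \<le> ?F (x + t *\<^sub>R h) - ?F x"
      unfolding eventually_at_right_field
    proof (intro exI[of _ 1] conjI allI impI)
      fix t :: real assume "0 < t"
      then show "t * - (d / 2 * norm h) \<le> ?F (x + t *\<^sub>R h) - ?F x"
        using x[of "x + t *\<^sub>R h"] by (simp add: algebra_simps)
    qed simp
  qed
  have 1: "norm (\<phi> - dsq x) \<le> d / 2"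
  proof (rule norm_blinfun_bound)
    show "norm ((\<phi> - dsq x) h) \<le> d / 2 * norm h" for h
      unfolding real_norm_def
      by (rule abs_leI) (use ge[of h] ge[of "- h"] in \<open>simp_all add: blinfun.diff_left blinfun.minus_right\<close>)
  qed (use d in simp)
  have "(\<lambda>n. dsq (proj n x)) \<longlonglongrightarrow> dsq x"
    by (rule continuous_on_tendsto_compose[OF dsq(2) proj_tendsto]) auto
  then have "\<forall>\<^sub>F n in sequentially. dist (dsq (proj n x)) (dsq x) < d / 2"
    using d by (intro tendstoD) auto
  then obtain n where n: "dist (dsq (proj n x)) (dsq x) < d / 2"
    using eventually_happens by fastforce
  show ?thesis
  proof (rule that)
    show "norm (\<phi> - dsq (proj n x)) \<le> d"
      using 1 n norm_triangle_ineq[of "\<phi> - dsq x" "dsq x - dsq (proj n x)"] by (simp add: dist_norm norm_minus_commute)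
    show "dsq (proj n x) (e m) = 0" if "m \<ge> n" for m
      by (rule dsq_basis_eq_0) (use that in \<open>simp add: coord_proj\<close>)
  qed
qed

lemma operator_approx:
  fixes T w :: "'a \<Rightarrow>\<^sub>L (real ^ 'd)"
  assumes d: "d > 0"
  obtains S n r where "norm (T - S) \<le> d" "r > 0" "\<And>m. m \<ge> n \<Longrightarrow> blinfun_apply S (e m) = r *\<^sub>R w (e m)"
proof -
  \<comment> \<open>Half of \<open>d\<close> is spent on the components, shared equally because
    their errors are added up, and half on the multiple of \<open>w\<close>.\<close>
  let ?c = "d / (2 * real CARD('d))"
  have c: "?c > 0" using d by simp
  have bl: "bounded_linear (\<lambda>x. T x $ i)" for i
    by (intro bounded_linear_compose[OF bounded_linear_vec_nth] blinfun.bounded_linear_right)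
  have "\<exists>\<psi> n. norm (Blinfun (\<lambda>x. T x $ i) - \<psi>) \<le> ?c \<and> (\<forall>m\<ge>n. blinfun_apply \<psi> (e m) = 0)" for i
    using functional_approx[OF c, of "Blinfun (\<lambda>x. T x $ i)"] by metis
  then obtain \<psi> n where \<psi>: "\<And>i. norm (Blinfun (\<lambda>x. T x $ i) - \<psi> i) \<le> ?c"
      "\<And>i m. m \<ge> n i \<Longrightarrow> blinfun_apply (\<psi> i) (e m) = 0"
    by metis
  define r where "r = d / (2 * (norm w + 1))"
  have r: "r > 0" "r * norm w \<le> d / 2"
    using d by (auto simp: r_def field_simps add_pos_nonneg)
  have bS: "bounded_linear (\<lambda>x. (\<chi> i. \<psi> i x) + r *\<^sub>R w x)"
  proof -
    have e: "(\<lambda>x. (\<chi> i. \<psi> i x)) = (\<lambda>x. \<Sum>i\<in>UNIV. \<psi> i x *\<^sub>R axis i 1)"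
      by (simp add: vec_eq_iff axis_def if_distrib fun_eq_iff cong: if_cong)
    have "bounded_linear (\<lambda>x. (\<chi> i. \<psi> i x))"
      unfolding e by (intro bounded_linear_sum bounded_linear_scaleR_const blinfun.bounded_linear_right)
    then show ?thesis
      by (intro bounded_linear_add bounded_linear_const_scaleR blinfun.bounded_linear_right)
  qed
  define S where "S = Blinfun (\<lambda>x. (\<chi> i. \<psi> i x) + r *\<^sub>R w x)"
  have S: "blinfun_apply S x = (\<chi> i. \<psi> i x) + r *\<^sub>R w x" for x
    unfolding S_def by (simp add: bounded_linear_Blinfun_apply[OF bS])
  show ?thesis
  proof (rule that)
    show "norm (T - S) \<le> d"
    proof (rule norm_blinfun_bound)
      fix x
      have "(T - S) x = (\<chi> i. T x $ i - \<psi> i x) - r *\<^sub>R w x"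
        by (simp add: blinfun.diff_left S vec_eq_iff)
      then have "norm ((T - S) x) \<le> norm (\<chi> i. T x $ i - \<psi> i x) + r * norm (w x)"
        using norm_triangle_ineq4[of "\<chi> i. T x $ i - \<psi> i x" "r *\<^sub>R w x"] r by simp
      also have "norm (\<chi> i. T x $ i - \<psi> i x) \<le> (\<Sum>i\<in>UNIV. \<bar>T x $ i - \<psi> i x\<bar>)"
        by (rule order_trans[OF norm_le_l1_cart]) simp
      also have "\<dots> \<le> (\<Sum>i\<in>(UNIV::'d set). ?c * norm x)"
      proof (rule sum_mono)
        fix i
        have "\<bar>T x $ i - \<psi> i x\<bar> = norm ((Blinfun (\<lambda>x. T x $ i) - \<psi> i) x)"
          by (simp add: blinfun.diff_left bounded_linear_Blinfun_apply[OF bl])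
        also have "\<dots> \<le> norm (Blinfun (\<lambda>x. T x $ i) - \<psi> i) * norm x" by (rule norm_blinfun)
        also have "\<dots> \<le> ?c * norm x" by (rule mult_right_mono[OF \<psi>(1) norm_ge_zero])
        finally show "\<bar>T x $ i - \<psi> i x\<bar> \<le> ?c * norm x" .
      qed
      also have "\<dots> = d / 2 * norm x" by simp
      also have "r * norm (w x) \<le> r * (norm w * norm x)" using r by (intro mult_left_mono norm_blinfun) auto
      also have "\<dots> \<le> d / 2 * norm x" using mult_right_mono[OF r(2) norm_ge_zero[of x]] by (simp only: mult.assoc)
      finally show "norm ((T - S) x) \<le> d * norm x" by simp
    qed (use d in simp)
    show "blinfun_apply S (e m) = r *\<^sub>R w (e m)" if "m \<ge> Max (range n)" for m
    proof -
      have "n i \<le> m" for i using that Max_ge[of "range n" "n i"] by simp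
      then show ?thesis by (simp add: S \<psi>(2) vec_eq_iff)
    qed
  qed (rule r)
qed

section \<open>Smooth functions adapted to an open cover\<close>

lemma countable_dense:
  obtains D :: "'a set" where "countable D" "D \<noteq> {}" "\<And>x r. r > 0 \<Longrightarrow> \<exists>d\<in>D. norm (x - d) < r"
proof -
  let ?f = "\<lambda>qs :: rat list. \<Sum>j<length qs. of_rat (qs ! j) *\<^sub>R e j"
  have "\<exists>d\<in>range ?f. norm (x - d) < r" if r: "r > 0" for x r
  proof -
    have "\<forall>\<^sub>F n in sequentially. dist (proj n x) x < r / 2"
      using r by (intro tendstoD proj_tendsto) auto
    then obtain n where n: "dist (proj n x) x < r / 2" using eventually_happens by fastforce
    have "\<exists>q. \<bar>coord x j - of_rat q\<bar> * norm (e j) \<le> r / (2 * real (n + 1))" for j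
    proof -
      let ?s = "r / (2 * real (n + 1)) / norm (e j)"
      have s: "?s > 0" using r basis_nonzero[of j] by simp
      obtain q where "coord x j - ?s < of_rat q" "of_rat q < coord x j"
        using of_rat_dense[of "coord x j - ?s" "coord x j"] s by auto
      then have "\<bar>coord x j - of_rat q\<bar> \<le> ?s" by simp
      then show ?thesis using basis_nonzero[of j]
        by (intro exI[of _ q]) (simp only: pos_le_divide_eq zero_less_norm_iff not_False_eq_True)
    qed
    then obtain q where q: "\<And>j. \<bar>coord x j - of_rat (q j)\<bar> * norm (e j) \<le> r / (2 * real (n + 1))" by metis
    let ?d = "?f (map q [0..<n])"
    have "norm (proj n x - ?d) = norm (\<Sum>j<n. (coord x j - of_rat (q j)) *\<^sub>R e j)"
      by (simp add: proj_def sum_subtractf[symmetric] scaleR_diff_left)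
    also have "\<dots> \<le> (\<Sum>j<n. r / (2 * real (n + 1)))"
      by (rule order_trans[OF norm_sum]) (intro sum_mono, use q in simp)
    also have "\<dots> < r / 2" using r by (simp add: field_simps)
    finally have "norm (x - ?d) < r"
      using n norm_triangle_ineq[of "x - proj n x" "proj n x - ?d"] by (simp add: dist_norm norm_minus_commute)
    then show ?thesis by blast
  qed
  then show ?thesis using that[of "range ?f"] by auto
qed

text \<open>A Lindelof argument with centres in a dense set and rational radii. Each small ball
  remembers a point \<open>c k\<close> of the cover. The factor 4 leaves room around the support of
  a bump, which has radius \<open>2 * q k\<close>.\<close>

lemma countable_cover:
  fixes r :: "'a \<Rightarrow> real"
  assumes U: "U \<noteq> {}" and r: "\<And>x. x \<in> U \<Longrightarrow> r x > 0"
  shows "\<exists>(d :: nat \<Rightarrow> 'a) q c. (\<forall>k. 0 < q k \<and> c k \<in> U \<and> q k \<le> r (c k) \<and>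
    cball (d k) (4 * q k) \<subseteq> ball (c k) (r (c k))) \<and> (\<forall>z\<in>U. \<exists>k. norm (z - d k) < q k)"
proof -
  obtain D :: "'a set" where D: "countable D" "\<And>x r. r > 0 \<Longrightarrow> \<exists>d\<in>D. norm (x - d) < r"
    using countable_dense by metis
  define A where "A = {(d, q). d \<in> D \<and> q \<in> \<rat> \<and> q > 0 \<and> (\<exists>x\<in>U. q \<le> r x \<and> cball d (4 * q) \<subseteq> ball x (r x))}"
  have "countable A"
    by (rule countable_subset[of _ "D \<times> \<rat>"]) (use D countable_rat in \<open>auto simp: A_def\<close>)
  have cov: "\<exists>(d, q)\<in>A. norm (z - d) < q" if z: "z \<in> U" for z
  proof -
    \<comment> \<open>Reaching \<open>d\<close> from \<open>z\<close> costs less than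
      \<open>q\<close>, the ball around \<open>d\<close> another \<open>4 * q\<close>; together this
      stays below \<open>r z\<close>.\<close>
    obtain q where q: "q \<in> \<rat>" "0 < q" "q < r z / 6"
      using Rats_dense_in_real[of 0 "r z / 6"] r[OF z] by auto
    obtain d where d: "d \<in> D" "norm (z - d) < q" using D(2)[OF q(2)] by blast
    have "cball d (4 * q) \<subseteq> ball z (r z)"
    proof
      fix y assume "y \<in> cball d (4 * q)"
      then have "dist z y \<le> norm (z - d) + 4 * q"
        using dist_triangle[of z y d] by (simp add: dist_norm)
      then show "y \<in> ball z (r z)" using d q by simp
    qed
    then have "(d, q) \<in> A" using d q z r[OF z] by (auto simp: A_def intro!: bexI[of _ z])
    then show ?thesis using d by blast
  qed
  then have "A \<noteq> {}" using U by blast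
  define p where "p = from_nat_into A"
  have p: "p k \<in> A" for k unfolding p_def by (rule from_nat_into[OF \<open>A \<noteq> {}\<close>])
  have "\<exists>x\<in>U. snd (p k) \<le> r x \<and> cball (fst (p k)) (4 * snd (p k)) \<subseteq> ball x (r x)" for k
    using p[of k] by (auto simp: A_def)
  then obtain c where c: "\<And>k. c k \<in> U" "\<And>k. snd (p k) \<le> r (c k)"
      "\<And>k. cball (fst (p k)) (4 * snd (p k)) \<subseteq> ball (c k) (r (c k))"
    by metis
  have "0 < snd (p k)" for k using p[of k] by (auto simp: A_def)
  moreover have "\<exists>k. norm (z - fst (p k)) < snd (p k)" if z: "z \<in> U" for z
  proof -
    obtain d q where dq: "(d, q) \<in> A" "norm (z - d) < q" using cov[OF z] by blast
    then obtain k where "p k = (d, q)"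
      using from_nat_into_surj[OF \<open>countable A\<close> dq(1)] unfolding p_def by blast
    then show ?thesis using dq by (intro exI[of _ k]) simp
  qed
  ultimately show ?thesis using c
    by (intro exI[of _ "\<lambda>k. fst (p k)"] exI[of _ "\<lambda>k. snd (p k)"] exI[of _ c]) blast
qed

definition bump :: "'a \<Rightarrow> real \<Rightarrow> 'a \<Rightarrow> real" where
  "bump d q x = step ((4 * q\<^sup>2 - (norm (x - d))\<^sup>2) / q\<^sup>2)"

lemma bump_bounds: "0 \<le> bump d q x" "bump d q x \<le> 1"
  by (simp_all add: bump_def step_bounds)

lemma bump_eq_1: "norm (x - d) \<le> q \<Longrightarrow> q > 0 \<Longrightarrow> bump d q x = 1"
  unfolding bump_def
proof (rule step_1)
  assume "norm (x - d) \<le> q" "q > 0"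
  then have "(norm (x - d))\<^sup>2 \<le> q\<^sup>2" by (intro power_mono) auto
  then have "(norm (x - d))\<^sup>2 \<le> 3 * q\<^sup>2" using zero_le_power2[of q] by linarith
  then show "1 \<le> (4 * q\<^sup>2 - (norm (x - d))\<^sup>2) / q\<^sup>2" using \<open>q > 0\<close> by (simp add: le_divide_eq)
qed

lemma bump_eq_0: "2 * q \<le> norm (x - d) \<Longrightarrow> q > 0 \<Longrightarrow> bump d q x = 0"
  unfolding bump_def
proof (rule step_0)
  assume "2 * q \<le> norm (x - d)" "q > 0"
  then have "(2 * q)\<^sup>2 \<le> (norm (x - d))\<^sup>2" by (intro power_mono) auto
  then show "(4 * q\<^sup>2 - (norm (x - d))\<^sup>2) / q\<^sup>2 \<le> 0" using \<open>q > 0\<close>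
    by (simp add: divide_le_0_iff power_mult_distrib)
qed

lemma C1_at_bump: "q > 0 \<Longrightarrow> C1_at (bump d q) x"
  unfolding bump_def
  by (intro C1_at_step C1_at_divide C1_at_diff C1_at_norm_power2 C1_at_const C1_at_id) auto

lemma bump_derivative:
  assumes q: "q > 0"
  obtains D where "\<And>x. (bump d q has_derivative blinfun_apply (D x)) (at x)" "continuous_on UNIV D"
    "\<And>x. norm (D x) \<le> 8 / q"
proof -
  have "C1_on UNIV (bump d q)" using C1_at_bump[OF q] by (simp add: C1_on_iff_C1_at)
  then obtain D where D: "\<And>x. (bump d q has_derivative blinfun_apply (D x)) (at x)" "continuous_on UNIV D"
    unfolding C1_on_def by auto
  have "norm (D x) \<le> 8 / q" for x
  proof (rule norm_blinfun_bound)
    fix h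
    let ?u = "(4 * q\<^sup>2 - (norm (x - d))\<^sup>2) / q\<^sup>2"
    have "((\<lambda>x. x - d) has_derivative (\<lambda>h. h)) (at x)" by (auto intro!: derivative_eq_intros)
    from has_derivative_compose[OF this dsq(1)]
    have "((\<lambda>x. (norm (x - d))\<^sup>2) has_derivative blinfun_apply (dsq (x - d))) (at x)" by simp
    then have "((\<lambda>x. (4 * q\<^sup>2 - (norm (x - d))\<^sup>2) / q\<^sup>2) has_derivative (\<lambda>h. (0 - dsq (x - d) h) / q\<^sup>2)) (at x)"
      unfolding divide_inverse by (intro has_derivative_mult_left has_derivative_diff has_derivative_const)
    from has_derivative_compose[OF this step_derivative[unfolded has_field_derivative_def]]
    have "(bump d q has_derivative (\<lambda>h. step_deriv ?u * ((0 - dsq (x - d) h) / q\<^sup>2))) (at x)"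
      unfolding bump_def .
    then have "blinfun_apply (D x) = (\<lambda>h. step_deriv ?u * ((0 - dsq (x - d) h) / q\<^sup>2))"
      by (rule has_derivative_unique[OF D(1)])
    then have "D x h = step_deriv ?u * ((0 - dsq (x - d) h) / q\<^sup>2)" by (rule fun_cong)
    then have "norm (D x h) = step_deriv ?u * \<bar>dsq (x - d) h\<bar> / q\<^sup>2"
      using step_deriv_bounds[of ?u] by (simp add: abs_mult)
    also have "\<dots> \<le> 8 / q * norm h"
    proof (cases "?u \<le> 0")
      case True
      then show ?thesis using q by (simp add: step_deriv_eq_0)
    next
      case False
      \<comment> \<open>Where the step is not flat, \<open>x\<close> is within \<open>2 * q\<close>
        of \<open>d\<close>, so the squared norm has slope at most \<open>4 * q\<close>. The slope 2
        of \<open>step\<close> and the division by \<open>q\<^sup>2\<close> give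
        \<open>8 / q\<close>.\<close>
      then have "(norm (x - d))\<^sup>2 < (2 * q)\<^sup>2" using q by (simp add: power_mult_distrib divide_le_0_iff not_le)
      then have n: "norm (x - d) \<le> 2 * q" by (rule less_imp_le[OF power2_less_imp_less]) (use q in simp)
      have "\<bar>dsq (x - d) h\<bar> \<le> norm (dsq (x - d)) * norm h" using norm_blinfun[of "dsq (x - d)" h] by simp
      also have "\<dots> \<le> (4 * q) * norm h" using norm_dsq_le[of "x - d"] n by (intro mult_right_mono) auto
      finally have "step_deriv ?u * \<bar>dsq (x - d) h\<bar> \<le> 2 * ((4 * q) * norm h)"
        using step_deriv_bounds[of ?u] by (intro mult_mono) auto
      then show ?thesis using q by (simp add: field_simps power2_eq_square)
    qed
    finally show "norm (D x h) \<le> 8 / q * norm h" .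
  qed (use q in simp)
  then show ?thesis using that D by blast
qed

lemma C1_at_suminf:
  fixes F :: "nat \<Rightarrow> 'a \<Rightarrow> real" and F' :: "nat \<Rightarrow> 'a \<Rightarrow> 'a \<Rightarrow>\<^sub>L real"
  assumes der: "\<And>k x. (F k has_derivative blinfun_apply (F' k x)) (at x)" and cont: "\<And>k. continuous_on UNIV (F' k)"
    and sF: "\<And>x. summable (\<lambda>k. F k x)" and M: "\<And>k x. norm (F' k x) \<le> M k" "summable M"
  shows "C1_at (\<lambda>x. \<Sum>k. F k x) x"
proof -
  define G where "G x = (\<Sum>k. F' k x)" for x
  have ul: "uniform_limit UNIV (\<lambda>n x. \<Sum>k<n. F' k x) G sequentially"
    unfolding G_def by (rule Weierstrass_m_test) (use M in auto)
  have contG: "continuous_on UNIV G"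
    by (rule uniform_limit_theorem[OF _ ul]) (auto intro!: always_eventually continuous_on_sum cont)
  have "\<exists>g. \<forall>x\<in>UNIV. (\<lambda>n. F n x) sums g x \<and> (g has_derivative blinfun_apply (G x)) (at x within UNIV)"
  proof (rule has_derivative_series)
    show "convex (UNIV :: 'a set)" by simp
    show "(F n has_derivative blinfun_apply (F' n x)) (at x within UNIV)" for n x using der by simp
    show "\<forall>\<^sub>F n in sequentially. \<forall>x\<in>UNIV. \<forall>h. norm ((\<Sum>i<n. F' i x h) - G x h) \<le> d * norm h" if "d > 0" for d
      using uniform_limitD[OF ul that]
    proof eventually_elim
      case (elim n)
      show ?case
      proof (intro ballI allI)
        fix x h
        have "norm (((\<Sum>k<n. F' k x) - G x) h) \<le> norm ((\<Sum>k<n. F' k x) - G x) * norm h" by (rule norm_blinfun)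
        also have "\<dots> \<le> d * norm h" using elim by (intro mult_right_mono) (auto simp: dist_norm less_imp_le)
        finally show "norm ((\<Sum>i<n. F' i x h) - G x h) \<le> d * norm h"
          by (simp add: blinfun.diff_left blinfun.sum_left)
      qed
    qed
    show "(\<lambda>n. F n 0) sums (\<Sum>k. F k 0)" using sF by (simp add: summable_sums)
  qed simp
  then obtain g where g: "\<And>x. (\<lambda>n. F n x) sums g x" "\<And>x. (g has_derivative blinfun_apply (G x)) (at x)" by auto
  have "g = (\<lambda>x. \<Sum>k. F k x)" using g(1) by (simp add: sums_iff fun_eq_iff)
  then show ?thesis using g contG by (intro C1_atI[where W=UNIV and F'=G]) auto
qed

text \<open>A smooth substitute for the distance to the complement of \<open>U\<close>, so flat and
  so small that the ball of ten times its value always fits into a single ball of the given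
  cover.\<close>

lemma ex_gauge:
  fixes r :: "'a \<Rightarrow> real"
  assumes r: "\<And>x. x \<in> U \<Longrightarrow> 0 < r x" "\<And>x. x \<in> U \<Longrightarrow> ball x (r x) \<subseteq> U"
  obtains g :: "'a \<Rightarrow> real" where "\<And>x. C1_at g x" "\<And>x y. \<bar>g x - g y\<bar> \<le> norm (x - y) / 100"
    "\<And>x. 0 \<le> g x" "\<And>x. g x > 0 \<longleftrightarrow> x \<in> U"
    "\<And>z. z \<in> U \<Longrightarrow> \<exists>x\<in>U. g z \<le> r x \<and> cball z (10 * g z) \<subseteq> ball x (r x)"
proof (cases "U = {}")
  case True
  then show ?thesis using that[of "\<lambda>_. 0"] by simp
next
  case False
  have "\<exists>(d :: nat \<Rightarrow> 'a) q c. (\<forall>k. 0 < q k \<and> c k \<in> U \<and> q k \<le> r (c k) \<and>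
    cball (d k) (4 * q k) \<subseteq> ball (c k) (r (c k))) \<and> (\<forall>z\<in>U. \<exists>k. norm (z - d k) < q k)"
    by (rule countable_cover[OF False r(1)])
  then obtain d :: "nat \<Rightarrow> 'a" and q c where
    q: "\<And>k. q k > 0" and c: "\<And>k. c k \<in> U" "\<And>k. q k \<le> r (c k)" "\<And>k. cball (d k) (4 * q k) \<subseteq> ball (c k) (r (c k))"
    and cov: "\<And>z. z \<in> U \<Longrightarrow> \<exists>k. norm (z - d k) < q k" by blast
  \<comment> \<open>The factor 800 turns the bump slope \<open>8 / q k\<close> into the Lipschitz
    constant \<open>1/100\<close>; the cap at 1 makes the weighted series converge.\<close>
  define a where "a k = min (q k) 1 / 800" for k
  have a: "0 < a k" "a k \<le> q k / 800" "a k \<le> 1" for k using q[of k] by (auto simp: a_def)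
  define p where "p k = (1/2 :: real) ^ Suc k" for k
  have p: "p k > 0" "p sums 1" for k
    using power_half_series unfolding p_def[abs_def] by simp_all
  have "\<exists>D. (\<forall>x. (bump (d k) (q k) has_derivative blinfun_apply (D x)) (at x)) \<and> continuous_on UNIV D
      \<and> (\<forall>x. norm (D x) \<le> 8 / q k)" for k
    by (rule bump_derivative[OF q[of k]]) blast
  then obtain D where D: "\<And>k x. (bump (d k) (q k) has_derivative blinfun_apply (D k x)) (at x)"
    "\<And>k. continuous_on UNIV (D k)" "\<And>k x. norm (D k x) \<le> 8 / q k"
    by metis
  let ?F = "\<lambda>k x. p k * (a k * bump (d k) (q k) x)"
  have F0: "0 \<le> ?F k x" for k x using p(1)[of k] a(1)[of k] bump_bounds(1)[of "d k" "q k" x] by simp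
  have F1: "a k * bump (d k) (q k) x \<le> 1" for k x
    using a[of k] bump_bounds[of "d k" "q k" x] by (intro mult_le_one) auto
  have sp: "summable p" using p(2) sums_summable by blast
  have sF: "summable (\<lambda>k. ?F k x)" for x
  proof (rule summable_comparison_test'[OF sp])
    show "norm (?F k x) \<le> p k" for k
      using F0[of k x] F1[of k x] p(1)[of k] by (simp add: mult_left_le)
  qed
  define F' where "F' k x = (p k * a k) *\<^sub>R D k x" for k x
  have F': "(?F k has_derivative blinfun_apply (F' k x)) (at x)" for k x
    using has_derivative_mult_right[OF D(1), of "p k * a k" k x]
    by (simp add: F'_def scaleR_blinfun.rep_eq mult.assoc)
  have nF': "norm (F' k x) \<le> p k * (1/100)" for k x
  proof -
    have "a k * norm (D k x) \<le> (q k / 800) * (8 / q k)"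
      using a[of k] D(3)[of k x] q[of k] by (intro mult_mono) auto
    then have "a k * norm (D k x) \<le> 1/100" using q[of k] by simp
    then show ?thesis using p(1)[of k] a[of k] by (simp add: F'_def mult.assoc)
  qed
  define g where "g x = (\<Sum>k. ?F k x)" for x
  have lip: "\<bar>?F k x - ?F k y\<bar> \<le> p k * (1/100) * norm (x - y)" for k x y
    using differentiable_bound[of UNIV "?F k" "\<lambda>x. blinfun_apply (F' k x)" "p k * (1/100)" x y] F' nF'
    by (simp add: norm_blinfun.rep_eq)
  have gpos: "g x > 0" if x: "x \<in> U" for x
  proof -
    obtain k where k: "norm (x - d k) < q k" using cov[OF x] by blast
    then have "?F k x > 0" using bump_eq_1[of x "d k" "q k"] q[of k] p(1)[of k] a(1)[of k] by simp
    then show ?thesis unfolding g_def using suminf_pos2[OF sF F0] by blast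
  qed
  have near: "\<exists>k. g x \<le> a k \<and> norm (x - d k) < 2 * q k" if "g x > 0" for x
  proof -
    \<comment> \<open>The value \<open>g x\<close> is an average of the numbers on the right, since
      the weights \<open>p k\<close> sum to 1; some term is at least the average.\<close>
    have "\<exists>k. g x \<le> a k * bump (d k) (q k) x"
    proof (rule ccontr)
      assume "\<not> ?thesis"
      then have less: "0 < p k * g x - ?F k x" for k
        using p(1)[of k] by (simp add: not_le right_diff_distrib[symmetric])
      have "(\<lambda>k. p k * g x - ?F k x) sums (1 * g x - g x)"
        unfolding g_def by (intro sums_diff sums_mult2 p(2) summable_sums sF)
      then show False using suminf_pos[of "\<lambda>k. p k * g x - ?F k x"] less by (simp add: sums_iff)
    qed
    then obtain k where k: "g x \<le> a k * bump (d k) (q k) x" by blast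
    have "bump (d k) (q k) x \<noteq> 0" using k that by auto
    then have "norm (x - d k) < 2 * q k" using bump_eq_0[of "q k" x "d k"] q[of k] by linarith
    moreover have "g x \<le> a k" using k a(1)[of k] bump_bounds[of "d k" "q k" x] by (meson mult_left_le less_imp_le order_trans)
    ultimately show ?thesis by blast
  qed
  show ?thesis
  proof (rule that[of g])
    show "C1_at g x" for x
      unfolding g_def
      by (rule C1_at_suminf[OF F' _ sF nF']) (use D(2) sp in \<open>auto simp: F'_def intro!: continuous_intros summable_mult2\<close>)
    show "\<bar>g x - g y\<bar> \<le> norm (x - y) / 100" for x y
    proof -
      have s: "(\<lambda>k. p k * (1/100) * norm (x - y)) sums (1 * (1/100) * norm (x - y))"
        by (intro sums_mult2 p(2))
      have "summable (\<lambda>k. norm (?F k x - ?F k y))"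
        by (rule summable_comparison_test'[OF sums_summable[OF s]]) (use lip in auto)
      then have "norm (\<Sum>k. ?F k x - ?F k y) \<le> (\<Sum>k. norm (?F k x - ?F k y))" by (rule summable_norm)
      also have "\<dots> \<le> (\<Sum>k. p k * (1/100) * norm (x - y))"
        by (rule suminf_le) (use lip \<open>summable (\<lambda>k. norm (?F k x - ?F k y))\<close> s in \<open>auto simp: sums_iff\<close>)
      also have "\<dots> = norm (x - y) / 100" using s by (simp add: sums_iff)
      finally show ?thesis unfolding g_def using suminf_diff[OF sF sF, of x y] by simp
    qed
    show "0 \<le> g x" for x unfolding g_def by (intro suminf_nonneg sF F0)
    show inU: "g x > 0 \<longleftrightarrow> x \<in> U" for x
    proof
      assume "g x > 0"
      then obtain k where "norm (x - d k) < 2 * q k" using near by blast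
      then have "x \<in> cball (d k) (4 * q k)" using q[of k] by (simp add: dist_norm norm_minus_commute)
      then show "x \<in> U" using c(3)[of k] r(2)[OF c(1)[of k]] by blast
    qed (rule gpos)
    show "\<exists>x\<in>U. g z \<le> r x \<and> cball z (10 * g z) \<subseteq> ball x (r x)" if z: "z \<in> U" for z
    proof -
      obtain k where k: "g z \<le> a k" "norm (z - d k) < 2 * q k" using near[OF gpos[OF z]] by blast
      have "cball z (10 * g z) \<subseteq> cball (d k) (4 * q k)"
      proof
        fix y assume "y \<in> cball z (10 * g z)"
        then have "norm (y - z) \<le> 10 * g z" by (simp add: dist_norm norm_minus_commute)
        moreover have "10 * g z \<le> q k" using k(1) a(2)[of k] q[of k] by linarith
        ultimately have "norm (y - d k) \<le> 4 * q k"
          using norm_triangle_ineq[of "y - z" "z - d k"] k(2) q[of k] by simp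
        then show "y \<in> cball (d k) (4 * q k)" by (simp add: dist_norm norm_minus_commute)
      qed
      moreover have "g z \<le> r (c k)" using k(1) a(2)[of k] c(2)[of k] q[of k] by linarith
      ultimately show ?thesis using c(1,3)[of k] by blast
    qed
  qed
qed

lemma C1_approx:
  fixes F :: "'a \<Rightarrow> 'b::real_normed_vector" and \<epsilon> :: "'a \<Rightarrow> real"
  assumes U: "open U" and F: "continuous_on U F" and \<epsilon>: "continuous_on U \<epsilon>" "\<And>x. x \<in> U \<Longrightarrow> \<epsilon> x > 0"
    and dense: "\<And>y d. d > 0 \<Longrightarrow> \<exists>T\<in>\<T>. norm (y - T) \<le> d"
  obtains L where "\<And>x. x \<in> U \<Longrightarrow> C1_at L x" "\<And>x. x \<in> U \<Longrightarrow> norm (L x - F x) \<le> \<epsilon> x"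
    "\<And>x. x \<in> U \<Longrightarrow> \<exists>S\<subseteq>\<T>. finite S \<and> (\<forall>\<^sub>F y in nhds x. L y \<in> convex hull S)"
proof (cases "U = {}")
  case True
  then show ?thesis using that by simp
next
  case False
  have "\<exists>r T. r > 0 \<and> T \<in> \<T> \<and> (\<forall>y\<in>ball x r. y \<in> U \<and> norm (T - F y) \<le> \<epsilon> y)" if x: "x \<in> U" for x
  proof -
    obtain T where T: "T \<in> \<T>" "norm (F x - T) \<le> \<epsilon> x / 2" using dense[of "\<epsilon> x / 2"] \<epsilon>(2)[OF x] by auto
    have "isCont (\<lambda>y. \<epsilon> y - norm (T - F y)) x"
      using F \<epsilon>(1) U x by (intro continuous_intros) (auto simp: continuous_on_eq_continuous_at)
    moreover have "\<epsilon> x - norm (T - F x) > 0" using T \<epsilon>(2)[OF x] by (simp add: norm_minus_commute)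
    ultimately have "\<forall>\<^sub>F y in nhds x. \<epsilon> y - norm (T - F y) > 0"
      using tendsto_at_iff_tendsto_nhds[of "\<lambda>y. \<epsilon> y - norm (T - F y)" x] order_tendstoD(1)
      unfolding isCont_def by blast
    moreover have "\<forall>\<^sub>F y in nhds x. y \<in> U" using U x by (rule eventually_nhds_in_open)
    ultimately have "\<forall>\<^sub>F y in nhds x. y \<in> U \<and> norm (T - F y) \<le> \<epsilon> y" by eventually_elim auto
    then obtain r where "r > 0" "\<And>y. dist y x < r \<Longrightarrow> y \<in> U \<and> norm (T - F y) \<le> \<epsilon> y"
      unfolding eventually_nhds_metric by blast
    then show ?thesis using T by (intro exI[of _ r] exI[of _ T]) (simp add: dist_commute)
  qed
  then obtain r T where rT: "\<And>x. x \<in> U \<Longrightarrow> r x > 0 \<and> T x \<in> \<T> \<and> (\<forall>y\<in>ball x (r x). y \<in> U \<and> norm (T x - F y) \<le> \<epsilon> y)"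
    by metis
  have "\<exists>(d :: nat \<Rightarrow> 'a) q c. (\<forall>k. 0 < q k \<and> c k \<in> U \<and> q k \<le> r (c k) \<and>
    cball (d k) (4 * q k) \<subseteq> ball (c k) (r (c k))) \<and> (\<forall>z\<in>U. \<exists>k. norm (z - d k) < q k)"
    by (rule countable_cover[OF False]) (use rT in blast)
  then obtain d :: "nat \<Rightarrow> 'a" and q c where
    q: "\<And>k. q k > 0" and c: "\<And>k. c k \<in> U" "\<And>k. q k \<le> r (c k)" "\<And>k. cball (d k) (4 * q k) \<subseteq> ball (c k) (r (c k))"
    and cov: "\<And>z. z \<in> U \<Longrightarrow> \<exists>k. norm (z - d k) < q k" by blast
  define b where "b k = bump (d k) (q k)" for k
  define \<psi> where "\<psi> k x = b k x * (\<Prod>i<k. 1 - b i x)" for k x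
  have b: "0 \<le> b k x" "b k x \<le> 1" "C1_at (b k) x" for k x
    using bump_bounds C1_at_bump q by (auto simp: b_def)
  have \<psi>0: "0 \<le> \<psi> k x" for k x
    using b by (auto simp: \<psi>_def intro!: mult_nonneg_nonneg prod_nonneg)
  have sum_\<psi>: "(\<Sum>k<n. \<psi> k x) = 1 - (\<Prod>i<n. 1 - b i x)" for n x
    by (induction n) (auto simp: \<psi>_def algebra_simps)
  have \<psi>_support: "norm (T (c k) - F x) \<le> \<epsilon> x" if "\<psi> k x \<noteq> 0" for k x
  proof -
    have "b k x \<noteq> 0" using that by (auto simp: \<psi>_def)
    then have "norm (x - d k) < 2 * q k" using bump_eq_0[of "q k" x "d k"] q[of k] unfolding b_def by linarith
    then have "x \<in> cball (d k) (4 * q k)" using q[of k] by (simp add: dist_norm norm_minus_commute)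
    then show ?thesis using c(3)[of k] rT[OF c(1)[of k]] by blast
  qed
  \<comment> \<open>The functions \<open>\<psi> k\<close> form a partition of unity that stops at
    the first \<open>k\<close> with \<open>x\<close> in the inner ball, where \<open>b k\<close> is
    1 and all later products vanish. By \<open>L_eq\<close> any later admissible index gives the
    same sum, so \<open>L\<close> is locally one finite sum.\<close>
  define L where "L x = (\<Sum>k<Suc (LEAST k. norm (x - d k) < q k). \<psi> k x *\<^sub>R T (c k))" for x
  have L_eq: "L x = (\<Sum>k<Suc m. \<psi> k x *\<^sub>R T (c k))" if m: "norm (x - d m) < q m" for x m
    unfolding L_def
  proof (rule sum.mono_neutral_left)
    let ?l = "LEAST k. norm (x - d k) < q k"
    have l: "norm (x - d ?l) < q ?l" by (rule LeastI[of _ m]) (rule m)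
    show "{..<Suc ?l} \<subseteq> {..<Suc m}" using Least_le[of "\<lambda>k. norm (x - d k) < q k", OF m] by auto
    have "b ?l x = 1" unfolding b_def by (rule bump_eq_1) (use l q in auto)
    then show "\<forall>k\<in>{..<Suc m} - {..<Suc ?l}. \<psi> k x *\<^sub>R T (c k) = 0"
      by (auto simp: \<psi>_def intro!: prod_zero bexI[of _ ?l])
  qed simp
  have sum1: "(\<Sum>k<Suc m. \<psi> k x) = 1" if m: "norm (x - d m) < q m" for x m
  proof -
    have "b m x = 1" unfolding b_def by (rule bump_eq_1) (use m q in auto)
    then show ?thesis unfolding sum_\<psi> by (simp add: prod_zero_iff)
  qed
  have ev: "\<forall>\<^sub>F y in nhds x. norm (y - d m) < q m" if "norm (x - d m) < q m" for x m
  proof -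
    have "open {y. norm (y - d m) < q m}" by (intro open_Collect_less continuous_intros)
    then show ?thesis using that eventually_nhds_in_open[of "{y. norm (y - d m) < q m}" x] by simp
  qed
  show ?thesis
  proof (rule that[of L])
    fix x assume x: "x \<in> U"
    obtain m where m: "norm (x - d m) < q m" using cov[OF x] by blast
    have "C1_at (\<lambda>y. \<Sum>k<Suc m. \<psi> k y *\<^sub>R T (c k)) x"
      unfolding \<psi>_def by (intro C1_at_sum C1_at_scaleR C1_at_mult C1_at_prod C1_at_diff b C1_at_const)
    then show "C1_at L x"
      by (rule C1_at_cong) (use ev[OF m] L_eq in \<open>auto elim!: eventually_mono\<close>)
    have "L x - F x = (\<Sum>k<Suc m. \<psi> k x *\<^sub>R (T (c k) - F x))"
      using sum1[OF m] by (simp add: L_eq[OF m] scaleR_diff_right sum_subtractf scaleR_sum_left[symmetric] del: sum.lessThan_Suc)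
    also have "norm \<dots> \<le> (\<Sum>k<Suc m. \<psi> k x * \<epsilon> x)"
    proof (rule order_trans[OF norm_sum sum_mono])
      fix k show "norm (\<psi> k x *\<^sub>R (T (c k) - F x)) \<le> \<psi> k x * \<epsilon> x"
        using \<psi>0[of k x] \<psi>_support[of k x] by (cases "\<psi> k x = 0") (auto intro: mult_left_mono)
    qed
    also have "\<dots> = \<epsilon> x" using sum1[OF m] by (simp add: sum_distrib_right[symmetric] del: sum.lessThan_Suc)
    finally show "norm (L x - F x) \<le> \<epsilon> x" .
    show "\<exists>S\<subseteq>\<T>. finite S \<and> (\<forall>\<^sub>F y in nhds x. L y \<in> convex hull S)"
    proof (intro exI[of _ "(\<lambda>k. T (c k)) ` {..<Suc m}"] conjI)
      show "\<forall>\<^sub>F y in nhds x. L y \<in> convex hull ((\<lambda>k. T (c k)) ` {..<Suc m})"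
        using ev[OF m]
      proof eventually_elim
        case (elim y)
        show ?case unfolding L_eq[OF elim]
          by (rule convex_sum) (use sum1[OF elim] \<psi>0 in \<open>auto simp: hull_inc\<close>)
      qed
    qed (use rT c in auto)
  qed
qed

end

section \<open>Pointwise Lipschitz constants of quotients and smooth minima\<close>

lemma calm_divide:
  fixes F G :: "'a::real_normed_vector \<Rightarrow> real"
  assumes F: "C1_at F x" "calm F x K" and G: "C1_at G x" "calm G x L" "G x > 0"
  shows "calm (\<lambda>y. F y / G y) x (K / G x + \<bar>F x\<bar> * L / (G x)\<^sup>2)"
proof -
  obtain F' G' where D: "(F has_derivative blinfun_apply F') (at x)" "(G has_derivative blinfun_apply G') (at x)"
    using F G by (metis C1_at_derivative)
  have nz: "G x \<noteq> 0" using G by simp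
  show ?thesis
  proof (rule calm_of_derivative[OF has_derivative_divide'[OF D nz]])
    fix h
    have "norm ((F' h * G x - F x * G' h) / (G x * G x)) = \<bar>F' h / G x - F x * G' h / (G x)\<^sup>2\<bar>"
      using nz by (simp add: field_simps power2_eq_square)
    also have "\<dots> \<le> \<bar>F' h\<bar> / G x + \<bar>F x\<bar> * \<bar>G' h\<bar> / (G x)\<^sup>2"
      using G(3) abs_triangle_ineq4[of "F' h / G x" "F x * G' h / (G x)\<^sup>2"] by (simp add: abs_mult)
    also have "\<dots> \<le> (K * norm h) / G x + \<bar>F x\<bar> * (L * norm h) / (G x)\<^sup>2"
      using calm_derivative[OF D(1) F(2), of h] calm_derivative[OF D(2) G(2), of h] G(3)
      by (intro add_mono divide_right_mono mult_left_mono) auto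
    finally show "norm ((F' h * G x - F x * G' h) / (G x * G x)) \<le> (K / G x + \<bar>F x\<bar> * L / (G x)\<^sup>2) * norm h"
      by (simp add: algebra_simps)
  qed
qed

text \<open>A smooth minimum is monotone and commutes with adding the same number to all entries. A
  common part \<open>A\<close> therefore passes through untouched and only deviations from it enter
  \<open>K\<close>; with \<open>A\<close> linear this measures the distance of derivatives from
  \<open>A\<close>.\<close>

lemma calm_softmin:
  fixes v k :: "'i \<Rightarrow> 'a::real_normed_vector \<Rightarrow> real"
  assumes J: "finite J" "i \<in> J" and v: "\<And>j. j \<in> J \<Longrightarrow> calm (\<lambda>y. v j y - A y) x K"
    and k: "\<And>j. j \<in> J \<Longrightarrow> calm (k j) x L" "\<And>j. j \<in> J \<Longrightarrow> k j x > 0"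
  shows "calm (\<lambda>y. softmin J (\<lambda>j. v j y) (\<lambda>j. k j y) - A y) x (K + L)"
  unfolding calm_def
proof (intro allI impI)
  fix c assume c: "K + L < c"
  define d where "d = (c - (K + L)) / 2"
  have d: "K < K + d" "L < L + d" using c by (auto simp: d_def)
  have "\<forall>\<^sub>F y in nhds x. \<forall>j\<in>J. norm (v j y - A y - (v j x - A x)) \<le> (K + d) * norm (y - x)
      \<and> norm (k j y - k j x) \<le> (L + d) * norm (y - x) \<and> k j y > 0"
  proof (intro eventually_ball_finite J ballI eventually_conj)
    fix j assume j: "j \<in> J"
    show "\<forall>\<^sub>F y in nhds x. k j y > 0" by (rule order_tendstoD(1)[OF calm_tendsto[OF k(1)[OF j]] k(2)[OF j]])
    show "\<forall>\<^sub>F y in nhds x. norm (v j y - A y - (v j x - A x)) \<le> (K + d) * norm (y - x)"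
      "\<forall>\<^sub>F y in nhds x. norm (k j y - k j x) \<le> (L + d) * norm (y - x)"
      using v[OF j] k(1)[OF j] d unfolding calm_def by blast+
  qed
  then show "\<forall>\<^sub>F y in nhds x. norm (softmin J (\<lambda>j. v j y) (\<lambda>j. k j y) - A y
      - (softmin J (\<lambda>j. v j x) (\<lambda>j. k j x) - A x)) \<le> c * norm (y - x)"
  proof eventually_elim
    case (elim y)
    have cd: "c * norm (y - x) = (K + d) * norm (y - x) + (L + d) * norm (y - x)"
      by (simp add: d_def field_simps)
    have "softmin J (\<lambda>j. v j y) (\<lambda>j. k j y) \<le> softmin J (\<lambda>j. v j x) (\<lambda>j. k j x) + (A y - A x + c * norm (y - x))"
    proof (rule softmin_shift[OF J])
      fix j assume j: "j \<in> J"
      show "0 < k j y \<and> 0 < k j x" using elim k j by blast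
      show "v j y - v j x + \<bar>k j y - k j x\<bar> \<le> A y - A x + c * norm (y - x)"
        using bspec[OF elim j] cd unfolding real_norm_def by linarith
    qed
    moreover have "softmin J (\<lambda>j. v j x) (\<lambda>j. k j x) \<le> softmin J (\<lambda>j. v j y) (\<lambda>j. k j y) + (A x - A y + c * norm (y - x))"
    proof (rule softmin_shift[OF J])
      fix j assume j: "j \<in> J"
      show "0 < k j x \<and> 0 < k j y" using elim k j by blast
      show "v j x - v j y + \<bar>k j x - k j y\<bar> \<le> A x - A y + c * norm (y - x)"
        using bspec[OF elim j] cd unfolding real_norm_def by linarith
    qed
    ultimately show ?case unfolding real_norm_def by linarith
  qed
qed

section \<open>The filter along a basis\<close>

text \<open>\<open>\<eta>\<close> is the length scale and \<open>\<epsilon>\<close> the tolerance.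
  By \<open>gauge\<close>, on balls of radius \<open>10 * \<eta> z\<close> the tolerance is nearly
  constant, \<open>f'\<close> and \<open>L\<close> are within comparable distance of each other, and
  the slope of \<open>L\<close> is negligible over \<open>20 * \<eta> z\<close>, the largest
  distance of two points of the ball.\<close>

locale filter_data = smooth_basis e for e :: "nat \<Rightarrow> 'a::banach" +
  fixes U :: "'a set" and f :: "'a \<Rightarrow> real ^ 'd" and f' L :: "'a \<Rightarrow> 'a \<Rightarrow>\<^sub>L (real ^ 'd)"
    and \<epsilon> \<eta> :: "'a \<Rightarrow> real" and w :: "'a \<Rightarrow>\<^sub>L (real ^ 'd)"
  assumes U: "open U"
    and f: "\<And>x. x \<in> U \<Longrightarrow> (f has_derivative blinfun_apply (f' x)) (at x)" "continuous_on U f'"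
    and L: "\<And>x. x \<in> U \<Longrightarrow> C1_at L x"
    and L_tail: "\<And>x. x \<in> U \<Longrightarrow> \<exists>N. \<forall>\<^sub>F y in nhds x. \<exists>r>0. \<forall>m\<ge>N. blinfun_apply (L y) (e m) = r *\<^sub>R w (e m)"
    and \<epsilon>: "\<And>x. C1_at \<epsilon> x" "\<And>x y. \<bar>\<epsilon> x - \<epsilon> y\<bar> \<le> norm (x - y) / 100" "\<And>x. 0 \<le> \<epsilon> x"
    and \<eta>: "\<And>x. C1_at \<eta> x" "\<And>x y. \<bar>\<eta> x - \<eta> y\<bar> \<le> norm (x - y) / 100" "\<And>x. 0 \<le> \<eta> x" "\<And>x. \<eta> x > 0 \<longleftrightarrow> x \<in> U" "\<And>x. \<eta> x \<le> 1"
    and gauge: "\<And>z. z \<in> U \<Longrightarrow> \<exists>a>0. \<eta> z \<le> a \<and> (\<forall>y\<in>cball z (10 * \<eta> z). y \<in> U \<and> a \<le> \<epsilon> y \<and> \<epsilon> y \<le> 5/4 * a \<and>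
      norm (f' y - f' z) \<le> a \<and> norm (L y - f' y) \<le> 5/4 * a \<and> (\<exists>K. calm L y K \<and> K * (20 * \<eta> z) \<le> a))"
begin

abbreviation aff :: "'a \<Rightarrow> 'a \<Rightarrow> real ^ 'd" where
  "aff z x \<equiv> f z + blinfun_apply (L z) (x - z)"

abbreviation gap :: "nat \<Rightarrow> nat \<Rightarrow> 'a \<Rightarrow> real" where
  "gap j n x \<equiv> norm (proj n x - proj j x)"

abbreviation \<beta> :: "nat \<Rightarrow> 'a \<Rightarrow> real" where
  "\<beta> j x \<equiv> \<epsilon> (proj j x) * \<eta> (proj j x)"

text \<open>The penalty switches a candidate off smoothly before it leaves the window: it starts when the gap
  reaches \<open>3 * \<eta>\<close> and has removed the candidate from the minimum by \<open>4 * \<eta>\<close>, while the window extends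
  to \<open>5 * \<eta>\<close>.\<close>

definition cand :: "'d \<Rightarrow> nat \<Rightarrow> nat \<Rightarrow> 'a \<Rightarrow> real" where
  "cand l n j x = aff (proj j x) x $ l + \<beta> j x * sq_pos ((gap j n x)\<^sup>2 / (\<eta> (proj j x))\<^sup>2 - 9)"

definition window :: "nat \<Rightarrow> nat \<Rightarrow> 'a \<Rightarrow> nat set" where
  "window i n x = {j. j \<le> i \<and> gap j n x < 5 * \<eta> (proj j x)}"

text \<open>Two indices keep two effects apart: \<open>i\<close> bounds the candidates,
  \<open>n\<close> is the resolution at which the penalties see \<open>x\<close>. The stages use
  \<open>i = n\<close>; the mixed terms separate the rise in \<open>n\<close> from the fall caused
  by new candidates.\<close>

definition filt :: "nat \<Rightarrow> nat \<Rightarrow> 'd \<Rightarrow> 'a \<Rightarrow> real" where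
  "filt i n l x = softmin (window i n x) (\<lambda>j. cand l n j x) (\<lambda>j. \<beta> j x)"

text \<open>The bound is below 3, so that candidates after \<open>i\<close> carry no penalty, and
  above the factor 2 of \<open>ready\<close>, so that ready indices keep all later ones
  anchored.\<close>

definition anchored :: "nat \<Rightarrow> 'a \<Rightarrow> bool" where
  "anchored i x \<longleftrightarrow> norm (x - proj i x) < 5/2 * \<eta> (proj i x)"

lemma finite_window [simp]: "finite (window i n x)"
  by (rule finite_subset[of _ "{..i}"]) (auto simp: window_def)

lemma C1_at_f: "x \<in> U \<Longrightarrow> C1_at f x"
  using f U by (intro C1_atI[where W=U and F'=f'])

lemma C1_at_proj: "C1_at G (proj j x) \<Longrightarrow> C1_at (\<lambda>y. G (proj j y)) x"
  by (rule C1_at_compose[OF C1_at_linear[OF bounded_linear_proj]])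

lemma anchored_pos: "anchored i x \<Longrightarrow> \<eta> (proj i x) > 0 \<and> proj i x \<in> U"
  unfolding anchored_def \<eta>(4)[symmetric] using norm_ge_zero[of "x - proj i x"] by linarith

lemma window_pos: "j \<in> window i n x \<Longrightarrow> \<eta> (proj j x) > 0 \<and> proj j x \<in> U"
  unfolding window_def \<eta>(4)[symmetric] mem_Collect_eq using norm_ge_zero[of "proj n x - proj j x"] by linarith

lemma \<epsilon>_pos: assumes "x \<in> U" shows "\<epsilon> x > 0"
proof -
  obtain a where "a > 0" "\<forall>y\<in>cball x (10 * \<eta> x). a \<le> \<epsilon> y" using gauge[OF assms] by blast
  moreover have "x \<in> cball x (10 * \<eta> x)" using \<eta>(3)[of x] by simp
  ultimately show ?thesis using bspec[of _ "\<lambda>y. a \<le> \<epsilon> y" x] by fastforce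
qed

lemma \<beta>_pos: "proj j x \<in> U \<Longrightarrow> \<beta> j x > 0"
  using \<epsilon>_pos \<eta>(4) by simp

lemma later_near:
  assumes "anchored i x" "i \<le> k"
  shows "norm (proj k x - proj i x) < 5/2 * \<eta> (proj i x)" "norm (x - proj k x) < 5/2 * \<eta> (proj i x)"
    "\<bar>\<eta> (proj k x) - \<eta> (proj i x)\<bar> \<le> 1/40 * \<eta> (proj i x)"
proof -
  show 1: "norm (proj k x - proj i x) < 5/2 * \<eta> (proj i x)"
    using norm_proj_diff_le_tail[OF assms(2), of x] assms(1) by (simp add: anchored_def)
  show "norm (x - proj k x) < 5/2 * \<eta> (proj i x)"
    using norm_tail_mono[OF assms(2), of x] assms(1) by (simp add: anchored_def)
  show "\<bar>\<eta> (proj k x) - \<eta> (proj i x)\<bar> \<le> 1/40 * \<eta> (proj i x)"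
    using \<eta>(2)[of "proj k x" "proj i x"] 1 by linarith
qed

text \<open>A distance of \<open>5 * \<eta> (proj j x)\<close> changes \<open>\<eta>\<close> by at
  most 5 percent; expressed through \<open>\<eta> (proj i x)\<close> the factors 5 become 6.\<close>

lemma window_near:
  assumes "j \<in> window i n x" "i \<le> n"
  shows "norm (proj j x - proj i x) \<le> 6 * \<eta> (proj i x)"
    "\<bar>\<eta> (proj j x) - \<eta> (proj i x)\<bar> \<le> 6/100 * \<eta> (proj i x)"
proof -
  have "j \<le> i" "gap j n x < 5 * \<eta> (proj j x)" using assms by (auto simp: window_def)
  then have g: "norm (proj i x - proj j x) < 5 * \<eta> (proj j x)"
    using norm_proj_diff_mono[of j i n x] assms(2) by linarith
  have "\<bar>\<eta> (proj j x) - \<eta> (proj i x)\<bar> \<le> norm (proj i x - proj j x) / 100"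
    using \<eta>(2)[of "proj j x" "proj i x"] by (simp add: norm_minus_commute)
  with g show "norm (proj j x - proj i x) \<le> 6 * \<eta> (proj i x)"
    "\<bar>\<eta> (proj j x) - \<eta> (proj i x)\<bar> \<le> 6/100 * \<eta> (proj i x)"
    unfolding norm_minus_commute[of "proj j x"] by linarith+
qed

lemma anchored_region:
  assumes "anchored i x"
  obtains a where "a > 0" "\<eta> (proj i x) \<le> a"
    "\<And>y. norm (y - proj i x) \<le> 10 * \<eta> (proj i x) \<Longrightarrow> y \<in> U \<and> a \<le> \<epsilon> y \<and> \<epsilon> y \<le> 5/4 * a \<and>
      norm (f' y - f' (proj i x)) \<le> a \<and> norm (L y - f' y) \<le> 5/4 * a \<and>
      (\<exists>K. calm L y K \<and> K * (20 * \<eta> (proj i x)) \<le> a)"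
proof -
  obtain a where a: "a > 0" "\<eta> (proj i x) \<le> a" "\<forall>y\<in>cball (proj i x) (10 * \<eta> (proj i x)). y \<in> U \<and> a \<le> \<epsilon> y \<and> \<epsilon> y \<le> 5/4 * a \<and>
      norm (f' y - f' (proj i x)) \<le> a \<and> norm (L y - f' y) \<le> 5/4 * a \<and>
      (\<exists>K. calm L y K \<and> K * (20 * \<eta> (proj i x)) \<le> a)"
    using gauge anchored_pos[OF assms] by blast
  show ?thesis by (rule that[OF a(1,2)]) (use a(3) in \<open>auto simp: dist_norm norm_minus_commute\<close>)
qed

lemma aff_derivative:
  assumes z: "z \<in> U"
  obtains D where "(L has_derivative blinfun_apply D) (at z)"
    "((\<lambda>z. aff z x) has_derivative (\<lambda>v. blinfun_apply (f' z) v - L z v + D v (x - z))) (at z)"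
proof -
  obtain D where D: "(L has_derivative blinfun_apply D) (at z)" using C1_at_derivative[OF L[OF z]] .
  have "((\<lambda>z. x - z) has_derivative (\<lambda>v. - v)) (at z)" by (auto intro!: derivative_eq_intros)
  from has_derivative_add[OF f(1)[OF z] blinfun.FDERIV[OF D this]]
  have "((\<lambda>z. aff z x) has_derivative (\<lambda>v. f' z v + (L z (- v) + D v (x - z)))) (at z)" .
  then show ?thesis using that[OF D] by (simp add: blinfun.minus_right algebra_simps)
qed

text \<open>Moving the base point \<open>z\<close> changes the affine approximation only through
  \<open>f' z - L z\<close>, of size \<open>5/4 * a\<close>, and through the derivative of
  \<open>L\<close> applied across a distance of at most 20 scales, of size \<open>a\<close>.\<close>

lemma aff_Lipschitz:
  assumes i: "anchored i x" and xyz: "norm (x - proj i x) \<le> 10 * \<eta> (proj i x)"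
    "norm (y - proj i x) \<le> 10 * \<eta> (proj i x)" "norm (z - proj i x) \<le> 10 * \<eta> (proj i x)"
  shows "\<bar>aff y x $ l - aff z x $ l\<bar> \<le> 3 * \<epsilon> (proj i x) * norm (y - z)"
proof -
  let ?B = "cball (proj i x) (10 * \<eta> (proj i x))"
  obtain a where a: "a > 0" and reg: "\<And>y. norm (y - proj i x) \<le> 10 * \<eta> (proj i x) \<Longrightarrow> y \<in> U \<and> a \<le> \<epsilon> y \<and> \<epsilon> y \<le> 5/4 * a \<and>
      norm (f' y - f' (proj i x)) \<le> a \<and> norm (L y - f' y) \<le> 5/4 * a \<and>
      (\<exists>K. calm L y K \<and> K * (20 * \<eta> (proj i x)) \<le> a)"
    using anchored_region[OF i] by metis
  have B: "norm (u - proj i x) \<le> 10 * \<eta> (proj i x)" if "u \<in> ?B" for u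
    using that by (simp add: dist_norm norm_minus_commute)
  have "\<exists>F'. ((\<lambda>z. aff z x) has_derivative F') (at u within ?B) \<and> onorm F' \<le> 3 * a" if u: "u \<in> ?B" for u
  proof -
    have uU: "u \<in> U" using reg[OF B[OF u]] by blast
    obtain D where D: "(L has_derivative blinfun_apply D) (at u)"
      "((\<lambda>z. aff z x) has_derivative (\<lambda>v. blinfun_apply (f' u) v - L u v + D v (x - u))) (at u)"
      using aff_derivative[OF uU, of x] .
    obtain K where K: "calm L u K" "K * (20 * \<eta> (proj i x)) \<le> a" using reg[OF B[OF u]] by blast
    have xu: "norm (x - u) \<le> 20 * \<eta> (proj i x)"
      using norm_triangle_ineq4[of "x - proj i x" "u - proj i x"] xyz(1) B[OF u] by simp
    have "onorm (\<lambda>v. blinfun_apply (f' u) v - L u v + D v (x - u)) \<le> 3 * a"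
    proof (rule onorm_bound)
      fix v
      have Dv: "norm (D v) \<le> K * norm v" by (rule calm_derivative[OF D(1) K(1)])
      have "norm (D v (x - u)) \<le> norm (D v) * norm (x - u)" by (rule norm_blinfun)
      also have "\<dots> \<le> (K * norm v) * (20 * \<eta> (proj i x))"
        using Dv xu by (intro mult_mono order_trans[OF norm_ge_zero Dv]) auto
      also have "\<dots> = (K * (20 * \<eta> (proj i x))) * norm v" by simp
      also have "\<dots> \<le> a * norm v" by (rule mult_right_mono[OF K(2)]) simp
      finally have 1: "norm (D v (x - u)) \<le> a * norm v" .
      have "norm (f' u v - L u v) = norm ((L u - f' u) v)" by (simp add: blinfun.diff_left norm_minus_commute)
      also have "\<dots> \<le> norm (L u - f' u) * norm v" by (rule norm_blinfun)
      also have "\<dots> \<le> 5/4 * a * norm v" using reg[OF B[OF u]] by (intro mult_right_mono) auto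
      finally have "norm (f' u v - L u v + D v (x - u)) \<le> 5/4 * a * norm v + a * norm v"
        using 1 norm_triangle_ineq[of "f' u v - L u v" "D v (x - u)"] by linarith
      also have "\<dots> \<le> 3 * a * norm v" using a by (simp add: algebra_simps)
      finally show "norm (f' u v - L u v + D v (x - u)) \<le> 3 * a * norm v" .
    qed (use a in simp)
    then show ?thesis using D(2) has_derivative_at_withinI by blast
  qed
  then have "\<forall>u\<in>?B. \<exists>F'. ((\<lambda>z. aff z x) has_derivative F') (at u within ?B) \<and> onorm F' \<le> 3 * a" by blast
  from bchoice[OF this] obtain F' where F': "\<forall>u\<in>?B. ((\<lambda>z. aff z x) has_derivative F' u) (at u within ?B) \<and> onorm (F' u) \<le> 3 * a"
    by blast
  have "norm (aff y x - aff z x) \<le> 3 * a * norm (y - z)"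
    by (rule differentiable_bound[of ?B "\<lambda>z. aff z x" F'])
      (use F' xyz in \<open>auto simp: dist_norm norm_minus_commute\<close>)
  also have "\<dots> \<le> 3 * \<epsilon> (proj i x) * norm (y - z)"
    using reg[of "proj i x"] anchored_pos[OF i] by (intro mult_right_mono mult_left_mono) auto
  finally show ?thesis using component_le_norm_cart[of "aff y x - aff z x" l] by simp
qed

lemma \<epsilon>_compare:
  assumes "anchored i x" "norm (y - proj i x) \<le> 10 * \<eta> (proj i x)"
  shows "\<epsilon> y \<le> 5/4 * \<epsilon> (proj i x)" "\<epsilon> (proj i x) \<le> 5/4 * \<epsilon> y" "y \<in> U"
proof -
  obtain a where a: "a > 0" "\<And>y. norm (y - proj i x) \<le> 10 * \<eta> (proj i x) \<Longrightarrow> y \<in> U \<and> a \<le> \<epsilon> y \<and> \<epsilon> y \<le> 5/4 * a"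
    using anchored_region[OF assms(1)] by metis
  show "\<epsilon> y \<le> 5/4 * \<epsilon> (proj i x)" "\<epsilon> (proj i x) \<le> 5/4 * \<epsilon> y" "y \<in> U"
    using a(2)[OF assms(2)] a(2)[of "proj i x"] anchored_pos[OF assms(1)] by auto
qed

lemma \<beta>_compare:
  assumes i: "anchored i x" and y: "norm (proj j x - proj i x) \<le> 10 * \<eta> (proj i x)"
    and h: "\<bar>\<eta> (proj j x) - \<eta> (proj i x)\<bar> \<le> 6/100 * \<eta> (proj i x)"
  shows "\<beta> j x \<le> 2 * \<beta> i x" "\<beta> i x \<le> 2 * \<beta> j x"
proof -
  note e = \<epsilon>_compare[OF i y]
  have p: "\<eta> (proj i x) > 0" "\<epsilon> (proj i x) > 0" using anchored_pos[OF i] \<epsilon>_pos by auto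
  have h': "\<eta> (proj j x) \<le> 106/100 * \<eta> (proj i x)" "\<eta> (proj i x) \<le> 100/94 * \<eta> (proj j x)" using h by linarith+
  have "\<beta> j x \<le> (5/4 * \<epsilon> (proj i x)) * (106/100 * \<eta> (proj i x))"
    by (rule mult_mono) (use e h' p \<epsilon>(3) \<eta>(3) in auto)
  also have "\<dots> \<le> 2 * \<beta> i x" using p by simp
  finally show "\<beta> j x \<le> 2 * \<beta> i x" .
  have "\<beta> i x \<le> (5/4 * \<epsilon> (proj j x)) * (100/94 * \<eta> (proj j x))"
    by (rule mult_mono) (use e h' p \<epsilon>(3) \<eta>(3) in auto)
  also have "\<dots> \<le> 2 * \<beta> j x" using \<epsilon>(3)[of "proj j x"] \<eta>(3)[of "proj j x"] by simp
  finally show "\<beta> i x \<le> 2 * \<beta> j x" .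
qed

lemma later_compare:
  assumes "anchored i x" "i \<le> k"
  shows "\<beta> k x \<le> 2 * \<beta> i x" "\<beta> i x \<le> 2 * \<beta> k x" "\<epsilon> (proj k x) \<le> 5/4 * \<epsilon> (proj i x)"
    "\<epsilon> (proj i x) \<le> 5/4 * \<epsilon> (proj k x)" "\<epsilon> x \<le> 5/4 * \<epsilon> (proj i x)" "\<epsilon> (proj i x) \<le> 5/4 * \<epsilon> x" "x \<in> U"
proof -
  note n = later_near[OF assms] anchored_pos[OF assms(1)]
  have k: "norm (proj k x - proj i x) \<le> 10 * \<eta> (proj i x)" using n by linarith
  have x: "norm (x - proj i x) \<le> 10 * \<eta> (proj i x)" using assms(1) n by (simp add: anchored_def)
  show "\<beta> k x \<le> 2 * \<beta> i x" "\<beta> i x \<le> 2 * \<beta> k x" using \<beta>_compare[OF assms(1) k] n by linarith+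
  show "\<epsilon> (proj k x) \<le> 5/4 * \<epsilon> (proj i x)" "\<epsilon> (proj i x) \<le> 5/4 * \<epsilon> (proj k x)" using \<epsilon>_compare[OF assms(1) k] by auto
  show "\<epsilon> x \<le> 5/4 * \<epsilon> (proj i x)" "\<epsilon> (proj i x) \<le> 5/4 * \<epsilon> x" "x \<in> U" using \<epsilon>_compare[OF assms(1) x] by auto
qed

lemma penalty_zero:
  assumes "gap j n x \<le> 3 * \<eta> (proj j x)" "\<eta> (proj j x) > 0"
  shows "cand l n j x = aff (proj j x) x $ l"
proof -
  have "(gap j n x)\<^sup>2 \<le> (3 * \<eta> (proj j x))\<^sup>2" using assms by (intro power_mono) auto
  then have "(gap j n x)\<^sup>2 / (\<eta> (proj j x))\<^sup>2 - 9 \<le> 0"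
    using assms(2) by (simp add: divide_le_eq power_mult_distrib)
  then show ?thesis by (simp add: cand_def sq_pos_def)
qed

text \<open>The tail of \<open>x\<close> beyond \<open>i\<close> dominates all later gaps and the
  scales differ by at most 1/40, so these gaps stay below 3 scales, where the penalty is off. Later
  candidates thus do not depend on \<open>n\<close>.\<close>

lemma later_window:
  assumes "anchored i x" "i \<le> j" "j \<le> n" "j \<le> k"
  shows "gap j n x \<le> 3 * \<eta> (proj j x)" "j \<in> window k n x" "cand l n j x = aff (proj j x) x $ l"
    "\<eta> (proj j x) > 0"
proof -
  note n = later_near[OF assms(1,2)] anchored_pos[OF assms(1)]
  have "gap j n x \<le> norm (x - proj j x)" by (rule norm_proj_diff_le_tail[OF assms(3)])
  then show g: "gap j n x \<le> 3 * \<eta> (proj j x)" using n by linarith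
  show p: "\<eta> (proj j x) > 0" using n by linarith
  show "j \<in> window k n x" using g p assms by (simp add: window_def)
  show "cand l n j x = aff (proj j x) x $ l" by (rule penalty_zero[OF g p])
qed

lemma cand_ge: "aff (proj j x) x $ l \<le> cand l n j x"
  using \<epsilon>(3)[of "proj j x"] \<eta>(3)[of "proj j x"] by (simp add: cand_def sq_pos_def)

lemma cand_mono:
  assumes "j \<le> n" "n \<le> m" shows "cand l n j x \<le> cand l m j x"
proof -
  have "(gap j n x)\<^sup>2 / (\<eta> (proj j x))\<^sup>2 - 9 \<le> (gap j m x)\<^sup>2 / (\<eta> (proj j x))\<^sup>2 - 9"
    by (intro diff_right_mono divide_right_mono power_mono norm_proj_diff_mono assms) auto
  then show ?thesis
    unfolding cand_def sq_pos_def
    by (intro add_left_mono mult_left_mono power_mono) (auto simp: \<epsilon>(3) \<eta>(3))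
qed

lemma window_cand_lower:
  assumes i: "anchored i x" and j: "j \<in> window i n x" and n: "i \<le> n"
  shows "aff (proj i x) x $ l - 18 * \<beta> i x \<le> aff (proj j x) x $ l" "\<beta> j x > 0" "\<beta> j x \<le> 2 * \<beta> i x"
    "\<beta> i x \<le> 2 * \<beta> j x"
proof -
  note w = window_near[OF j n] and p = anchored_pos[OF i]
  have "\<bar>aff (proj j x) x $ l - aff (proj i x) x $ l\<bar> \<le> 3 * \<epsilon> (proj i x) * norm (proj j x - proj i x)"
    by (rule aff_Lipschitz[OF i]) (use i w p in \<open>auto simp: anchored_def\<close>)
  also have "\<dots> \<le> 3 * \<epsilon> (proj i x) * (6 * \<eta> (proj i x))" using w \<epsilon>(3) by (intro mult_left_mono) auto
  finally show "aff (proj i x) x $ l - 18 * \<beta> i x \<le> aff (proj j x) x $ l" by linarith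
  show "\<beta> j x > 0" using window_pos[OF j] \<beta>_pos by blast
  show "\<beta> j x \<le> 2 * \<beta> i x" "\<beta> i x \<le> 2 * \<beta> j x" by (rule \<beta>_compare[OF i _ w(2)]; use w p in linarith)+
qed

text \<open>The 20 is the 18 of \<open>window_cand_lower\<close>, that is slope 3 over 6 scales,
  plus a smoothing width \<open>\<beta> j x\<close> of at most
  \<open>2 * \<beta> i x\<close>.\<close>

lemma filt_bounds:
  assumes i: "anchored i x" and n: "i \<le> n"
  shows "filt i n l x \<le> aff (proj i x) x $ l" "aff (proj i x) x $ l - 20 * \<beta> i x \<le> filt i n l x"
proof -
  note iw = later_window[OF i order_refl n order_refl]
  have pos: "\<And>j. j \<in> window i n x \<Longrightarrow> \<beta> j x > 0" using window_cand_lower(2)[OF i _ n] .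
  show "filt i n l x \<le> aff (proj i x) x $ l"
    unfolding filt_def using softmin_le[OF finite_window iw(2), where v="\<lambda>j. cand l n j x" and k="\<lambda>j. \<beta> j x"] pos iw(3) by simp
  show "aff (proj i x) x $ l - 20 * \<beta> i x \<le> filt i n l x"
    unfolding filt_def
  proof (rule softmin_ge[OF finite_window iw(2)])
    fix j assume j: "j \<in> window i n x"
    show "0 < \<beta> j x \<and> aff (proj i x) x $ l - 20 * \<beta> i x \<le> cand l n j x - \<beta> j x"
      using window_cand_lower(1)[OF i j n, of l] window_cand_lower(2-4)[OF i j n] cand_ge[of j x l n] by linarith
  qed
qed

text \<open>The candidates in \<open>{i<..n}\<close> are penalty-free and identical at resolutions
  \<open>n\<close> and \<open>Suc n\<close>, while those up to \<open>i\<close> rise and may leave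
  the window. This is the situation of \<open>softmin_supermodular\<close> with
  \<open>K = {i<..n}\<close>.\<close>

lemma filt_increments:
  assumes i: "anchored i x" and n: "i \<le> n"
  shows "filt n (Suc n) l x - filt n n l x \<le> filt i (Suc n) l x - filt i n l x"
    "filt i n l x \<le> filt i (Suc n) l x"
proof -
  let ?J = "window i n x" and ?J' = "window i (Suc n) x" and ?K = "{i<..n}"
  have later: "j \<in> window n m x \<and> cand l m j x = aff (proj j x) x $ l \<and> \<beta> j x > 0"
    if "j \<in> ?K" "m = n \<or> m = Suc n" for j m
    using later_window[OF i, of j m n] that \<beta>_pos \<eta>(4) by auto
  have "j \<in> ?J" if "j \<in> ?J'" for j
    using that norm_proj_diff_mono[of j n "Suc n" x] n by (auto simp: window_def)
  then have sub: "?J' \<subseteq> ?J" by blast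
  have W: "window n m x = window i m x \<union> ?K" if "m = n \<or> m = Suc n" for m
    using later[OF _ that] n by (auto simp: window_def not_le)
  have iw: "i \<in> ?J'" using later_window[OF i order_refl, of "Suc n" i] n by simp
  have pos: "\<And>j. j \<in> ?J \<union> ?K \<Longrightarrow> \<beta> j x > 0" using window_cand_lower(2)[OF i _ n] later by blast
  have dis: "?J \<inter> ?K = {}" by (auto simp: window_def)
  have v: "\<And>j. j \<in> ?J' \<Longrightarrow> cand l n j x \<le> cand l (Suc n) j x" "\<And>j. j \<in> ?K \<Longrightarrow> cand l n j x = cand l (Suc n) j x"
    using cand_mono[of _ n "Suc n" l x] later n by (auto simp: window_def)
  note sm = softmin_supermodular[OF finite_window sub iw _ dis pos v]
  show "filt n (Suc n) l x - filt n n l x \<le> filt i (Suc n) l x - filt i n l x"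
    unfolding filt_def using sm(1) W by simp
  show "filt i n l x \<le> filt i (Suc n) l x" unfolding filt_def using sm(2) by simp
qed

text \<open>A potential for the steps \<open>filt n n \<mapsto> filt (Suc n) (Suc n)\<close>: it bounds their size and, by
  supermodularity of the smooth minimum, adds up along \<open>n\<close> to something bounded by \<open>\<beta>\<close>.\<close>

definition osc :: "nat \<Rightarrow> nat \<Rightarrow> 'a \<Rightarrow> real" where
  "osc i n x = (\<Sum>l\<in>UNIV. 2 * filt i n l x - filt n n l x - filt i i l x)"

lemma filt_new_le:
  assumes n: "anchored n x" shows "filt (Suc n) (Suc n) l x \<le> filt n (Suc n) l x"
  unfolding filt_def
proof (rule softmin_superset[OF finite_window])
  show "window n (Suc n) x \<subseteq> window (Suc n) (Suc n) x" by (auto simp: window_def)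
  show "n \<in> window n (Suc n) x" using later_window[OF n, of n "Suc n" n] by simp
qed (use window_pos \<beta>_pos in blast)

text \<open>The right-hand side is the rise from \<open>filt n n\<close> to
  \<open>filt n (Suc n)\<close> plus the fall from there to \<open>filt (Suc n) (Suc n)\<close>,
  both nonnegative.\<close>

lemma osc_step_terms:
  assumes "anchored n x"
  shows "\<bar>filt (Suc n) (Suc n) l x - filt n n l x\<bar>
    \<le> 2 * filt n (Suc n) l x - filt (Suc n) (Suc n) l x - filt n n l x"
  using filt_new_le[OF assms, of l] filt_increments(2)[OF assms order_refl, of l] by linarith

lemma osc_step: assumes "anchored n x"
  shows "\<bar>filt (Suc n) (Suc n) l x - filt n n l x\<bar> \<le> osc n (Suc n) x" "0 \<le> osc n (Suc n) x"
proof -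
  have "0 \<le> 2 * filt n (Suc n) k x - filt (Suc n) (Suc n) k x - filt n n k x" for k
    using osc_step_terms[OF assms, of k] by linarith
  then have "2 * filt n (Suc n) l x - filt (Suc n) (Suc n) l x - filt n n l x \<le> osc n (Suc n) x"
    "0 \<le> osc n (Suc n) x"
    unfolding osc_def
    by (auto intro!: sum_nonneg member_le_sum[of l UNIV "\<lambda>l. 2 * filt n (Suc n) l x - filt (Suc n) (Suc n) l x - filt n n l x"])
  then show "\<bar>filt (Suc n) (Suc n) l x - filt n n l x\<bar> \<le> osc n (Suc n) x" "0 \<le> osc n (Suc n) x"
    using osc_step_terms[OF assms, of l] by linarith+
qed

lemma osc_superadditive:
  assumes "anchored i x" "i \<le> n"
  shows "osc i n x + osc n (Suc n) x \<le> osc i (Suc n) x"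
proof -
  have "(2 * filt i n l x - filt n n l x - filt i i l x) + (2 * filt n (Suc n) l x - filt (Suc n) (Suc n) l x - filt n n l x)
    \<le> 2 * filt i (Suc n) l x - filt (Suc n) (Suc n) l x - filt i i l x" for l
    using filt_increments(1)[OF assms, of l] by linarith
  then show ?thesis unfolding osc_def sum.distrib[symmetric] by (intro sum_mono)
qed

lemma osc_self [simp]: "osc i i x = 0"
  by (simp add: osc_def)

lemma osc_le:
  assumes i: "anchored i x" and n: "anchored n x" "i \<le> n"
  shows "osc i n x \<le> 70 * real CARD('d) * \<beta> i x"
proof -
  \<comment> \<open>The filters deviate from their anchors by 40 (that is
    \<open>20 * \<beta> n x\<close>, and \<open>\<beta>\<close> may double) and 20, the anchors from
    each other by 15/2, in units of \<open>\<beta> i x\<close>.\<close>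
  have "2 * filt i n l x - filt n n l x - filt i i l x \<le> 70 * \<beta> i x" for l
  proof -
    note near = later_near[OF i n(2)] and p = anchored_pos[OF i]
    have "\<bar>aff (proj n x) x $ l - aff (proj i x) x $ l\<bar> \<le> 3 * \<epsilon> (proj i x) * norm (proj n x - proj i x)"
      by (rule aff_Lipschitz[OF i]) (use i near p in \<open>auto simp: anchored_def\<close>)
    also have "\<dots> \<le> 3 * \<epsilon> (proj i x) * (5/2 * \<eta> (proj i x))"
      using near(1) \<epsilon>(3) by (intro mult_left_mono) auto
    finally have h: "aff (proj i x) x $ l - aff (proj n x) x $ l \<le> 15/2 * \<beta> i x" by linarith
    have "\<beta> i x > 0" using \<beta>_pos p by blast
    then show ?thesis
      using h filt_bounds[OF i n(2), of l] filt_bounds[OF i order_refl, of l] filt_bounds[OF n(1) order_refl, of l]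
        later_compare(1)[OF i n(2)] by linarith
  qed
  then have "osc i n x \<le> (\<Sum>l\<in>(UNIV::'d set). 70 * \<beta> i x)" unfolding osc_def by (intro sum_mono)
  then show ?thesis by simp
qed

end

lemma calm_vec_nth: "calm F x K \<Longrightarrow> calm (\<lambda>y. F y $ l) x K"
  for F :: "'a::real_normed_vector \<Rightarrow> real ^ 'd"
  unfolding calm_def
proof (intro allI impI)
  fix k assume a: "\<forall>k>K. \<forall>\<^sub>F y in nhds x. norm (F y - F x) \<le> k * norm (y - x)" "K < k"
  then have "\<forall>\<^sub>F y in nhds x. norm (F y - F x) \<le> k * norm (y - x)" by blast
  then show "\<forall>\<^sub>F y in nhds x. norm (F y $ l - F x $ l) \<le> k * norm (y - x)"
  proof eventually_elim
    case (elim y)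
    then show ?case using component_le_norm_cart[of "F y - F x" l] by simp
  qed
qed

lemma calm_sq_pos: "calm sq_pos u (2 * max 0 u)"
  by (rule calm_of_derivative[OF sq_pos_derivative[unfolded has_field_derivative_def]]) (simp add: abs_mult)

context filter_data
begin

section \<open>Local form, smoothness and derivative bounds of the filter\<close>

lemma proj_tendsto_nhds: "(proj j \<longlongrightarrow> proj j x) (nhds x)"
  by (rule C1_at_tendsto[OF C1_at_linear[OF bounded_linear_proj]])

lemma \<eta>_proj_tendsto: "((\<lambda>y. \<eta> (proj j y)) \<longlongrightarrow> \<eta> (proj j x)) (nhds x)"
  by (rule C1_at_tendsto[OF C1_at_proj[OF \<eta>(1)]])

lemma gap_tendsto: "((\<lambda>y. gap j n y) \<longlongrightarrow> gap j n x) (nhds x)"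
  by (intro tendsto_intros proj_tendsto_nhds)

lemma eventually_anchored:
  assumes "anchored i x" shows "\<forall>\<^sub>F y in nhds x. anchored i y"
proof -
  have "((\<lambda>y. 5/2 * \<eta> (proj i y) - norm (y - proj i y)) \<longlongrightarrow> 5/2 * \<eta> (proj i x) - norm (x - proj i x)) (nhds x)"
    by (intro tendsto_intros proj_tendsto_nhds \<eta>_proj_tendsto filterlim_ident)
  then have "\<forall>\<^sub>F y in nhds x. 0 < 5/2 * \<eta> (proj i y) - norm (y - proj i y)"
    by (rule order_tendstoD) (use assms in \<open>simp add: anchored_def\<close>)
  then show ?thesis by eventually_elim (simp add: anchored_def)
qed

text \<open>A locally constant substitute for the window. Its threshold lies between 4, beyond which
  a candidate no longer counts, and 5, where the window ends; so nearby points keep all of the core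
  and see nothing else.\<close>

definition core :: "nat \<Rightarrow> nat \<Rightarrow> 'a \<Rightarrow> nat set" where
  "core i n x = {j. j \<le> i \<and> gap j n x < 9/2 * \<eta> (proj j x)}"

lemma core:
  assumes "anchored i x" "i \<le> n"
  shows "core i n x \<subseteq> window i n x" "i \<in> core i n x" "finite (core i n x)"
proof -
  have "gap i n x < 5/2 * \<eta> (proj i x)" using later_near[OF assms] by simp
  then show "i \<in> core i n x" using anchored_pos[OF assms(1)] by (simp add: core_def)
  show "core i n x \<subseteq> window i n x"
  proof
    fix j assume "j \<in> core i n x"
    then have "j \<le> i" "gap j n x < 9/2 * \<eta> (proj j x)" by (auto simp: core_def)
    moreover then have "gap j n x < 5 * \<eta> (proj j x)" using \<eta>(3)[of "proj j x"] by linarith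
    ultimately show "j \<in> window i n x" by (simp add: window_def)
  qed
  then show "finite (core i n x)" using finite_subset finite_window by blast
qed

lemma eventually_core:
  assumes i: "anchored i x" and n: "i \<le> n"
  shows "\<forall>\<^sub>F y in nhds x. anchored i y \<and> core i n x \<subseteq> window i n y \<and>
    (\<forall>j\<in>window i n y - core i n x. 4 * \<eta> (proj j y) < gap j n y)"
proof -
  have "\<forall>\<^sub>F y in nhds x. \<forall>j\<in>{..i}. (j \<in> core i n x \<longrightarrow> gap j n y < 5 * \<eta> (proj j y)) \<and>
      (j \<notin> core i n x \<longrightarrow> 4 * \<eta> (proj j y) < gap j n y)"
  proof (intro eventually_ball_finite ballI)
    fix j assume j: "j \<in> {..i}"
    have lim: "((\<lambda>y. gap j n y - c * \<eta> (proj j y)) \<longlongrightarrow> gap j n x - c * \<eta> (proj j x)) (nhds x)" for c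
      by (intro tendsto_intros gap_tendsto \<eta>_proj_tendsto)
    show "\<forall>\<^sub>F y in nhds x. (j \<in> core i n x \<longrightarrow> gap j n y < 5 * \<eta> (proj j y)) \<and>
      (j \<notin> core i n x \<longrightarrow> 4 * \<eta> (proj j y) < gap j n y)"
    proof (cases "j \<in> core i n x")
      case True
      then have "gap j n x < 5 * \<eta> (proj j x)" using core(1)[OF i n] by (auto simp: window_def)
      then have "\<forall>\<^sub>F y in nhds x. gap j n y - 5 * \<eta> (proj j y) < 0"
        by (intro order_tendstoD(2)[OF lim]) simp
      then show ?thesis by eventually_elim (use True in simp)
    next
      case False
      then have g: "9/2 * \<eta> (proj j x) \<le> gap j n x" using j by (auto simp: core_def)
      have "0 < gap j n x - 4 * \<eta> (proj j x)"
      proof (cases "\<eta> (proj j x) > 0")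
        case True
        then show ?thesis using g by linarith
      next
        case 0: False
        \<comment> \<open>At a vanishing scale the threshold says nothing, so positivity of the gap
          is needed. Were the gap zero, \<open>proj i x\<close> and \<open>proj j x\<close> would
          coincide, but the anchor has positive scale.\<close>
        have "proj n x \<noteq> proj j x"
        proof
          assume "proj n x = proj j x"
          then have "proj i (proj n x) = proj i (proj j x)" by simp
          then have "proj i x = proj j x" using n j by (simp add: proj_proj min_absorb1 min_absorb2)
          then show False using 0 anchored_pos[OF i] by simp
        qed
        then have "0 < gap j n x" by simp
        then show ?thesis using 0 \<eta>(3)[of "proj j x"] by linarith
      qed
      then have "\<forall>\<^sub>F y in nhds x. 0 < gap j n y - 4 * \<eta> (proj j y)" by (rule order_tendstoD(1)[OF lim])
      then show ?thesis by eventually_elim (use False in simp)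
    qed
  qed simp
  with eventually_anchored[OF i] show ?thesis
    by eventually_elim (auto simp: window_def core_def)
qed

text \<open>Beyond 4 scales the penalty is at least \<open>(16 - 9)\<^sup>2 = 49\<close> times
  \<open>\<beta> j x\<close>. The affine parts can make up for at most
  \<open>18 * \<beta> i x\<close>, hence 36 of these, and the width for one more, so
  \<open>softmin_drop\<close> applies.\<close>

lemma filt_eq_core:
  assumes y: "anchored i y" and n: "i \<le> n" and J: "J \<subseteq> window i n y" "i \<in> J"
    and far: "\<And>j. j \<in> window i n y - J \<Longrightarrow> 4 * \<eta> (proj j y) < gap j n y"
  shows "filt i n l y = softmin J (\<lambda>j. cand l n j y) (\<lambda>j. \<beta> j y)"
  unfolding filt_def
proof (rule softmin_drop[OF finite_window J])
  show "0 < \<beta> j y" if "j \<in> window i n y" for j by (rule window_cand_lower(2)[OF y that n])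
  fix j assume j: "j \<in> window i n y - J"
  then have jw: "j \<in> window i n y" by blast
  have p: "\<eta> (proj j y) > 0" using window_pos[OF jw] by blast
  have "(4 * \<eta> (proj j y))\<^sup>2 \<le> (gap j n y)\<^sup>2" using far[OF j] p by (intro power_mono) auto
  then have "16 \<le> (gap j n y)\<^sup>2 / (\<eta> (proj j y))\<^sup>2" using p by (simp add: le_divide_eq power_mult_distrib)
  then have "7\<^sup>2 \<le> (max 0 ((gap j n y)\<^sup>2 / (\<eta> (proj j y))\<^sup>2 - 9))\<^sup>2" by (intro power_mono) auto
  then have "\<beta> j y * 49 \<le> \<beta> j y * sq_pos ((gap j n y)\<^sup>2 / (\<eta> (proj j y))\<^sup>2 - 9)"
    using window_cand_lower(2)[OF y jw n] unfolding sq_pos_def by (intro mult_left_mono) auto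
  then have "aff (proj j y) y $ l + 49 * \<beta> j y \<le> cand l n j y" by (simp add: cand_def)
  moreover have "cand l n i y = aff (proj i y) y $ l" by (rule later_window(3)[OF y order_refl n order_refl])
  ultimately show "cand l n i y \<le> cand l n j y - \<beta> j y"
    using window_cand_lower(1)[OF y jw n, of l] window_cand_lower(2-4)[OF y jw n] by linarith
qed

lemma eventually_filt_eq:
  assumes "anchored i x" "i \<le> n"
  shows "\<forall>\<^sub>F y in nhds x. filt i n l y = softmin (core i n x) (\<lambda>j. cand l n j y) (\<lambda>j. \<beta> j y)"
  using eventually_core[OF assms]
  by eventually_elim (rule filt_eq_core, use core[OF assms] assms in auto)

lemma C1_at_aff:
  assumes "proj j x \<in> U" shows "C1_at (\<lambda>y. aff (proj j y) y) x"
  by (intro C1_at_add C1_at_blinfun_apply C1_at_proj C1_at_f L assms C1_at_diff C1_at_id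
      C1_at_linear[OF bounded_linear_proj])

lemma C1_at_gap_sq: "C1_at (\<lambda>y. (gap j n y)\<^sup>2) x"
  by (intro C1_at_norm_power2 C1_at_diff C1_at_linear[OF bounded_linear_proj])

lemma C1_at_\<beta>: "C1_at (\<beta> j) x"
  by (intro C1_at_mult C1_at_proj \<epsilon> \<eta>)

lemma C1_at_\<eta>_sq: "C1_at (\<lambda>y. (\<eta> (proj j y))\<^sup>2) x"
  unfolding power2_eq_square by (intro C1_at_mult C1_at_proj \<eta>)

lemma C1_at_cand:
  assumes "proj j x \<in> U" shows "C1_at (\<lambda>y. cand l n j y) x"
  unfolding cand_def
  by (intro C1_at_add C1_at_vec_nth C1_at_aff assms C1_at_mult C1_at_\<beta> C1_at_sq_pos C1_at_diff
      C1_at_divide C1_at_gap_sq C1_at_\<eta>_sq C1_at_const) (use \<eta>(4)[of "proj j x"] assms in auto)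

lemma C1_at_filt:
  assumes "anchored i x" "i \<le> n" shows "C1_at (\<lambda>y. filt i n l y) x"
proof (rule C1_at_cong)
  show "C1_at (\<lambda>y. softmin (core i n x) (\<lambda>j. cand l n j y) (\<lambda>j. \<beta> j y)) x"
  proof (rule C1_at_softmin[OF core(3,2)[OF assms]])
    fix j assume "j \<in> core i n x"
    then have j: "proj j x \<in> U" using core(1)[OF assms] window_pos by blast
    show "C1_at (\<lambda>y. cand l n j y) x" by (rule C1_at_cand[OF j])
    show "C1_at (\<lambda>y. \<beta> j y) x" by (rule C1_at_\<beta>)
    show "\<beta> j x > 0" by (rule \<beta>_pos[OF j])
  qed
  show "\<forall>\<^sub>F y in nhds x. softmin (core i n x) (\<lambda>j. cand l n j y) (\<lambda>j. \<beta> j y) = filt i n l y"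
    using eventually_filt_eq[OF assms, of l] by eventually_elim simp
qed

lemma proj_Lipschitz: "norm (proj j y - proj j x) \<le> norm (y - x)"
  using norm_proj_le[of j "y - x"] by (simp add: proj_diff)

lemma calm_\<epsilon>: "calm (\<lambda>y. \<epsilon> (proj j y)) x (1/100)"
proof (rule calm_Lipschitz)
  fix y show "norm (\<epsilon> (proj j y) - \<epsilon> (proj j x)) \<le> 1/100 * norm (y - x)"
    using \<epsilon>(2)[of "proj j y" "proj j x"] proj_Lipschitz[of j y x] by simp
qed

lemma calm_\<eta>: "calm (\<lambda>y. \<eta> (proj j y)) x (1/100)"
proof (rule calm_Lipschitz)
  fix y show "norm (\<eta> (proj j y) - \<eta> (proj j x)) \<le> 1/100 * norm (y - x)"
    using \<eta>(2)[of "proj j y" "proj j x"] proj_Lipschitz[of j y x] by simp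
qed

lemma calm_\<beta>: "calm (\<beta> j) x ((\<epsilon> (proj j x) + \<eta> (proj j x)) / 100)"
  by (rule calm_mono[OF calm_mult[OF C1_at_proj[OF \<epsilon>(1)] calm_\<epsilon> C1_at_proj[OF \<eta>(1)] calm_\<eta>]])
    (simp add: \<epsilon>(3) \<eta>(3) add_divide_distrib)

lemma calm_\<eta>_sq: "calm (\<lambda>y. (\<eta> (proj j y))\<^sup>2) x (\<eta> (proj j x) / 50)"
  unfolding power2_eq_square
  by (rule calm_mono[OF calm_mult[OF C1_at_proj[OF \<eta>(1)] calm_\<eta> C1_at_proj[OF \<eta>(1)] calm_\<eta>]])
    (simp add: \<eta>(3))

lemma calm_gap_sq: "j \<le> n \<Longrightarrow> calm (\<lambda>y. (gap j n y)\<^sup>2) x (2 * gap j n x)"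
proof -
  assume j: "j \<le> n"
  have "calm (\<lambda>y. proj n y - proj j y) x 1"
  proof (rule calm_Lipschitz)
    fix y
    have "norm (proj n (y - x) - proj j (y - x)) \<le> norm (y - x)"
      using norm_proj_diff_le_tail[OF j, of "y - x"] norm_tail_le[of "y - x" j] by linarith
    then show "norm (proj n y - proj j y - (proj n x - proj j x)) \<le> 1 * norm (y - x)"
      by (simp add: proj_diff algebra_simps)
  qed
  from calm_compose[OF this _ calm_norm_sq] show ?thesis by simp
qed

lemma calm_tail_sq: "calm (\<lambda>y. (norm (y - proj j y))\<^sup>2) x (2 * norm (x - proj j x))"
proof -
  have "calm (\<lambda>y. y - proj j y) x 1"
  proof (rule calm_Lipschitz)
    fix y show "norm (y - proj j y - (x - proj j x)) \<le> 1 * norm (y - x)"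
      using norm_tail_le[of "y - x" j] by (simp add: proj_diff algebra_simps)
  qed
  from calm_compose[OF this _ calm_norm_sq] show ?thesis by simp
qed

lemma ratio_estimate:
  fixes g h c :: real
  assumes "0 \<le> g" "g \<le> c * h" "0 < h"
  shows "2 * g / h\<^sup>2 + \<bar>g\<^sup>2\<bar> * (h / 50) / (h\<^sup>2)\<^sup>2 \<le> (2 * c + c\<^sup>2 / 50) / h"
proof -
  define r where "r = g / h"
  have r: "0 \<le> r" "r \<le> c" "g = r * h" using assms by (auto simp: r_def divide_le_eq)
  have "2 * g / h\<^sup>2 + \<bar>g\<^sup>2\<bar> * (h / 50) / (h\<^sup>2)\<^sup>2 = (2 * r + r\<^sup>2 / 50) / h"
    using assms(3) unfolding r(3) by (simp add: field_simps power2_eq_square)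
  also have "\<dots> \<le> (2 * c + c\<^sup>2 / 50) / h"
    using r assms(3) by (intro divide_right_mono add_mono mult_left_mono power_mono) auto
  finally show ?thesis .
qed

text \<open>The derivative differs from \<open>f' x\<close> by \<open>2 * a\<close> on the projected
  part, by \<open>(5/4 + 2) * a\<close> on the tail where \<open>L\<close> replaces
  \<open>f'\<close>, and by \<open>a\<close> through the derivative of \<open>L\<close>.\<close>

lemma calm_aff:
  assumes i: "anchored i x" and near: "norm (proj j x - proj i x) \<le> 10 * \<eta> (proj i x)"
  shows "calm (\<lambda>y. aff (proj j y) y - f' x y) x (7 * \<epsilon> (proj i x))"
proof -
  obtain a where a: "a > 0" and reg: "\<And>y. norm (y - proj i x) \<le> 10 * \<eta> (proj i x) \<Longrightarrow> y \<in> U \<and> a \<le> \<epsilon> y \<and> \<epsilon> y \<le> 5/4 * a \<and>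
      norm (f' y - f' (proj i x)) \<le> a \<and> norm (L y - f' y) \<le> 5/4 * a \<and>
      (\<exists>K. calm L y K \<and> K * (20 * \<eta> (proj i x)) \<le> a)"
    using anchored_region[OF i] by metis
  let ?z = "proj j x"
  note p = anchored_pos[OF i]
  have x10: "norm (x - proj i x) \<le> 10 * \<eta> (proj i x)" using i p by (simp add: anchored_def)
  note rz = reg[OF near] and rx = reg[OF x10]
  obtain D where D: "(L has_derivative blinfun_apply D) (at ?z)" using C1_at_derivative[OF L] rz by blast
  obtain K where K: "calm L ?z K" "K * (20 * \<eta> (proj i x)) \<le> a" using rz by blast
  have xz: "norm (x - ?z) \<le> 20 * \<eta> (proj i x)"
    using norm_triangle_ineq4[of "x - proj i x" "?z - proj i x"] x10 near by simp
  have P: "(proj j has_derivative proj j) (at x)"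
    by (rule bounded_linear_imp_has_derivative[OF bounded_linear_proj])
  have LP: "((\<lambda>y. L (proj j y)) has_derivative (\<lambda>h. D (proj j h))) (at x)"
    by (rule has_derivative_compose[OF P D])
  have fP: "((\<lambda>y. f (proj j y)) has_derivative (\<lambda>h. f' ?z (proj j h))) (at x)"
    by (rule has_derivative_compose[OF P f(1)]) (use rz in blast)
  have der: "((\<lambda>y. aff (proj j y) y - f' x y) has_derivative
     (\<lambda>h. f' ?z (proj j h) + (L ?z (h - proj j h) + D (proj j h) (x - ?z)) - f' x h)) (at x)"
    by (intro has_derivative_diff has_derivative_add fP blinfun.FDERIV[OF LP] has_derivative_ident P
      bounded_linear_imp_has_derivative[OF blinfun.bounded_linear_right])
  have fz: "norm (f' ?z - f' x) \<le> 2 * a"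
    using rz rx norm_triangle_ineq4[of "f' ?z - f' (proj i x)" "f' x - f' (proj i x)"] by simp
  have Lz: "norm (L ?z - f' x) \<le> 13/4 * a"
    using rz fz norm_triangle_ineq[of "L ?z - f' ?z" "f' ?z - f' x"] by simp
  show ?thesis
  proof (rule calm_of_derivative[OF der])
    fix h
    have "f' ?z (proj j h) + (L ?z (h - proj j h) + D (proj j h) (x - ?z)) - f' x h
      = (f' ?z - f' x) (proj j h) + (L ?z - f' x) (h - proj j h) + D (proj j h) (x - ?z)"
      by (simp add: blinfun.diff_left blinfun.diff_right algebra_simps)
    also have "norm \<dots> \<le> 2 * a * norm h + 13/4 * a * norm h + a * norm h"
    proof (intro order_trans[OF norm_triangle_ineq] add_mono)
      have "norm ((f' ?z - f' x) (proj j h)) \<le> norm (f' ?z - f' x) * norm (proj j h)" by (rule norm_blinfun)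
      also have "\<dots> \<le> 2 * a * norm h" using fz a norm_proj_le[of j h] by (intro mult_mono) auto
      finally show "norm ((f' ?z - f' x) (proj j h)) \<le> 2 * a * norm h" .
      have "norm ((L ?z - f' x) (h - proj j h)) \<le> norm (L ?z - f' x) * norm (h - proj j h)" by (rule norm_blinfun)
      also have "\<dots> \<le> 13/4 * a * norm h" using Lz a norm_tail_le[of h j] by (intro mult_mono) auto
      finally show "norm ((L ?z - f' x) (h - proj j h)) \<le> 13/4 * a * norm h" .
      have Dh: "norm (D (proj j h)) \<le> K * norm (proj j h)" by (rule calm_derivative[OF D K(1)])
      have "norm (D (proj j h) (x - ?z)) \<le> norm (D (proj j h)) * norm (x - ?z)" by (rule norm_blinfun)
      also have "\<dots> \<le> (K * norm (proj j h)) * (20 * \<eta> (proj i x))"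
        using Dh xz by (intro mult_mono order_trans[OF norm_ge_zero Dh]) auto
      also have "\<dots> = (K * (20 * \<eta> (proj i x))) * norm (proj j h)" by simp
      also have "\<dots> \<le> a * norm h" using K(2) norm_proj_le[of j h] a by (intro mult_mono) auto
      finally show "norm (D (proj j h) (x - ?z)) \<le> a * norm h" .
    qed
    also have "\<dots> \<le> 7 * a * norm h" using a mult_nonneg_nonneg[of a "norm h"] by (simp add: algebra_simps)
    also have "\<dots> \<le> 7 * \<epsilon> (proj i x) * norm h"
      using reg[of "proj i x"] p by (intro mult_right_mono mult_left_mono) auto
    finally show "norm (f' ?z (proj j h) + (L ?z (h - proj j h) + D (proj j h) (x - ?z)) - f' x h)
      \<le> 7 * \<epsilon> (proj i x) * norm h" .
  qed
qed

lemma \<eta>_le_\<epsilon>: assumes "anchored i x" shows "\<eta> (proj i x) \<le> \<epsilon> (proj i x)"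
proof (rule anchored_region[OF assms])
  fix a assume a: "\<eta> (proj i x) \<le> a" and reg: "\<And>y. norm (y - proj i x) \<le> 10 * \<eta> (proj i x) \<Longrightarrow> y \<in> U \<and> a \<le> \<epsilon> y \<and> \<epsilon> y \<le> 5/4 * a \<and>
      norm (f' y - f' (proj i x)) \<le> a \<and> norm (L y - f' y) \<le> 5/4 * a \<and>
      (\<exists>K. calm L y K \<and> K * (20 * \<eta> (proj i x)) \<le> a)"
  have "a \<le> \<epsilon> (proj i x)" using reg[of "proj i x"] \<eta>(3)[of "proj i x"] by simp
  with a show ?thesis by simp
qed

lemma calm_\<beta>_near:
  assumes i: "anchored i x" and near: "norm (proj j x - proj i x) \<le> 10 * \<eta> (proj i x)"
    "\<bar>\<eta> (proj j x) - \<eta> (proj i x)\<bar> \<le> 6/100 * \<eta> (proj i x)"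
  shows "calm (\<beta> j) x (1/40 * \<epsilon> (proj i x))"
proof (rule calm_mono[OF calm_\<beta>])
  have "\<eta> (proj j x) \<le> 106/100 * \<eta> (proj i x)" using near(2) by linarith
  then have "\<eta> (proj j x) \<le> 106/100 * \<epsilon> (proj i x)" using \<eta>_le_\<epsilon>[OF i] by linarith
  with \<epsilon>_compare(1)[OF i near(1)] \<epsilon>(3)[of "proj i x"]
  show "(\<epsilon> (proj j x) + \<eta> (proj j x)) / 100 \<le> 1/40 * \<epsilon> (proj i x)" by simp
qed

text \<open>On the core the squared relative gap has slope at most \<open>10 / \<eta>\<close> and
  exceeds 9 by at most 45/4. Squaring gives slope \<open>225 / \<eta>\<close> for the penalty, the
  factor \<open>\<beta>\<close> cancels \<open>\<eta>\<close>, and the variation of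
  \<open>\<beta>\<close> itself adds little.\<close>

lemma calm_cand:
  assumes i: "anchored i x" and n: "i \<le> n" and j: "j \<in> core i n x"
  shows "calm (\<lambda>y. cand l n j y - f' x y $ l) x (292 * \<epsilon> (proj i x))"
proof -
  let ?h = "\<eta> (proj j x)" and ?e = "\<epsilon> (proj i x)"
  have jw: "j \<in> window i n x" using core(1)[OF i n] j by blast
  have jn: "j \<le> n" using jw n by (auto simp: window_def)
  note w = window_near[OF jw n] and p = anchored_pos[OF i]
  have h: "?h > 0" "proj j x \<in> U" using window_pos[OF jw] by auto
  have near: "norm (proj j x - proj i x) \<le> 10 * \<eta> (proj i x)" using w p by linarith
  have g: "gap j n x \<le> 9/2 * ?h" using j by (simp add: core_def)
  have nz: "0 < ?h\<^sup>2" using h by simp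
  have "calm (\<lambda>y. (gap j n y)\<^sup>2 / (\<eta> (proj j y))\<^sup>2) x
      (2 * gap j n x / ?h\<^sup>2 + \<bar>(gap j n x)\<^sup>2\<bar> * (?h / 50) / (?h\<^sup>2)\<^sup>2)"
    by (rule calm_divide[OF C1_at_gap_sq calm_gap_sq[OF jn] C1_at_\<eta>_sq calm_\<eta>_sq nz])
  then have "calm (\<lambda>y. (gap j n y)\<^sup>2 / (\<eta> (proj j y))\<^sup>2) x (10 / ?h)"
  proof (rule calm_mono)
    have "2 * gap j n x / ?h\<^sup>2 + \<bar>(gap j n x)\<^sup>2\<bar> * (?h / 50) / (?h\<^sup>2)\<^sup>2 \<le> (2 * (9/2) + (9/2)\<^sup>2 / 50) / ?h"
      by (rule ratio_estimate) (use g h in auto)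
    also have "\<dots> \<le> 10 / ?h" using h by (intro divide_right_mono) (auto simp: power2_eq_square)
    finally show "2 * gap j n x / ?h\<^sup>2 + \<bar>(gap j n x)\<^sup>2\<bar> * (?h / 50) / (?h\<^sup>2)\<^sup>2 \<le> 10 / ?h" .
  qed
  from calm_diff[OF this calm_const[of 0 9]]
  have c1: "calm (\<lambda>y. (gap j n y)\<^sup>2 / (\<eta> (proj j y))\<^sup>2 - 9) x (10 / ?h)" by simp
  let ?u = "(gap j n x)\<^sup>2 / ?h\<^sup>2 - 9"
  have "(gap j n x)\<^sup>2 \<le> (9/2 * ?h)\<^sup>2" using g by (intro power_mono) auto
  then have "(gap j n x)\<^sup>2 \<le> 81/4 * ?h\<^sup>2" by (simp add: power_mult_distrib power2_eq_square)
  then have u: "?u \<le> 45/4" using nz by (simp add: divide_le_eq)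
  have m: "max 0 ?u \<le> 45/4" by (rule max.boundedI[OF _ u]) simp
  have "calm sq_pos ?u (45/2)" by (rule calm_mono[OF calm_sq_pos]) (use mult_left_mono[OF m, of 2] in simp)
  from calm_compose[OF c1 _ this]
  have c2: "calm (\<lambda>y. sq_pos ((gap j n y)\<^sup>2 / (\<eta> (proj j y))\<^sup>2 - 9)) x (225 / ?h)" using h by simp
  have C2: "C1_at (\<lambda>y. sq_pos ((gap j n y)\<^sup>2 / (\<eta> (proj j y))\<^sup>2 - 9)) x"
    by (intro C1_at_sq_pos C1_at_diff C1_at_divide C1_at_gap_sq C1_at_\<eta>_sq C1_at_const) (use nz in simp)
  have s: "0 \<le> sq_pos ?u" "sq_pos ?u \<le> 127"
  proof -
    show "0 \<le> sq_pos ?u" by (simp add: sq_pos_def)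
    have "(max 0 ?u)\<^sup>2 \<le> (45/4)\<^sup>2" using m by (intro power_mono) auto
    then show "sq_pos ?u \<le> 127" by (simp add: sq_pos_def power2_eq_square)
  qed
  have cb: "calm (\<beta> j) x (1/40 * ?e)" by (rule calm_\<beta>_near[OF i near w(2)])
  have e: "?e > 0" using \<epsilon>_pos p by blast
  have "calm (\<lambda>y. \<beta> j y * sq_pos ((gap j n y)\<^sup>2 / (\<eta> (proj j y))\<^sup>2 - 9)) x (285 * ?e)"
  proof (rule calm_mono[OF calm_mult[OF C1_at_\<beta> cb C2 c2]])
    have "\<bar>\<beta> j x\<bar> * (225 / ?h) = 225 * \<epsilon> (proj j x)" using h \<epsilon>(3)[of "proj j x"] by (simp add: abs_mult)
    moreover have "\<bar>sq_pos ?u\<bar> * (1/40 * ?e) \<le> 127 * (1/40 * ?e)" using s e by (intro mult_right_mono) auto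
    ultimately show "\<bar>\<beta> j x\<bar> * (225 / ?h) + \<bar>sq_pos ?u\<bar> * (1/40 * ?e) \<le> 285 * ?e"
      using \<epsilon>_compare(1)[OF i near] e by linarith
  qed
  from calm_add[OF calm_vec_nth[OF calm_aff[OF i near]] this, of l]
  have "calm (\<lambda>y. (aff (proj j y) y - f' x y) $ l + \<beta> j y * sq_pos ((gap j n y)\<^sup>2 / (\<eta> (proj j y))\<^sup>2 - 9)) x
     (7 * ?e + 285 * ?e)" .
  then show ?thesis by (simp add: cand_def algebra_simps)
qed

lemma calm_filt:
  assumes i: "anchored i x" and n: "i \<le> n"
  shows "calm (\<lambda>y. filt i n l y - f' x y $ l) x (300 * \<epsilon> (proj i x))"
proof (rule calm_cong)
  note p = anchored_pos[OF i]
  show "calm (\<lambda>y. softmin (core i n x) (\<lambda>j. cand l n j y) (\<lambda>j. \<beta> j y) - f' x y $ l) x (300 * \<epsilon> (proj i x))"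
  proof (rule calm_mono[OF calm_softmin[OF core(3,2)[OF i n], where K="292 * \<epsilon> (proj i x)" and L="1/40 * \<epsilon> (proj i x)"]])
    fix j assume j: "j \<in> core i n x"
    then have jw: "j \<in> window i n x" using core(1)[OF i n] by blast
    show "calm (\<lambda>y. cand l n j y - f' x y $ l) x (292 * \<epsilon> (proj i x))" by (rule calm_cand[OF i n j])
    show "calm (\<beta> j) x (1/40 * \<epsilon> (proj i x))"
      by (rule calm_\<beta>_near[OF i _ window_near(2)[OF jw n]]) (use window_near(1)[OF jw n] p in linarith)
    show "\<beta> j x > 0" by (rule window_cand_lower(2)[OF i jw n])
  qed (use \<epsilon>(3)[of "proj i x"] in linarith)
  show "\<forall>\<^sub>F y in nhds x. softmin (core i n x) (\<lambda>j. cand l n j y) (\<lambda>j. \<beta> j y) - f' x y $ l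
    = filt i n l y - f' x y $ l"
    using eventually_filt_eq[OF i n, of l] by eventually_elim simp
qed

lemma C1_at_osc:
  assumes "anchored i x" "anchored n x" "i \<le> n" shows "C1_at (\<lambda>y. osc i n y) x"
  unfolding osc_def by (intro C1_at_sum C1_at_diff C1_at_mult C1_at_const C1_at_filt assms order_refl)

text \<open>The coefficients 2, -1, -1 sum to zero, so the common derivative \<open>f' x\<close>
  cancels and only the deviations of size \<open>300 * \<epsilon>\<close> remain, one of them
  enlarged by 5/4.\<close>

lemma calm_osc:
  assumes i: "anchored i x" and n: "anchored n x" "i \<le> n"
  shows "calm (\<lambda>y. osc i n y) x (1275 * real CARD('d) * \<epsilon> (proj i x))"
proof -
  have "calm (\<lambda>y. 2 * filt i n l y - filt n n l y - filt i i l y) x (1275 * \<epsilon> (proj i x))" for l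
  proof -
    have 1: "calm (\<lambda>y. (filt i n l y - f' x y $ l) + (filt i n l y - f' x y $ l)
        - (filt n n l y - f' x y $ l) - (filt i i l y - f' x y $ l)) x
        ((300 * \<epsilon> (proj i x) + 300 * \<epsilon> (proj i x)) + 300 * \<epsilon> (proj n x) + 300 * \<epsilon> (proj i x))"
      by (intro calm_diff calm_add calm_filt i n order_refl)
    have "(\<lambda>y. (filt i n l y - f' x y $ l) + (filt i n l y - f' x y $ l)
        - (filt n n l y - f' x y $ l) - (filt i i l y - f' x y $ l)) = (\<lambda>y. 2 * filt i n l y - filt n n l y - filt i i l y)"
      by auto
    with 1 show ?thesis using later_compare(3)[OF i n(2)] by (auto elim!: calm_mono)
  qed
  then have "calm (\<lambda>y. osc i n y) x (\<Sum>l\<in>(UNIV::'d set). 1275 * \<epsilon> (proj i x))"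
    unfolding osc_def by (rule calm_sum)
  then show ?thesis by (simp add: mult_ac)
qed

section \<open>Behaviour of the filter along basis vectors\<close>

lemma proj_add_basis: "j \<le> m \<Longrightarrow> proj j (x + s *\<^sub>R e m) = proj j x"
  by (simp add: proj_add proj_scaleR proj_basis)

text \<open>Projections up to \<open>n\<close> do not see \<open>e m\<close>, so windows, widths and
  penalties stay fixed and each candidate moves affinely, by its own operator
  \<open>L (proj j x)\<close>.\<close>

lemma filt_add_basis:
  assumes "i \<le> n" "n \<le> m"
  shows "filt i n l (x + s *\<^sub>R e m) = softmin (window i n x) (\<lambda>j. cand l n j x + s * L (proj j x) (e m) $ l) (\<lambda>j. \<beta> j x)"
proof -
  have P: "proj j (x + s *\<^sub>R e m) = proj j x" if "j \<le> n" for j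
    by (rule proj_add_basis) (use that assms in simp)
  have W: "window i n (x + s *\<^sub>R e m) = window i n x" using P assms by (auto simp: window_def)
  have "softmin (window i n x) (\<lambda>j. cand l n j (x + s *\<^sub>R e m)) (\<lambda>j. \<beta> j (x + s *\<^sub>R e m))
    = softmin (window i n x) (\<lambda>j. cand l n j x + s * L (proj j x) (e m) $ l) (\<lambda>j. \<beta> j x)"
  proof -
    have "cand l n j (x + s *\<^sub>R e m) = cand l n j x + s * L (proj j x) (e m) $ l" "\<beta> j (x + s *\<^sub>R e m) = \<beta> j x"
      if "j \<in> window i n x" for j
    proof -
      have "j \<le> n" using that assms by (auto simp: window_def)
      then show "cand l n j (x + s *\<^sub>R e m) = cand l n j x + s * L (proj j x) (e m) $ l" "\<beta> j (x + s *\<^sub>R e m) = \<beta> j x"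
        unfolding cand_def by (simp_all add: P blinfun.add_right blinfun.scaleR_right blinfun.diff_right algebra_simps)
    qed
    then have "cutoff (window i n x) (\<lambda>j. cand l n j (x + s *\<^sub>R e m)) (\<lambda>j. \<beta> j (x + s *\<^sub>R e m))
      = cutoff (window i n x) (\<lambda>j. cand l n j x + s * L (proj j x) (e m) $ l) (\<lambda>j. \<beta> j x)"
      "(\<Sum>j\<in>window i n x. \<bar>cand l n j (x + s *\<^sub>R e m)\<bar> + \<bar>\<beta> j (x + s *\<^sub>R e m)\<bar>)
      = (\<Sum>j\<in>window i n x. \<bar>cand l n j x + s * L (proj j x) (e m) $ l\<bar> + \<bar>\<beta> j x\<bar>)"
      by (auto intro!: ext cutoff_cong sum.cong)
    then show ?thesis by (simp add: softmin_def)
  qed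
  then show ?thesis by (simp add: filt_def W)
qed

lemma filt_basis_const:
  assumes "i \<le> n" "n \<le> m" "\<And>j. j \<in> window i n x \<Longrightarrow> L (proj j x) (e m) $ l = 0"
  shows "filt i n l (x + s *\<^sub>R e m) = filt i n l x"
proof -
  have "cutoff (window i n x) (\<lambda>j. cand l n j x + s * L (proj j x) (e m) $ l) (\<lambda>j. \<beta> j x)
    = cutoff (window i n x) (\<lambda>j. cand l n j x) (\<lambda>j. \<beta> j x)"
    by (rule ext, rule cutoff_cong) (simp add: assms)
  then have "softmin (window i n x) (\<lambda>j. cand l n j x + s * L (proj j x) (e m) $ l) (\<lambda>j. \<beta> j x)
     = softmin (window i n x) (\<lambda>j. cand l n j x) (\<lambda>j. \<beta> j x)"
    by (simp add: softmin_def assms(3))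
  then show ?thesis using filt_add_basis[OF assms(1,2), of l x s] by (simp add: filt_def)
qed

lemma filt_basis_grow:
  assumes i: "anchored i x" and n: "i \<le> n" "n \<le> m" and s: "0 \<le> s"
    and r: "\<And>j. j \<in> window i n x \<Longrightarrow> r \<le> L (proj j x) (e m) $ l"
  shows "filt i n l x + s * r \<le> filt i n l (x + s *\<^sub>R e m)"
proof -
  have "softmin (window i n x) (\<lambda>j. cand l n j x) (\<lambda>j. \<beta> j x)
    \<le> softmin (window i n x) (\<lambda>j. cand l n j x + s * L (proj j x) (e m) $ l) (\<lambda>j. \<beta> j x) + - (s * r)"
  proof (rule softmin_shift[OF finite_window later_window(2)[OF i order_refl n(1) order_refl]])
    fix j assume j: "j \<in> window i n x"
    show "0 < \<beta> j x \<and> 0 < \<beta> j x" using window_cand_lower(2)[OF i j n(1)] by simp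
    show "cand l n j x - (cand l n j x + s * L (proj j x) (e m) $ l) + \<bar>\<beta> j x - \<beta> j x\<bar> \<le> - (s * r)"
      using mult_left_mono[OF r[OF j] s] by simp
  qed
  then show ?thesis using filt_add_basis[OF n, of l x s] by (simp add: filt_def)
qed

end

context filter_data
begin

section \<open>The clock\<close>

text \<open>With 280 = 4 * 70 the bound of \<open>osc_le\<close> keeps the potential term of the
  level below 1/4.\<close>

definition rate :: real where "rate = 1 / (280 * real CARD('d))"

lemma rate_pos: "rate > 0" by (simp add: rate_def)

lemma rate_card: "rate * (c * real CARD('d)) = c / 280" by (simp add: rate_def)

text \<open>Being anchored need not persist, since \<open>\<eta>\<close> may shrink along the
  projections. It loses at most 2 percent here, so the stricter factor 2 makes every later index
  anchored.\<close>

definition ready :: "nat \<Rightarrow> 'a \<Rightarrow> bool" where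
  "ready i x \<longleftrightarrow> norm (x - proj i x) < 2 * \<eta> (proj i x)"

definition active :: "nat \<Rightarrow> 'a \<Rightarrow> nat set" where
  "active n x = {i. i \<le> n \<and> ready i x}"

text \<open>Subtracting the potential makes the level drop in proportion to the relative size of each
  step. The geometric term keeps the drop positive when the step vanishes.\<close>

definition level :: "nat \<Rightarrow> nat \<Rightarrow> 'a \<Rightarrow> real" where
  "level i n x = (norm (x - proj i x))\<^sup>2 / (\<eta> (proj i x))\<^sup>2 - rate * (osc i n x / \<beta> i x)
     - ((1/2) ^ i - (1/2) ^ n) / 8"

text \<open>The constant entry 1 keeps the index set nonempty, so that the clock is smooth on all of
  \<open>U\<close>. It also hides indices on the verge of not being ready: their level is near 4 up
  to 3/8, too large to matter.\<close>

definition clock :: "nat \<Rightarrow> 'a \<Rightarrow> real" where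
  "clock n x = softmin (insert None (Some ` active n x)) (\<lambda>i. case i of None \<Rightarrow> 1 | Some i \<Rightarrow> level i n x) (\<lambda>_. 1/8)"

text \<open>Proportional to the size of the step from \<open>n\<close> to \<open>Suc n\<close>, so
  that step divided by thickness is bounded. The factor 1/2 pays for
  \<open>\<beta> i x \<le> 2 * \<beta> n x\<close> when levels anchored at earlier \<open>i\<close>
  are compared; the geometric term keeps it positive.\<close>

definition thickness :: "nat \<Rightarrow> 'a \<Rightarrow> real" where
  "thickness n x = rate / 2 * (osc n (Suc n) x / \<beta> n x) + (1/2) ^ n / 64"

lemma finite_active [simp]: "finite (active n x)"
  by (rule finite_subset[of _ "{..n}"]) (auto simp: active_def)

lemma ready_pos: "ready i x \<Longrightarrow> \<eta> (proj i x) > 0"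
  unfolding ready_def using norm_ge_zero[of "x - proj i x"] by linarith

lemma ready_imp_anchored:
  assumes "ready i x" "i \<le> n" shows "anchored n x" "\<eta> (proj n x) \<le> 102/100 * \<eta> (proj i x)" "\<eta> (proj n x) > 0"
proof -
  have p: "\<eta> (proj i x) > 0" by (rule ready_pos[OF assms(1)])
  have t: "norm (x - proj i x) < 2 * \<eta> (proj i x)" using assms(1) by (simp add: ready_def)
  have g: "norm (proj n x - proj i x) \<le> norm (x - proj i x)" by (rule norm_proj_diff_le_tail[OF assms(2)])
  have h: "\<bar>\<eta> (proj n x) - \<eta> (proj i x)\<bar> \<le> norm (proj n x - proj i x) / 100" by (rule \<eta>(2))
  show "\<eta> (proj n x) \<le> 102/100 * \<eta> (proj i x)" "\<eta> (proj n x) > 0" using p t g h by linarith+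
  have "norm (x - proj n x) \<le> norm (x - proj i x)" by (rule norm_tail_mono[OF assms(2)])
  then show "anchored n x" unfolding anchored_def using p t g h by linarith
qed

lemma osc_ratio:
  assumes i: "anchored i x" and n: "anchored n x" "i \<le> n"
  shows "rate * (osc i n x / \<beta> i x) \<le> 1/4"
proof -
  have b: "\<beta> i x > 0" using \<beta>_pos anchored_pos[OF i] by blast
  have "osc i n x / \<beta> i x \<le> 70 * real CARD('d)" using osc_le[OF assms] b by (simp add: divide_le_eq)
  then have "rate * (osc i n x / \<beta> i x) \<le> rate * (70 * real CARD('d))" using rate_pos by (intro mult_left_mono) auto
  then show ?thesis unfolding rate_card by simp
qed

lemma level_ge:
  assumes "ready i x" "i \<le> n"
  shows "(norm (x - proj i x))\<^sup>2 / (\<eta> (proj i x))\<^sup>2 - 3/8 \<le> level i n x"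
proof -
  have arith: "t - 3/8 \<le> t - r - (p - q) / 8" if "p \<le> 1" "0 \<le> q" "r \<le> 1/4" for p q r t :: real
    using that by (simp add: field_simps)
  show ?thesis
    unfolding level_def
    by (intro arith osc_ratio ready_imp_anchored(1)[OF assms(1)] assms(2) order_refl) (auto simp: power_le_one)
qed

lemma thickness_bounds:
  assumes "ready i x" "i \<le> n" shows "0 < thickness n x" "thickness n x \<le> 9/64"
proof -
  note a = ready_imp_anchored(1)[OF assms] ready_imp_anchored(1)[OF assms(1) le_SucI[OF assms(2)]]
  have b: "\<beta> n x > 0" using \<beta>_pos anchored_pos[OF a(1)] by blast
  have "0 \<le> rate * (osc n (Suc n) x / \<beta> n x)" using osc_step(2)[OF a(1)] b rate_pos by simp
  moreover have "rate * (osc n (Suc n) x / \<beta> n x) \<le> 1/4" by (rule osc_ratio[OF a]) simp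
  moreover have "(1/2 :: real) ^ n \<le> 1" by (simp add: power_le_one)
  moreover have "0 < (1/2 :: real) ^ n" by simp
  moreover have "0 < r / 2 * q + p / 64 \<and> r / 2 * q + p / 64 \<le> 9/64"
    if "0 \<le> r * q" "r * q \<le> 1/4" "p \<le> 1" "0 < p" for r q p :: real
    using that times_divide_eq_left[of r 2 q] by linarith
  ultimately show "0 < thickness n x" "thickness n x \<le> 9/64" unfolding thickness_def by blast+
qed

lemma step_le_thickness:
  assumes "anchored n x" "anchored (Suc n) x"
  shows "\<bar>filt (Suc n) (Suc n) l x - filt n n l x\<bar> \<le> 2 * \<beta> n x / rate * thickness n x"
proof -
  have b: "\<beta> n x > 0" using \<beta>_pos anchored_pos[OF assms(1)] by blast
  have "t = 2 * b / r * (r / 2 * (t / b))" if "b > 0" "r > 0" for t b r :: real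
    using that by simp
  from this[OF b rate_pos]
  have "osc n (Suc n) x = 2 * \<beta> n x / rate * (rate / 2 * (osc n (Suc n) x / \<beta> n x))" .
  also have "\<dots> \<le> 2 * \<beta> n x / rate * thickness n x"
    using b rate_pos by (intro mult_left_mono) (auto simp: thickness_def)
  finally show ?thesis using osc_step(1)[OF assms(1), of l] by linarith
qed

text \<open>By superadditivity the potential since \<open>i\<close> grows by at least the potential
  of the new step. The geometric term drops by \<open>(1/2) ^ n / 16\<close>, which covers the one
  in the thickness and leaves a strict margin.\<close>

lemma level_decreases:
  assumes "ready i x" "i \<le> n"
  shows "level i (Suc n) x \<le> level i n x - thickness n x - (1/2) ^ n / 64"
proof -
  note a = ready_imp_anchored(1)[OF assms(1) order_refl] ready_imp_anchored(1)[OF assms]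
  have b: "\<beta> n x > 0" "\<beta> i x > 0" using \<beta>_pos anchored_pos[OF a(1)] anchored_pos[OF a(2)] by blast+
  have "osc n (Suc n) x / (2 * \<beta> n x) \<le> osc n (Suc n) x / \<beta> i x"
    using later_compare(2)[OF a(1) assms(2)] b osc_step(2)[OF a(2)] by (intro divide_left_mono) auto
  also have "\<dots> \<le> (osc i (Suc n) x - osc i n x) / \<beta> i x"
    using osc_superadditive[OF a(1) assms(2)] b by (intro divide_right_mono) auto
  finally have "rate * (osc n (Suc n) x / (2 * \<beta> n x)) \<le> rate * ((osc i (Suc n) x - osc i n x) / \<beta> i x)"
    using rate_pos by (intro mult_left_mono) auto
  then have "rate / 2 * (osc n (Suc n) x / \<beta> n x) \<le> rate * (osc i (Suc n) x / \<beta> i x) - rate * (osc i n x / \<beta> i x)"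
    by (simp add: diff_divide_distrib right_diff_distrib)
  moreover have "t - a' - (p - q') / 8 \<le> t - a - (p - q) / 8 - (b + q / 64) - q / 64"
    if "b \<le> a' - a" "0 < q" "q' = q / 2" for t a a' b p q q' :: real
    using that by (simp add: field_simps)
  moreover have "0 < (1/2 :: real) ^ n" "(1/2 :: real) ^ Suc n = (1/2) ^ n / 2" by simp_all
  ultimately show ?thesis unfolding level_def thickness_def by blast
qed

lemma clock_index:
  "finite (insert None (Some ` active n x))" "None \<in> insert None (Some ` active n x)"
  by auto

lemma clock_le: "i \<in> active n x \<Longrightarrow> clock n x \<le> level i n x"
  unfolding clock_def
  using softmin_le[of "insert None (Some ` active n x)" "Some i" "\<lambda>_. 1/8" "\<lambda>i. case i of None \<Rightarrow> 1 | Some i \<Rightarrow> level i n x"]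
  by auto

lemma clock_small:
  assumes "clock n x < 1/2" obtains i where "i \<in> active n x" "level i n x < 5/8"
proof -
  have "\<exists>i\<in>active n x. level i n x < 5/8"
  proof (rule ccontr)
    assume "\<not> ?thesis"
    then have "1/2 \<le> clock n x"
      unfolding clock_def by (intro softmin_ge[OF clock_index]) (auto simp: not_less)
    then show False using assms by simp
  qed
  then show ?thesis using that by blast
qed

lemma clock_anchored:
  assumes "clock n x < 1/2" obtains i where "ready i x" "i \<le> n" "anchored n x" "anchored (Suc n) x"
    "0 < thickness n x" "thickness n x \<le> 9/64" "\<eta> (proj n x) > 0"
proof -
  obtain i where "i \<in> active n x" using clock_small[OF assms] by blast
  then have i: "ready i x" "i \<le> n" by (auto simp: active_def)
  show ?thesis
    by (rule that[OF i ready_imp_anchored(1)[OF i] ready_imp_anchored(1)[OF i(1) le_SucI[OF i(2)]] thickness_bounds[OF i]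
      ready_imp_anchored(3)[OF i]])
qed

text \<open>Some level is below 5/8, so the constant entry does not count; all active levels drop by
  the same amount, and a newly active index can only lower the minimum further.\<close>

lemma clock_decreases:
  assumes "clock n x < 1/2"
  shows "clock (Suc n) x \<le> clock n x - thickness n x - (1/2) ^ n / 64"
proof -
  let ?v = "\<lambda>n i. case i of None \<Rightarrow> 1 | Some i \<Rightarrow> level i n x"
  let ?A = "Some ` active n x" and ?d = "thickness n x + (1/2) ^ n / 64"
  obtain i where i: "i \<in> active n x" "level i n x < 5/8" using clock_small[OF assms] .
  have A: "finite ?A" "Some i \<in> ?A" using i by auto
  have sub: "active n x \<subseteq> active (Suc n) x" by (auto simp: active_def)
  have "clock (Suc n) x \<le> softmin ?A (?v (Suc n)) (\<lambda>_. 1/8)"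
    unfolding clock_def by (rule softmin_superset[OF clock_index(1) _ A(2)]) (use sub in auto)
  also have "\<dots> \<le> softmin ?A (?v n) (\<lambda>_. 1/8) + - ?d"
  proof (rule softmin_shift[OF A])
    fix j assume "j \<in> ?A"
    then obtain k where k: "j = Some k" "ready k x" "k \<le> n" by (auto simp: active_def)
    show "?v (Suc n) j - ?v n j + \<bar>1/8 - 1/8\<bar> \<le> - ?d"
      using level_decreases[OF k(2,3)] k(1) by simp
  qed simp
  also have "softmin ?A (?v n) (\<lambda>_. 1/8) = clock n x"
    unfolding clock_def by (rule softmin_drop[symmetric, OF clock_index(1) _ A(2)]) (use i in auto)
  finally show ?thesis by simp
qed

text \<open>As for \<open>core\<close>, a threshold between 9/5, beyond which a level is too large
  to count, and the 2 of \<open>ready\<close> makes the index set locally constant.\<close>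

definition clock_core :: "nat \<Rightarrow> 'a \<Rightarrow> nat set" where
  "clock_core n x = {i. i \<le> n \<and> norm (x - proj i x) < 15/8 * \<eta> (proj i x)}"

lemma clock_core: "i \<in> clock_core n x \<Longrightarrow> ready i x \<and> i \<le> n" "finite (clock_core n x)"
proof -
  show "i \<in> clock_core n x \<Longrightarrow> ready i x \<and> i \<le> n"
    using \<eta>(3)[of "proj i x"] by (simp add: clock_core_def ready_def)
  show "finite (clock_core n x)" by (rule finite_subset[of _ "{..n}"]) (auto simp: clock_core_def)
qed

lemma eventually_clock_eq:
  assumes x: "x \<in> U"
  shows "\<forall>\<^sub>F y in nhds x. clock n y = softmin (insert None (Some ` clock_core n x))
    (\<lambda>i. case i of None \<Rightarrow> 1 | Some i \<Rightarrow> level i n y) (\<lambda>_. 1/8)"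
proof -
  have "\<forall>\<^sub>F y in nhds x. \<forall>i\<in>{..n}. (i \<in> clock_core n x \<longrightarrow> ready i y) \<and>
      (i \<notin> clock_core n x \<longrightarrow> 9/5 * \<eta> (proj i y) < norm (y - proj i y))"
  proof (intro eventually_ball_finite ballI)
    fix i assume i: "i \<in> {..n}"
    have lim: "((\<lambda>y. norm (y - proj i y) - c * \<eta> (proj i y)) \<longlongrightarrow> norm (x - proj i x) - c * \<eta> (proj i x)) (nhds x)" for c
      by (intro tendsto_intros proj_tendsto_nhds \<eta>_proj_tendsto filterlim_ident)
    show "\<forall>\<^sub>F y in nhds x. (i \<in> clock_core n x \<longrightarrow> ready i y) \<and>
      (i \<notin> clock_core n x \<longrightarrow> 9/5 * \<eta> (proj i y) < norm (y - proj i y))"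
    proof (cases "i \<in> clock_core n x")
      case True
      then have "norm (x - proj i x) < 2 * \<eta> (proj i x)" using clock_core(1) by (auto simp: ready_def)
      then have "\<forall>\<^sub>F y in nhds x. norm (y - proj i y) - 2 * \<eta> (proj i y) < 0"
        by (intro order_tendstoD(2)[OF lim]) simp
      then show ?thesis by eventually_elim (use True in \<open>simp add: ready_def\<close>)
    next
      case False
      then have t: "15/8 * \<eta> (proj i x) \<le> norm (x - proj i x)" using i by (auto simp: clock_core_def)
      have "0 < norm (x - proj i x) - 9/5 * \<eta> (proj i x)"
      proof (cases "\<eta> (proj i x) > 0")
        case True
        then show ?thesis using t by linarith
      next
        case 0: False
        \<comment> \<open>A projection equal to \<open>x\<close> would have positive scale, since
          \<open>x\<close> lies in \<open>U\<close>; so the tail is positive where the scale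
          vanishes.\<close>
        then have "proj i x \<noteq> x" using x \<eta>(4)[of x] by metis
        then have "0 < norm (x - proj i x)" by simp
        then show ?thesis using 0 \<eta>(3)[of "proj i x"] by linarith
      qed
      then have "\<forall>\<^sub>F y in nhds x. 0 < norm (y - proj i y) - 9/5 * \<eta> (proj i y)" by (rule order_tendstoD(1)[OF lim])
      then show ?thesis by eventually_elim (use False in simp)
    qed
  qed simp
  then show ?thesis
  proof eventually_elim
    case (elim y)
    have sub: "clock_core n x \<subseteq> active n y" using elim clock_core(1) by (auto simp: active_def)
    show ?case
      unfolding clock_def
    proof (rule softmin_drop[OF clock_index(1), where i=None])
      fix j assume "j \<in> insert None (Some ` active n y) - insert None (Some ` clock_core n x)"
      then obtain i where j: "j = Some i" and i: "i \<in> active n y" "i \<notin> clock_core n x" by auto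
      then have r: "ready i y" "i \<le> n" by (auto simp: active_def)
      have "9/5 * \<eta> (proj i y) < norm (y - proj i y)" using elim i r by auto
      then have "(9/5 * \<eta> (proj i y))\<^sup>2 \<le> (norm (y - proj i y))\<^sup>2" using \<eta>(3)[of "proj i y"] by (intro power_mono) auto
      moreover have "(9/5 * \<eta> (proj i y))\<^sup>2 = 81/25 * (\<eta> (proj i y))\<^sup>2" by (simp add: power2_eq_square)
      ultimately have "3 * (\<eta> (proj i y))\<^sup>2 \<le> (norm (y - proj i y))\<^sup>2"
        using zero_le_power2[of "\<eta> (proj i y)"] by linarith
      then have "3 \<le> (norm (y - proj i y))\<^sup>2 / (\<eta> (proj i y))\<^sup>2" using ready_pos[OF r(1)] by (simp only: pos_le_divide_eq zero_less_power)
      then show "(case None of None \<Rightarrow> 1 | Some i \<Rightarrow> level i n y) \<le> (case j of None \<Rightarrow> 1 | Some i \<Rightarrow> level i n y) - 1/8"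
        using level_ge[OF r] by (simp add: j)
    qed (use sub in auto)
  qed
qed

section \<open>Smoothness and derivative bounds of the clock\<close>

lemma C1_at_osc_ratio:
  assumes "anchored i x" "anchored n x" "i \<le> n" shows "C1_at (\<lambda>y. osc i n y / \<beta> i y) x"
  by (intro C1_at_divide C1_at_osc assms C1_at_\<beta>) (use \<beta>_pos[of i x] anchored_pos[OF assms(1)] in auto)

lemma C1_at_level:
  assumes "ready i x" "i \<le> n" shows "C1_at (\<lambda>y. level i n y) x"
  unfolding level_def
  by (intro C1_at_diff C1_at_const C1_at_mult C1_at_osc_ratio ready_imp_anchored(1)[OF assms(1)] assms order_refl
      C1_at_divide C1_at_\<eta>_sq C1_at_norm_power2 C1_at_id C1_at_linear[OF bounded_linear_proj])
    (use ready_pos[OF assms(1)] in auto)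

lemma C1_at_clock:
  assumes x: "x \<in> U" shows "C1_at (\<lambda>y. clock n y) x"
proof (rule C1_at_cong)
  show "C1_at (\<lambda>y. softmin (insert None (Some ` clock_core n x))
    (\<lambda>i. case i of None \<Rightarrow> 1 | Some i \<Rightarrow> level i n y) (\<lambda>_. 1/8)) x"
    by (rule C1_at_softmin[where i=None]) (use clock_core C1_at_level in \<open>auto split: option.splits\<close>)
  show "\<forall>\<^sub>F y in nhds x. softmin (insert None (Some ` clock_core n x))
    (\<lambda>i. case i of None \<Rightarrow> 1 | Some i \<Rightarrow> level i n y) (\<lambda>_. 1/8) = clock n y"
    using eventually_clock_eq[OF x, of n] by eventually_elim simp
qed

lemma C1_at_thickness:
  assumes "anchored n x" "anchored (Suc n) x" shows "C1_at (\<lambda>y. thickness n y) x"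
  unfolding thickness_def
  by (intro C1_at_add C1_at_mult C1_at_const C1_at_osc_ratio assms) simp

text \<open>The quotient rule gives 1275 from \<open>osc\<close> and 70/40 from
  \<open>\<beta>\<close>, each times the dimension over the scale; \<open>rate\<close> cancels the
  dimension and divides by 280.\<close>

lemma calm_osc_ratio:
  assumes i: "anchored i x" and n: "anchored n x" "i \<le> n"
  shows "calm (\<lambda>y. rate * (osc i n y / \<beta> i y)) x (23/5 / \<eta> (proj i x))"
proof -
  let ?c = "real CARD('d)" and ?e = "\<epsilon> (proj i x)" and ?h = "\<eta> (proj i x)"
  note p = anchored_pos[OF i]
  have e: "?e > 0" using \<epsilon>_pos p by blast
  have b: "\<beta> i x > 0" using \<beta>_pos p by blast
  have cb: "calm (\<beta> i) x (1/40 * ?e)" by (rule calm_\<beta>_near[OF i]) (use p in auto)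
  have 1: "calm (\<lambda>y. osc i n y / \<beta> i y) x (1275 * ?c * ?e / \<beta> i x + \<bar>osc i n x\<bar> * (1/40 * ?e) / (\<beta> i x)\<^sup>2)"
    by (rule calm_divide[OF C1_at_osc[OF i n] calm_osc[OF i n] C1_at_\<beta> cb b])
  have o: "0 \<le> osc i n x"
  proof -
    have "0 \<le> 2 * filt i n l x - filt n n l x - filt i i l x" for l
    proof -
      have "filt i i l x \<le> filt i n l x"
        using n(2)
      proof (induction n rule: dec_induct)
        case (step k)
        then show ?case using filt_increments(2)[OF i, of k l] by linarith
      qed simp
      moreover have "filt n n l x \<le> filt i n l x"
        unfolding filt_def
      proof (rule softmin_superset[OF finite_window])
        show "window i n x \<subseteq> window n n x" using n by (auto simp: window_def)
        show "i \<in> window i n x" by (rule later_window(2)[OF i order_refl n(2) order_refl])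
      qed (use window_pos \<beta>_pos in blast)
      ultimately show ?thesis by linarith
    qed
    then show ?thesis unfolding osc_def by (intro sum_nonneg) auto
  qed
  have "\<bar>osc i n x\<bar> * (1/40 * ?e) / (\<beta> i x)\<^sup>2 \<le> (70 * ?c * \<beta> i x) * (1/40 * ?e) / (\<beta> i x)\<^sup>2"
    using osc_le[OF i n] o e by (intro divide_right_mono mult_right_mono) auto
  also have "\<dots> = (7/4) * ?c / ?h" using b e p by (simp add: power2_eq_square field_simps)
  finally have 2: "\<bar>osc i n x\<bar> * (1/40 * ?e) / (\<beta> i x)\<^sup>2 \<le> (7/4) * ?c / ?h" .
  have "1275 * ?c * ?e / \<beta> i x = 1275 * ?c / ?h" using e p by simp
  with 1 2 have 3: "calm (\<lambda>y. osc i n y / \<beta> i y) x (1275 * ?c / ?h + (7/4) * ?c / ?h)"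
    by (auto elim!: calm_mono)
  have 4: "rate * (1275 * ?c / ?h + (7/4) * ?c / ?h) \<le> 23/5 / ?h"
  proof -
    have "rate * (1275 * ?c / ?h + (7/4) * ?c / ?h) = rate * (5107/4 * ?c) / ?h"
      by (simp add: algebra_simps add_divide_distrib[symmetric])
    also have "\<dots> \<le> 23/5 / ?h" unfolding rate_card using p by (intro divide_right_mono) auto
    finally show ?thesis .
  qed
  have "C1_at (\<lambda>y. osc i n y / \<beta> i y) x" by (rule C1_at_osc_ratio[OF i n])
  from calm_mult[OF C1_at_const calm_const[OF order_refl] this 3, of rate] show ?thesis
    by (rule calm_mono) (use 4 rate_pos in \<open>simp only: abs_of_pos mult_zero_right add_0_right\<close>)
qed

lemma calm_level:
  assumes r: "ready i x" "i \<le> n" shows "calm (\<lambda>y. level i n y) x (9 / \<eta> (proj i x))"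
proof -
  let ?h = "\<eta> (proj i x)"
  have h: "?h > 0" by (rule ready_pos[OF r(1)])
  have C: "C1_at (\<lambda>y. (norm (y - proj i y))\<^sup>2) x"
    by (intro C1_at_norm_power2 C1_at_diff C1_at_id C1_at_linear[OF bounded_linear_proj])
  have "calm (\<lambda>y. (norm (y - proj i y))\<^sup>2 / (\<eta> (proj i y))\<^sup>2) x
     (2 * norm (x - proj i x) / ?h\<^sup>2 + \<bar>(norm (x - proj i x))\<^sup>2\<bar> * (?h / 50) / (?h\<^sup>2)\<^sup>2)"
    by (rule calm_divide[OF C calm_tail_sq C1_at_\<eta>_sq calm_\<eta>_sq]) (use h in simp)
  then have 1: "calm (\<lambda>y. (norm (y - proj i y))\<^sup>2 / (\<eta> (proj i y))\<^sup>2) x ((2 * 2 + 2\<^sup>2 / 50) / ?h)"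
    by (rule calm_mono) (rule ratio_estimate, use r h in \<open>auto simp: ready_def\<close>)
  note a = ready_imp_anchored(1)[OF r(1)]
  have "calm (\<lambda>y. level i n y) x ((2 * 2 + 2\<^sup>2 / 50) / ?h + 23/5 / ?h + 0)"
    unfolding level_def
    by (intro calm_diff 1 calm_osc_ratio a r order_refl calm_const)
  then show ?thesis by (rule calm_mono) (use h in \<open>simp add: field_simps\<close>)
qed

lemma calm_clock:
  assumes x: "x \<in> U" and c: "clock n x < 1/2"
  shows "calm (\<lambda>y. clock n y) x (10 / \<eta> (proj n x))"
proof (rule calm_cong)
  have pn: "\<eta> (proj n x) > 0" by (rule clock_anchored[OF c])
  have "calm (\<lambda>y. softmin (insert None (Some ` clock_core n x))
    (\<lambda>i. case i of None \<Rightarrow> 1 | Some i \<Rightarrow> level i n y) (\<lambda>_. 1/8) - 0) x (10 / \<eta> (proj n x) + 0)"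
  proof (rule calm_softmin[where i=None and A="\<lambda>_. 0"])
    fix j assume j: "j \<in> insert None (Some ` clock_core n x)"
    show "calm (\<lambda>y. (case j of None \<Rightarrow> 1 | Some i \<Rightarrow> level i n y) - 0) x (10 / \<eta> (proj n x))"
    proof (cases j)
      case None
      then show ?thesis using pn by simp
    next
      case (Some i)
      then have r: "ready i x" "i \<le> n" using j clock_core(1) by auto
      have "9 * \<eta> (proj n x) \<le> 10 * \<eta> (proj i x)"
        using ready_imp_anchored(2)[OF r] ready_pos[OF r(1)] by linarith
      then have "9 / \<eta> (proj i x) \<le> 10 / \<eta> (proj n x)"
        using pn ready_pos[OF r(1)] by (simp add: frac_le_eq divide_le_eq field_simps)
      then show ?thesis using calm_mono[OF calm_level[OF r]] Some by simp
    qed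
  qed (use clock_core(2) in auto)
  then show "calm (\<lambda>y. softmin (insert None (Some ` clock_core n x))
    (\<lambda>i. case i of None \<Rightarrow> 1 | Some i \<Rightarrow> level i n y) (\<lambda>_. 1/8)) x (10 / \<eta> (proj n x))" by simp
  show "\<forall>\<^sub>F y in nhds x. softmin (insert None (Some ` clock_core n x))
    (\<lambda>i. case i of None \<Rightarrow> 1 | Some i \<Rightarrow> level i n y) (\<lambda>_. 1/8) = clock n y"
    using eventually_clock_eq[OF x, of n] by eventually_elim simp
qed

lemma calm_thickness:
  assumes a: "anchored n x" "anchored (Suc n) x"
  shows "calm (\<lambda>y. thickness n y) x (3 / \<eta> (proj n x))"
proof -
  have h: "\<eta> (proj n x) > 0" using anchored_pos[OF a(1)] by blast
  have 1: "calm (\<lambda>y. rate * (osc n (Suc n) y / \<beta> n y)) x (23/5 / \<eta> (proj n x))"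
    by (rule calm_osc_ratio[OF a]) simp
  have C: "C1_at (\<lambda>y. rate * (osc n (Suc n) y / \<beta> n y)) x"
    by (intro C1_at_mult C1_at_const C1_at_osc_ratio a) simp
  have "calm (\<lambda>y. 1/2 * (rate * (osc n (Suc n) y / \<beta> n y)) + (1/2) ^ n / 64) x
     (\<bar>1/2\<bar> * (23/5 / \<eta> (proj n x)) + \<bar>rate * (osc n (Suc n) x / \<beta> n x)\<bar> * 0 + 0)"
    by (intro calm_add calm_mult[OF C1_at_const _ C 1] calm_const) auto
  moreover have "(\<lambda>y. 1/2 * (rate * (osc n (Suc n) y / \<beta> n y)) + (1/2) ^ n / 64) = (\<lambda>y. thickness n y)"
    by (simp add: thickness_def fun_eq_iff)
  ultimately show ?thesis by (simp only:) (erule calm_mono, use h in \<open>simp add: field_simps\<close>)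
qed

lemma eventually_clock_small:
  assumes x: "x \<in> U" shows "\<forall>\<^sub>F n in sequentially. clock n x < 1/4"
proof -
  have "(\<lambda>n. \<eta> (proj n x)) \<longlonglongrightarrow> \<eta> x"
    by (rule isCont_tendsto_compose[OF C1_at_isCont[OF \<eta>(1)] proj_tendsto])
  moreover have "(\<lambda>n. norm (x - proj n x)) \<longlonglongrightarrow> norm (x - x)" by (rule tendsto_norm[OF tendsto_diff[OF tendsto_const proj_tendsto]])
  ultimately have "(\<lambda>n. \<eta> (proj n x) - 3 * norm (x - proj n x)) \<longlonglongrightarrow> \<eta> x - 3 * norm (x - x)"
    by (intro tendsto_diff tendsto_mult tendsto_const)
  then have "\<forall>\<^sub>F n in sequentially. 0 < \<eta> (proj n x) - 3 * norm (x - proj n x)"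
    by (rule order_tendstoD) (use x \<eta>(4) in simp)
  then show ?thesis
  proof eventually_elim
    case (elim n)
    then have h: "\<eta> (proj n x) > 0" "3 * norm (x - proj n x) < \<eta> (proj n x)"
      using norm_ge_zero[of "x - proj n x"] by linarith+
    then have "ready n x" using norm_ge_zero[of "x - proj n x"] unfolding ready_def by linarith
    then have "n \<in> active n x" by (simp add: active_def)
    then have "clock n x \<le> (norm (x - proj n x))\<^sup>2 / (\<eta> (proj n x))\<^sup>2"
      using clock_le[of n n x] by (simp add: level_def)
    also have "\<dots> < 1/4"
    proof -
      have "(3 * norm (x - proj n x))\<^sup>2 < (\<eta> (proj n x))\<^sup>2" using h by (intro power_strict_mono) auto
      then have "9 * (norm (x - proj n x))\<^sup>2 < (\<eta> (proj n x))\<^sup>2" by (simp add: power_mult_distrib)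
      then have "(norm (x - proj n x))\<^sup>2 < 1/4 * (\<eta> (proj n x))\<^sup>2"
        using zero_le_power2[of "norm (x - proj n x)"] by linarith
      then show ?thesis using h by (simp only: pos_divide_less_eq zero_less_power)
    qed
    finally show ?case .
  qed
qed

lemma finite_pos_lower_bound:
  fixes a :: "'i \<Rightarrow> real"
  assumes "finite J" "\<And>j. j \<in> J \<Longrightarrow> a j > 0"
  obtains r where "r > 0" "\<And>j. j \<in> J \<Longrightarrow> r \<le> a j"
proof (rule that[of "Min (insert 1 (a ` J))"])
  show "Min (insert 1 (a ` J)) > 0" using assms by auto
  show "Min (insert 1 (a ` J)) \<le> a j" if "j \<in> J" for j using assms that by (intro Min_le) auto
qed

text \<open>All tails \<open>x - proj i x\<close> have the same coordinate at \<open>m\<close>, so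
  moving along \<open>e m\<close> in its sign increases every relevant level at a positive rate, by
  strict convexity and constancy of \<open>osc\<close>. The minimum grows at least at the smallest
  of these finitely many rates.\<close>

lemma clock_basis_derivative:
  assumes x: "x \<in> U" and c: "clock n x < 1/2" and m: "n \<le> m" "coord x m \<noteq> 0"
    and D: "((\<lambda>y. clock n y) has_derivative D) (at x)"
    and const: "\<And>i s. i \<le> n \<Longrightarrow> anchored i x \<Longrightarrow> anchored n x \<Longrightarrow> osc i n (x + s *\<^sub>R e m) = osc i n x"
  shows "D (e m) \<noteq> 0"
proof -
  let ?\<sigma> = "sgn (coord x m)" and ?A = "clock_core n x"
  let ?v = "\<lambda>y i. case i of None \<Rightarrow> 1 | Some i \<Rightarrow> level i n y"
  obtain i0 where i0: "i0 \<in> active n x" "level i0 n x < 5/8" using clock_small[OF c] .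
  have r0: "ready i0 x" "i0 \<le> n" using i0 by (auto simp: active_def)
  have i0A: "i0 \<in> ?A"
  proof -
    have h: "\<eta> (proj i0 x) > 0" by (rule ready_pos[OF r0(1)])
    have "(norm (x - proj i0 x))\<^sup>2 / (\<eta> (proj i0 x))\<^sup>2 \<le> 1" using level_ge[OF r0] i0 by linarith
    then have "(norm (x - proj i0 x))\<^sup>2 \<le> (\<eta> (proj i0 x))\<^sup>2" using h by (simp add: divide_le_eq)
    then have "norm (x - proj i0 x) \<le> \<eta> (proj i0 x)" using h by (simp add: abs_le_square_iff[symmetric])
    then show ?thesis using r0 h by (simp add: clock_core_def)
  qed
  have A: "finite (Some ` ?A)" "Some i0 \<in> Some ` ?A" using i0A clock_core(2) by auto
  have "\<forall>\<^sub>F y in nhds x. level i0 n y < 7/8"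
    by (rule order_tendstoD(2)[OF C1_at_tendsto[OF C1_at_level[OF r0]]]) (use i0 in simp)
  with eventually_clock_eq[OF x, of n]
  \<comment> \<open>The constant entry 1 would not grow, but a level below 7/8 near \<open>x\<close>
    keeps it out of the minimum.\<close>
  have ev: "\<forall>\<^sub>F y in nhds x. clock n y = softmin (Some ` ?A) (?v y) (\<lambda>_. 1/8)"
  proof eventually_elim
    case (elim y)
    have "softmin (insert None (Some ` ?A)) (?v y) (\<lambda>_. 1/8) = softmin (Some ` ?A) (?v y) (\<lambda>_. 1/8)"
      by (rule softmin_drop[OF _ _ A(2)]) (use A elim in auto)
    then show ?case using elim by simp
  qed
  have cx: "clock n x = softmin (Some ` ?A) (?v x) (\<lambda>_. 1/8)" using ev by (rule eventually_nhds_x_imp_x)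
  define G where "G i = ?\<sigma> * dsq (x - proj i x) (e m) / (\<eta> (proj i x))\<^sup>2" for i
  have G: "G i > 0" if "i \<in> ?A" for i
  proof -
    have i: "i \<le> n" "\<eta> (proj i x) > 0" using clock_core(1)[OF that] ready_pos by auto
    have "coord (x - proj i x) m = coord x m" using i m by (simp add: coord_diff coord_proj)
    then have "0 < coord x m * dsq (x - proj i x) (e m)" using dsq_basis_pos[of "x - proj i x" m] m by simp
    then have "0 < ?\<sigma> * dsq (x - proj i x) (e m)" using m(2) by (auto simp: sgn_if zero_less_mult_iff)
    then show ?thesis using i by (simp add: G_def)
  qed
  obtain r where r: "r > 0" "\<And>i. i \<in> ?A \<Longrightarrow> r \<le> G i" using finite_pos_lower_bound[OF clock_core(2), of n x G] G by blast
  have grow: "level i n x + s * r \<le> level i n (x + s *\<^sub>R (?\<sigma> *\<^sub>R e m))" if i: "i \<in> ?A" and s: "0 \<le> s" for i s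
  proof -
    have ri: "ready i x" "i \<le> n" using clock_core(1)[OF i] by auto
    have P: "proj i (x + s *\<^sub>R (?\<sigma> *\<^sub>R e m)) = proj i x"
      using proj_add_basis[of i m x "s * ?\<sigma>"] ri m by simp
    have "s * (?\<sigma> * dsq (x - proj i x) (e m)) = dsq (x - proj i x) (s *\<^sub>R (?\<sigma> *\<^sub>R e m))"
      by (simp add: blinfun.scaleR_right)
    also have "\<dots> \<le> (norm (x - proj i x + s *\<^sub>R (?\<sigma> *\<^sub>R e m)))\<^sup>2 - (norm (x - proj i x))\<^sup>2"
      by (rule dsq_le_diff)
    also have "x - proj i x + s *\<^sub>R (?\<sigma> *\<^sub>R e m) = x + s *\<^sub>R (?\<sigma> *\<^sub>R e m) - proj i x" by simp
    finally have "s * (?\<sigma> * dsq (x - proj i x) (e m)) / (\<eta> (proj i x))\<^sup>2 \<le>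
      ((norm (x + s *\<^sub>R (?\<sigma> *\<^sub>R e m) - proj i x))\<^sup>2 - (norm (x - proj i x))\<^sup>2) / (\<eta> (proj i x))\<^sup>2"
      by (intro divide_right_mono) auto
    then have "s * G i \<le> (norm (x + s *\<^sub>R (?\<sigma> *\<^sub>R e m) - proj i x))\<^sup>2 / (\<eta> (proj i x))\<^sup>2
       - (norm (x - proj i x))\<^sup>2 / (\<eta> (proj i x))\<^sup>2"
      by (simp add: G_def diff_divide_distrib)
    moreover have "s * r \<le> s * G i" using r(2)[OF i] s by (rule mult_left_mono)
    moreover have "osc i n (x + s *\<^sub>R (?\<sigma> *\<^sub>R e m)) = osc i n x"
      using const[of i "s * ?\<sigma>"] ri ready_imp_anchored(1)[OF ri(1)] by simp
    ultimately show ?thesis unfolding level_def P by simp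
  qed
  have "r \<le> D (?\<sigma> *\<^sub>R e m)"
  proof (rule derivative_ge[OF D])
    have "((\<lambda>s. x + s *\<^sub>R (?\<sigma> *\<^sub>R e m)) \<longlongrightarrow> x + 0 *\<^sub>R (?\<sigma> *\<^sub>R e m)) (at_right 0)"
      by (intro tendsto_intros)
    then have "filterlim (\<lambda>s. x + s *\<^sub>R (?\<sigma> *\<^sub>R e m)) (nhds x) (at_right 0)" by simp
    with ev have "\<forall>\<^sub>F s in at_right 0. clock n (x + s *\<^sub>R (?\<sigma> *\<^sub>R e m))
        = softmin (Some ` ?A) (?v (x + s *\<^sub>R (?\<sigma> *\<^sub>R e m))) (\<lambda>_. 1/8)"
      unfolding filterlim_iff by blast
    then show "\<forall>\<^sub>F s in at_right 0. s * r \<le> clock n (x + s *\<^sub>R (?\<sigma> *\<^sub>R e m)) - clock n x"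
      using eventually_at_right_less[of 0]
    proof eventually_elim
      case (elim s)
      have "softmin (Some ` ?A) (?v x) (\<lambda>_. 1/8) \<le> softmin (Some ` ?A) (?v (x + s *\<^sub>R (?\<sigma> *\<^sub>R e m))) (\<lambda>_. 1/8) + - (s * r)"
      proof (rule softmin_shift[OF A])
        fix j assume "j \<in> Some ` ?A"
        then obtain i where "j = Some i" "i \<in> ?A" by blast
        then show "?v x j - ?v (x + s *\<^sub>R (?\<sigma> *\<^sub>R e m)) j + \<bar>1/8 - 1/8\<bar> \<le> - (s * r)"
          using grow[of i s] elim by simp
      qed simp
      then show ?case using elim(1) cx by linarith
    qed
  qed
  moreover have "D (?\<sigma> *\<^sub>R e m) = ?\<sigma> * D (e m)"
    using has_derivative_bounded_linear[OF D] by (simp add: linear_cmul bounded_linear.linear)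
  ultimately show ?thesis using r(1) by auto
qed

end

context filter_data
begin

section \<open>Gluing the stages\<close>

definition G :: "nat \<Rightarrow> 'a \<Rightarrow> real ^ 'd" where
  "G n x = (\<chi> l. filt n n l x)"

text \<open>The passage from stage \<open>n\<close> to stage \<open>Suc n\<close> takes place while the clock is in
  \<open>[1/4, 1/4 + thickness n x]\<close>. Since the clock then drops by more than the thickness, at most one
  passage is in progress at a given point.\<close>

definition phase :: "nat \<Rightarrow> 'a \<Rightarrow> real" where
  "phase n x = (clock n x - 1/4) / thickness n x"

definition jump :: "nat \<Rightarrow> 'a \<Rightarrow> real ^ 'd" where
  "jump n x = (if clock n x < 1/2 then (1 - step (phase n x)) *\<^sub>R (G (Suc n) x - G n x) else 0)"

definition stage :: "'a \<Rightarrow> nat" where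
  "stage x = (LEAST n. clock n x < 1/4)"

text \<open>Once the clock is below 1/4 a jump is the whole increment, so \<open>G m\<close> minus
  the jumps before \<open>m\<close> no longer changes with \<open>m\<close>. This is the limit of a
  telescoping sum, written without a limit; see \<open>glue_eq\<close>.\<close>

definition glue :: "'a \<Rightarrow> real ^ 'd" where
  "glue x = G (stage x) x - (\<Sum>k<stage x. jump k x)"

lemma stage: "x \<in> U \<Longrightarrow> clock (stage x) x < 1/4"
  unfolding stage_def using eventually_clock_small[of x] by (metis LeastI eventually_sequentially order_refl)

lemma clock_stays: assumes "clock n x < 1/4" shows "clock (Suc n) x < 1/4"
proof -
  have c: "clock n x < 1/2" using assms by linarith
  have "0 < thickness n x" using clock_anchored[OF c] by metis
  moreover have "0 < (1/2 :: real) ^ n" by simp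
  ultimately show ?thesis using clock_decreases[OF c] assms by linarith
qed

lemma jump_late: assumes "clock n x < 1/4" shows "jump n x = G (Suc n) x - G n x"
proof -
  have c: "clock n x < 1/2" using assms by linarith
  have "0 < thickness n x" using clock_anchored[OF c] by metis
  then have "phase n x \<le> 0" using assms by (simp add: phase_def divide_le_0_iff)
  then show ?thesis using c by (simp add: jump_def)
qed

lemma glue_eq: assumes "clock m x < 1/4" shows "glue x = G m x - (\<Sum>k<m. jump k x)"
proof -
  have "stage x \<le> m" unfolding stage_def using assms by (rule Least_le)
  then have "clock m x < 1/4 \<and> glue x = G m x - (\<Sum>k<m. jump k x)"
  proof (induction m rule: dec_induct)
    case base
    show ?case using LeastI[of "\<lambda>n. clock n x < 1/4", OF assms] by (simp add: glue_def stage_def)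
  next
    case (step k)
    then show ?case using clock_stays[of k x] jump_late[of k x] by simp
  qed
  then show ?thesis ..
qed

lemma C1_at_G: "anchored n x \<Longrightarrow> C1_at (\<lambda>y. G n y) x"
  unfolding G_def by (intro C1_at_vec_lambda C1_at_filt order_refl)

lemma C1_at_phase:
  assumes "x \<in> U" "clock n x < 1/2" shows "C1_at (\<lambda>y. phase n y) x"
proof -
  obtain i where "anchored n x" "anchored (Suc n) x" "0 < thickness n x" using clock_anchored[OF assms(2)] by metis
  then show ?thesis
    unfolding phase_def
    by (intro C1_at_divide C1_at_diff C1_at_clock C1_at_const C1_at_thickness assms) auto
qed

lemma eventually_clock_less:
  assumes "x \<in> U" "clock n x < c" shows "\<forall>\<^sub>F y in nhds x. clock n y < c"
  by (rule order_tendstoD(2)[OF C1_at_tendsto[OF C1_at_clock[OF assms(1)]] assms(2)])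

lemma eventually_jump_eq:
  assumes "x \<in> U" "clock n x < 1/2"
  shows "\<forall>\<^sub>F y in nhds x. (1 - step (phase n y)) *\<^sub>R (G (Suc n) y - G n y) = jump n y"
  using eventually_clock_less[OF assms] by eventually_elim (simp add: jump_def)

lemma eventually_jump_0:
  assumes x: "x \<in> U" and c: "\<not> clock n x < 1/2"
  shows "\<forall>\<^sub>F y in nhds x. 0 = jump n y"
proof -
  \<comment> \<open>Passages end at \<open>1/4 + 9/64\<close> at the latest, which is below 7/16, so
    the step already equals 1 near such a point.\<close>
  have "\<forall>\<^sub>F y in nhds x. 7/16 < clock n y"
    by (rule order_tendstoD(1)[OF C1_at_tendsto[OF C1_at_clock[OF x]]]) (use c in simp)
  then show ?thesis
  proof eventually_elim
    case (elim y)
    show ?case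
    proof (cases "clock n y < 1/2")
      case True
      have "0 < thickness n y" "thickness n y \<le> 9/64" using clock_anchored[OF True] by metis+
      then have "1 \<le> phase n y" using elim by (simp add: phase_def le_divide_eq)
      then show ?thesis by (simp add: jump_def)
    qed (simp add: jump_def)
  qed
qed

lemma C1_at_jump:
  assumes x: "x \<in> U" shows "C1_at (\<lambda>y. jump n y) x"
proof (cases "clock n x < 1/2")
  case True
  then have "anchored n x" "anchored (Suc n) x" using clock_anchored[of n x] by metis+
  then show ?thesis
    by (intro C1_at_cong[OF C1_at_scaleR eventually_jump_eq[OF x True]] C1_at_diff C1_at_const C1_at_step C1_at_phase
      C1_at_G x True)
next
  case False
  show ?thesis by (rule C1_at_cong[OF C1_at_const eventually_jump_0[OF x False]])
qed

lemma C1_at_glue: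
  assumes x: "x \<in> U" shows "C1_at glue x"
proof -
  let ?m = "stage x"
  have c: "clock ?m x < 1/2" using stage[OF x] by linarith
  have a: "anchored ?m x" using clock_anchored[OF c] by metis
  have "\<forall>\<^sub>F y in nhds x. G ?m y - (\<Sum>k<?m. jump k y) = glue y"
    using eventually_clock_less[OF x stage[OF x]] by eventually_elim (simp add: glue_eq)
  then show ?thesis
    by (rule C1_at_cong[rotated]) (intro C1_at_diff C1_at_sum C1_at_jump C1_at_G a x)
qed

lemma jump_derivative:
  assumes x: "x \<in> U" and c: "clock n x < 1/2"
    and D: "(G n has_derivative A) (at x)" "(G (Suc n) has_derivative B) (at x)" "(phase n has_derivative P) (at x)"
  shows "(jump n has_derivative (\<lambda>h. (1 - step (phase n x)) *\<^sub>R (B h - A h)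
    - (step_deriv (phase n x) * P h) *\<^sub>R (G (Suc n) x - G n x))) (at x)"
proof -
  have "((\<lambda>y. step (phase n y)) has_derivative (\<lambda>h. P h * step_deriv (phase n x))) (at x)"
    using has_derivative_compose[OF D(3) step_derivative[unfolded has_field_derivative_def]]
    by (simp add: mult.commute)
  then have "((\<lambda>y. (1 - step (phase n y)) *\<^sub>R (G (Suc n) y - G n y)) has_derivative
    (\<lambda>h. (1 - step (phase n x)) *\<^sub>R (B h - A h) + (0 - P h * step_deriv (phase n x)) *\<^sub>R (G (Suc n) x - G n x))) (at x)"
    by (intro has_derivative_scaleR has_derivative_diff has_derivative_const D)
  then have "((\<lambda>y. (1 - step (phase n y)) *\<^sub>R (G (Suc n) y - G n y)) has_derivative (\<lambda>h. (1 - step (phase n x)) *\<^sub>R (B h - A h)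
    - (step_deriv (phase n x) * P h) *\<^sub>R (G (Suc n) x - G n x))) (at x)"
    by (simp add: mult.commute scaleR_minus_left)
  then show ?thesis
    by (rule has_derivative_transform_eventually)
      (use eventually_jump_eq[OF x c] eventually_nhds_x_imp_x[OF eventually_jump_eq[OF x c]] in \<open>auto simp: eventually_at_filter elim: eventually_mono\<close>)
qed

text \<open>Only a current index can have a nonzero jump. At the first such index the earlier jumps
  vanish to first order, and the clock at its successor is below 1/4, so a single passage describes
  \<open>glue\<close>.\<close>

definition current :: "nat \<Rightarrow> 'a \<Rightarrow> bool" where
  "current n x \<longleftrightarrow> clock n x < 1/2 \<and> clock n x < 1/4 + thickness n x"

lemma jump_flat:
  assumes x: "x \<in> U" and n: "\<not> current n x"
  shows "jump n x = 0" "(jump n has_derivative (\<lambda>_. 0)) (at x)"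
proof -
  have "jump n x = 0 \<and> (jump n has_derivative (\<lambda>_. 0)) (at x)"
  proof (cases "clock n x < 1/2")
    case True
    then have a: "anchored n x" "anchored (Suc n) x" "0 < thickness n x" using clock_anchored[of n x] by metis+
    then have p: "1 \<le> phase n x" using n True by (simp add: phase_def current_def le_divide_eq not_less)
    obtain A B P where D: "(G n has_derivative blinfun_apply A) (at x)" "(G (Suc n) has_derivative blinfun_apply B) (at x)"
      "(phase n has_derivative blinfun_apply P) (at x)"
      using C1_at_derivative[OF C1_at_G[OF a(1)]] C1_at_derivative[OF C1_at_G[OF a(2)]]
        C1_at_derivative[OF C1_at_phase[OF x True]] by metis
    show ?thesis using jump_derivative[OF x True D] p by (simp add: step_deriv_eq_0 jump_def)
  next
    case False
    note ev = eventually_jump_0[OF x False]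
    have "(jump n has_derivative (\<lambda>_. 0)) (at x)"
      by (rule has_derivative_transform_eventually[OF has_derivative_const[of 0]])
        (use ev eventually_nhds_x_imp_x[OF ev] in \<open>auto simp: eventually_at_filter elim: eventually_mono\<close>)
    then show ?thesis using eventually_nhds_x_imp_x[OF ev] by simp
  qed
  then show "jump n x = 0" "(jump n has_derivative (\<lambda>_. 0)) (at x)" by auto
qed

lemma ex_current: assumes "x \<in> U" obtains n where "current n x" "\<And>k. k < n \<Longrightarrow> \<not> current k x"
proof -
  have c: "clock (stage x) x < 1/2" using stage[OF assms] by linarith
  have "0 < thickness (stage x) x" using clock_anchored[OF c] by metis
  then have "current (stage x) x" using c stage[OF assms] unfolding current_def by linarith
  then show ?thesis using that[of "LEAST n. current n x"] LeastI[of "\<lambda>n. current n x"] not_less_Least by blast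
qed

lemma glue_local:
  assumes x: "x \<in> U" and n: "current n x" "\<And>k. k < n \<Longrightarrow> \<not> current k x"
    and D: "(G n has_derivative A) (at x)" "(G (Suc n) has_derivative B) (at x)" "(phase n has_derivative P) (at x)"
  shows "glue x = G n x + step (phase n x) *\<^sub>R (G (Suc n) x - G n x)"
    "(glue has_derivative (\<lambda>h. A h + step (phase n x) *\<^sub>R (B h - A h)
      + (step_deriv (phase n x) * P h) *\<^sub>R (G (Suc n) x - G n x))) (at x)"
proof -
  have c: "clock n x < 1/2" using n(1) by (simp add: current_def)
  have "0 < (1/2 :: real) ^ n" by simp
  then have c': "clock (Suc n) x < 1/4" using clock_decreases[OF c] n(1) unfolding current_def by linarith
  have "(\<Sum>k<Suc n. jump k x) = jump n x" using jump_flat(1)[OF x n(2)] by simp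
  then have "glue x = G (Suc n) x - (1 - step (phase n x)) *\<^sub>R (G (Suc n) x - G n x)"
    using glue_eq[OF c'] c by (simp add: jump_def)
  then show "glue x = G n x + step (phase n x) *\<^sub>R (G (Suc n) x - G n x)" by (simp add: algebra_simps)
  have ev: "\<forall>\<^sub>F y in nhds x. G (Suc n) y - (\<Sum>k<Suc n. jump k y) = glue y"
    using eventually_clock_less[OF x c'] by eventually_elim (simp add: glue_eq)
  let ?J = "\<lambda>h. (1 - step (phase n x)) *\<^sub>R (B h - A h) - (step_deriv (phase n x) * P h) *\<^sub>R (G (Suc n) x - G n x)"
  have "((\<lambda>y. G (Suc n) y - ((\<Sum>k<n. jump k y) + jump n y)) has_derivative (\<lambda>h. B h - ((\<Sum>k<n. 0) + ?J h))) (at x)"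
    by (intro has_derivative_diff has_derivative_add has_derivative_sum D(2) jump_derivative[OF x c D] jump_flat(2)[OF x n(2)]) auto
  then have "((\<lambda>y. G (Suc n) y - (\<Sum>k<Suc n. jump k y)) has_derivative (\<lambda>h. B h - ((\<Sum>k<n. 0) + ?J h))) (at x)"
    by simp
  then have "(glue has_derivative (\<lambda>h. B h - ((\<Sum>k<n. 0) + ?J h))) (at x)"
    by (rule has_derivative_transform_eventually)
      (use ev eventually_nhds_x_imp_x[OF ev] in \<open>auto simp: eventually_at_filter elim: eventually_mono\<close>)
  then show "(glue has_derivative (\<lambda>h. A h + step (phase n x) *\<^sub>R (B h - A h)
      + (step_deriv (phase n x) * P h) *\<^sub>R (G (Suc n) x - G n x))) (at x)"
    by (simp add: algebra_simps)
qed

section \<open>Distance of the stages and of the glued map from f\<close>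

lemma G_close:
  assumes n: "anchored n x" shows "\<bar>G n x $ l - f x $ l\<bar> \<le> 28 * \<beta> n x"
proof -
  have p: "\<eta> (proj n x) > 0" using anchored_pos[OF n] by blast
  have t: "norm (x - proj n x) \<le> 5/2 * \<eta> (proj n x)" using n by (simp add: anchored_def)
  have "\<bar>aff x x $ l - aff (proj n x) x $ l\<bar> \<le> 3 * \<epsilon> (proj n x) * norm (x - proj n x)"
    by (rule aff_Lipschitz[OF n]) (use t p in auto)
  also have "\<dots> \<le> 3 * \<epsilon> (proj n x) * (5/2 * \<eta> (proj n x))" using t \<epsilon>(3) by (intro mult_left_mono) auto
  finally have "\<bar>f x $ l - aff (proj n x) x $ l\<bar> \<le> 15/2 * \<beta> n x" by (simp add: blinfun.zero_right)
  moreover have "0 \<le> \<beta> n x" using \<epsilon>(3) p by simp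
  ultimately show ?thesis using filt_bounds[OF n order_refl, of l] unfolding G_def vec_lambda_beta by linarith
qed

lemma G_derivative_close:
  assumes n: "anchored n x" and D: "(G n has_derivative D) (at x)"
  shows "\<bar>D h $ l - f' x h $ l\<bar> \<le> 300 * \<epsilon> (proj n x) * norm h"
proof -
  have "((\<lambda>y. G n y $ l - f' x y $ l) has_derivative (\<lambda>h. D h $ l - f' x h $ l)) (at x)"
    by (intro has_derivative_diff bounded_linear.has_derivative[OF bounded_linear_vec_nth D]
        bounded_linear_imp_has_derivative bounded_linear_compose[OF bounded_linear_vec_nth] blinfun.bounded_linear_right)
  moreover have "calm (\<lambda>y. G n y $ l - f' x y $ l) x (300 * \<epsilon> (proj n x))"
    using calm_filt[OF n order_refl, of l] by (simp add: G_def)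
  ultimately show ?thesis using calm_derivative by fastforce
qed

text \<open>Outside the passage the step is flat. Inside, the numerator is below the thickness, so
  clock and thickness contribute 10 and 3; the slope of \<open>step\<close> doubles the sum.\<close>

lemma phase_derivative_le:
  assumes x: "x \<in> U" and c: "clock n x < 1/2" and P: "(phase n has_derivative P) (at x)"
  shows "\<bar>step_deriv (phase n x) * P h\<bar> \<le> 26 / (\<eta> (proj n x) * thickness n x) * norm h"
proof (cases "phase n x \<le> 0 \<or> 1 \<le> phase n x")
  case True
  have "0 < thickness n x" "0 < \<eta> (proj n x)" using clock_anchored[OF c] by metis+
  then show ?thesis using step_deriv_eq_0[OF True] by simp
next
  case False
  obtain i where a: "anchored n x" "anchored (Suc n) x" "0 < thickness n x" "0 < \<eta> (proj n x)"
    using clock_anchored[OF c] by metis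
  let ?z = "thickness n x" and ?h = "\<eta> (proj n x)"
  have s: "0 < clock n x - 1/4" "clock n x - 1/4 < ?z"
    using False a(3) by (auto simp: phase_def divide_le_0_iff le_divide_eq not_le zero_less_divide_iff split: if_splits)
  have "calm (\<lambda>y. clock n y - 1/4) x (10 / ?h + 0)" by (intro calm_diff calm_clock x c calm_const order_refl)
  then have "calm (\<lambda>y. clock n y - 1/4) x (10 / ?h)" by simp
  from calm_divide[OF C1_at_diff[OF C1_at_clock[OF x] C1_at_const] this C1_at_thickness[OF a(1,2)] calm_thickness[OF a(1,2)] a(3)]
  have cp: "calm (phase n) x (10 / ?h / ?z + \<bar>clock n x - 1/4\<bar> * (3 / ?h) / ?z\<^sup>2)" by (simp add: phase_def[abs_def])
  have "\<bar>clock n x - 1/4\<bar> * (3 / ?h) / ?z\<^sup>2 \<le> ?z * (3 / ?h) / ?z\<^sup>2"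
    using s a by (intro divide_right_mono mult_right_mono) auto
  also have "\<dots> = 3 / ?h / ?z" using a by (simp add: power2_eq_square)
  finally have "10 / ?h / ?z + \<bar>clock n x - 1/4\<bar> * (3 / ?h) / ?z\<^sup>2 \<le> 13 / (?h * ?z)" by (simp add: field_simps)
  from calm_derivative[OF P calm_mono[OF cp this], of h]
  have P: "\<bar>P h\<bar> \<le> 13 / (?h * ?z) * norm h" by simp
  have "\<bar>step_deriv (phase n x) * P h\<bar> \<le> 2 * (13 / (?h * ?z) * norm h)"
    unfolding abs_mult using step_deriv_bounds[of "phase n x"] P by (intro mult_mono) auto
  then show ?thesis by simp
qed

lemma convex_close:
  fixes u v :: real
  assumes "\<bar>u\<bar> \<le> c" "\<bar>v\<bar> \<le> c" "0 \<le> t" "t \<le> 1" shows "\<bar>u + t * (v - u)\<bar> \<le> c"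
proof -
  have "u + t * (v - u) = (1 - t) * u + t * v" by (simp add: algebra_simps)
  also have "\<bar>\<dots>\<bar> \<le> (1 - t) * \<bar>u\<bar> + t * \<bar>v\<bar>"
    using assms by (intro order_trans[OF abs_triangle_ineq]) (simp add: abs_mult)
  also have "\<dots> \<le> (1 - t) * c + t * c" using assms by (intro add_mono mult_left_mono) auto
  finally show ?thesis by (simp add: algebra_simps)
qed

text \<open>Locally \<open>glue\<close> is a convex combination of two stages, and its derivative
  has one additional rank-one term. One power of the dimension comes from \<open>rate\<close>, the
  other from bounding the Euclidean norm by the sum of the components.\<close>

lemma glue_close:
  assumes x: "x \<in> U"
  shows "norm (f x - glue x) \<le> 20000 * (real CARD('d))\<^sup>2 * \<epsilon> x"
    and "(glue has_derivative blinfun_apply D) (at x) \<Longrightarrow> norm (f' x - D) \<le> 20000 * (real CARD('d))\<^sup>2 * \<epsilon> x"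
proof -
  let ?c = "real CARD('d)"
  obtain n where n: "current n x" "\<And>k. k < n \<Longrightarrow> \<not> current k x" using ex_current[OF x] by blast
  have c: "clock n x < 1/2" using n(1) by (simp add: current_def)
  obtain i where a: "anchored n x" "anchored (Suc n) x" "0 < thickness n x" "0 < \<eta> (proj n x)"
    using clock_anchored[OF c] by metis
  obtain A B P where AB: "(G n has_derivative blinfun_apply A) (at x)" "(G (Suc n) has_derivative blinfun_apply B) (at x)"
    "(phase n has_derivative blinfun_apply P) (at x)"
    using C1_at_derivative[OF C1_at_G[OF a(1)]] C1_at_derivative[OF C1_at_G[OF a(2)]]
      C1_at_derivative[OF C1_at_phase[OF x c]] by metis
  note loc = glue_local[OF x n AB]
  let ?t = "step (phase n x)" and ?e = "\<epsilon> (proj n x)"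
  have t: "0 \<le> ?t" "?t \<le> 1" by (rule step_bounds)+
  have e: "0 \<le> ?e" "?e \<le> 5/4 * \<epsilon> x" using \<epsilon>(3) later_compare(6)[OF a(1) order_refl] by auto
  have card: "1 \<le> ?c" using zero_less_card_finite[where 'a='d] by linarith
  have b: "\<beta> (Suc n) x \<le> 2 * \<beta> n x" "0 \<le> \<beta> n x" "\<epsilon> (proj (Suc n) x) \<le> 5/4 * ?e"
    using later_compare(1,3)[OF a(1) le_SucI[OF order_refl]] \<epsilon>(3) \<eta>(3) by auto
  show "norm (f x - glue x) \<le> 20000 * ?c\<^sup>2 * \<epsilon> x"
  proof -
    have "\<bar>(f x - glue x) $ l\<bar> \<le> 70 * \<epsilon> x" for l
    proof -
      have "\<bar>G n x $ l - f x $ l\<bar> \<le> 56 * \<beta> n x" "\<bar>G (Suc n) x $ l - f x $ l\<bar> \<le> 56 * \<beta> n x"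
        using G_close[OF a(1), of l] G_close[OF a(2), of l] b by linarith+
      from convex_close[OF this t] have "\<bar>(f x - glue x) $ l\<bar> \<le> 56 * \<beta> n x"
        by (simp add: loc(1) algebra_simps abs_minus_commute)
      also have "\<dots> \<le> 56 * (?e * 1)" using \<eta>(5) e by (intro mult_left_mono) auto
      finally show ?thesis using e by linarith
    qed
    then have "(\<Sum>l\<in>UNIV. \<bar>(f x - glue x) $ l\<bar>) \<le> ?c * (70 * \<epsilon> x)"
      using sum_bounded_above[of UNIV "\<lambda>l. \<bar>(f x - glue x) $ l\<bar>" "70 * \<epsilon> x"] by simp
    moreover have "?c * (70 * \<epsilon> x) \<le> 20000 * ?c\<^sup>2 * \<epsilon> x"
    proof -
      have "?c * 70 \<le> ?c * (20000 * ?c)" by (rule mult_left_mono) (use card in linarith)+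
      then have "?c * 70 \<le> 20000 * ?c\<^sup>2" by (simp only: power2_eq_square ac_simps)
      from mult_right_mono[OF this \<epsilon>(3)[of x]] show ?thesis by (simp add: ac_simps)
    qed
    ultimately show ?thesis using norm_le_l1_cart[of "f x - glue x"] by linarith
  qed
  assume D: "(glue has_derivative blinfun_apply D) (at x)"
  show "norm (f' x - D) \<le> 20000 * ?c\<^sup>2 * \<epsilon> x"
  proof (rule norm_blinfun_bound)
    fix h
    have Dh: "D h = A h + ?t *\<^sub>R (B h - A h) + (step_deriv (phase n x) * P h) *\<^sub>R (G (Suc n) x - G n x)"
      using fun_cong[OF has_derivative_unique[OF D loc(2)]] .
    have "\<bar>(f' x - D) h $ l\<bar> \<le> 20000 * ?c * \<epsilon> x * norm h" for l
    proof -
      have "\<bar>A h $ l - f' x h $ l\<bar> \<le> 375 * ?e * norm h" "\<bar>B h $ l - f' x h $ l\<bar> \<le> 375 * ?e * norm h"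
      proof -
        have "300 * ?e * norm h \<le> 375 * ?e * norm h" "300 * \<epsilon> (proj (Suc n) x) * norm h \<le> 375 * ?e * norm h"
          using e b by (intro mult_right_mono; simp)+
        then show "\<bar>A h $ l - f' x h $ l\<bar> \<le> 375 * ?e * norm h" "\<bar>B h $ l - f' x h $ l\<bar> \<le> 375 * ?e * norm h"
          using G_derivative_close[OF a(1) AB(1), of h l] G_derivative_close[OF a(2) AB(2), of h l] by linarith+
      qed
      from convex_close[OF this t]
      have 1: "\<bar>A h $ l - f' x h $ l + ?t * (B h $ l - A h $ l)\<bar> \<le> 375 * ?e * norm h" by simp
      \<comment> \<open>The thickness cancels between the slope of the phase and the size of the
        step: 26 * 2 * 280 = 14560.\<close>
      have "\<bar>step_deriv (phase n x) * P h\<bar> * \<bar>G (Suc n) x $ l - G n x $ l\<bar>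
        \<le> (26 / (\<eta> (proj n x) * thickness n x) * norm h) * (2 * \<beta> n x / rate * thickness n x)"
        using phase_derivative_le[OF x c AB(3), of h] step_le_thickness[OF a(1,2), of l] a
        by (intro mult_mono) (auto simp: G_def)
      also have "\<dots> = 14560 * ?c * ?e * norm h" using a by (simp add: rate_def)
      finally have 2: "\<bar>step_deriv (phase n x) * P h * (G (Suc n) x $ l - G n x $ l)\<bar> \<le> 14560 * ?c * ?e * norm h"
        by (simp add: abs_mult)
      have "\<bar>(f' x - D) h $ l\<bar> \<le> 375 * ?e * norm h + 14560 * ?c * ?e * norm h"
        using 1 2 by (simp add: Dh blinfun.diff_left)
      also have "\<dots> \<le> 375 * (?c * ?e * norm h) + 14560 * ?c * ?e * norm h"
        using mult_right_mono[OF card, of "?e * norm h"] e by (simp add: ac_simps)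
      also have "\<dots> = 14935 * ?c * (?e * norm h)" by simp
      also have "\<dots> \<le> 14935 * ?c * ((5/4 * \<epsilon> x) * norm h)"
        using e by (intro mult_left_mono mult_right_mono) auto
      also have "\<dots> = 74675/4 * (?c * \<epsilon> x * norm h)" by simp
      also have "\<dots> \<le> 20000 * (?c * \<epsilon> x * norm h)" using \<epsilon>(3) by (intro mult_right_mono) auto
      finally show ?thesis by simp
    qed
    then have "(\<Sum>l\<in>UNIV. \<bar>(f' x - D) h $ l\<bar>) \<le> ?c * (20000 * ?c * \<epsilon> x * norm h)"
      using sum_bounded_above[of UNIV "\<lambda>l. \<bar>(f' x - D) h $ l\<bar>"] by simp
    then show "norm ((f' x - D) h) \<le> 20000 * ?c\<^sup>2 * \<epsilon> x * norm h"
      using norm_le_l1_cart[of "(f' x - D) h"] by (simp add: power2_eq_square ac_simps)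
  qed (simp add: \<epsilon>(3))
qed

end

context filter_data
begin

section \<open>Critical points\<close>

definition tail_type :: "nat \<Rightarrow> 'a \<Rightarrow> bool" where
  "tail_type N x \<longleftrightarrow> (\<exists>r>0. \<forall>m\<ge>N. blinfun_apply (L x) (e m) = r *\<^sub>R w (e m))"

lemma tail_type_mono: "tail_type N x \<Longrightarrow> N \<le> N' \<Longrightarrow> tail_type N' x"
  unfolding tail_type_def by (meson order_trans)

text \<open>\<open>L\<close> has uniform tails only near points of \<open>U\<close>. If
  \<open>proj j x\<close> lies outside, its scale is 0 and the premise fails near \<open>x\<close>:
  either the gap is positive, or \<open>proj k x\<close> is that same outside point, differs from
  \<open>x\<close>, and cannot anchor.\<close>

lemma ex_tail_pair:
  assumes x: "x \<in> U"
  shows "\<exists>N. \<forall>\<^sub>F y in nhds x. anchored k y \<and> gap j k y < 5 * \<eta> (proj j y) \<longrightarrow> tail_type N (proj j y)"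
proof (cases "proj j x \<in> U")
  case True
  from L_tail[OF True] obtain N where "\<forall>\<^sub>F z in nhds (proj j x). tail_type N z"
    unfolding tail_type_def by blast
  then have "\<forall>\<^sub>F y in nhds x. tail_type N (proj j y)"
    using proj_tendsto_nhds[of j x] unfolding filterlim_iff by blast
  then show ?thesis by (intro exI[of _ N]) (auto elim: eventually_mono)
next
  case False
  then have 0: "\<eta> (proj j x) = 0" using \<eta>(3)[of "proj j x"] \<eta>(4)[of "proj j x"] by linarith
  have "\<forall>\<^sub>F y in nhds x. \<not> (anchored k y \<and> gap j k y < 5 * \<eta> (proj j y))"
  proof (cases "gap j k x = 0")
    case True
    then have k: "proj k x = proj j x" by simp
    with False x have "0 < norm (x - proj k x)" by auto
    then have pos: "0 < norm (x - proj k x) - 5/2 * \<eta> (proj k x)" by (simp add: k 0)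
    have "((\<lambda>y. norm (y - proj k y) - 5/2 * \<eta> (proj k y)) \<longlongrightarrow> norm (x - proj k x) - 5/2 * \<eta> (proj k x)) (nhds x)"
      by (intro tendsto_intros proj_tendsto_nhds \<eta>_proj_tendsto filterlim_ident)
    from order_tendstoD(1)[OF this pos] show ?thesis by eventually_elim (simp add: anchored_def)
  next
    case False
    then have pos: "0 < gap j k x - 5 * \<eta> (proj j x)" by (simp add: 0)
    have "((\<lambda>y. gap j k y - 5 * \<eta> (proj j y)) \<longlongrightarrow> gap j k x - 5 * \<eta> (proj j x)) (nhds x)"
      by (intro tendsto_diff tendsto_mult tendsto_const gap_tendsto \<eta>_proj_tendsto)
    from order_tendstoD(1)[OF this pos] show ?thesis by eventually_elim simp
  qed
  then show ?thesis by (intro exI[of _ 0]) (auto elim: eventually_mono)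
qed

lemma ex_tail_finite:
  assumes x: "x \<in> U" and S: "finite S"
  shows "\<exists>N. \<forall>\<^sub>F y in nhds x. \<forall>(j, k)\<in>S. anchored k y \<and> gap j k y < 5 * \<eta> (proj j y) \<longrightarrow> tail_type N (proj j y)"
  using S
proof (induction S)
  case (insert p S)
  obtain j k where p: "p = (j, k)" by fastforce
  obtain N where N: "\<forall>\<^sub>F y in nhds x. \<forall>(j, k)\<in>S. anchored k y \<and> gap j k y < 5 * \<eta> (proj j y) \<longrightarrow> tail_type N (proj j y)"
    using insert by blast
  obtain N' where N': "\<forall>\<^sub>F y in nhds x. anchored k y \<and> gap j k y < 5 * \<eta> (proj j y) \<longrightarrow> tail_type N' (proj j y)"
    using ex_tail_pair[OF x] by blast
  from N N' show ?case
    by (intro exI[of _ "max N N'"], eventually_elim)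
      (auto simp: p intro: tail_type_mono[of N _ "max N N'"] tail_type_mono[of N' _ "max N N'"])
qed simp

text \<open>One threshold \<open>N\<close> for all base points that enter a filter of resolution up
  to \<open>M\<close>, and hence for the stages, potentials and thickness built from them.\<close>

definition tails :: "nat \<Rightarrow> nat \<Rightarrow> 'a \<Rightarrow> bool" where
  "tails M N x \<longleftrightarrow> (\<forall>i k j. i \<le> k \<longrightarrow> k \<le> M \<longrightarrow> anchored k x \<longrightarrow> j \<in> window i k x \<longrightarrow> tail_type N (proj j x))"

lemma ex_tails:
  assumes x: "x \<in> U" shows "\<exists>N. \<forall>\<^sub>F y in nhds x. tails M N y"
proof -
  obtain N where "\<forall>\<^sub>F y in nhds x. \<forall>(j, k)\<in>{..M}\<times>{..M}.
      anchored k y \<and> gap j k y < 5 * \<eta> (proj j y) \<longrightarrow> tail_type N (proj j y)"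
    using ex_tail_finite[OF x, of "{..M} \<times> {..M}"] by auto
  then have "\<forall>\<^sub>F y in nhds x. tails M N y"
    unfolding tails_def window_def by eventually_elim force
  then show ?thesis ..
qed

lemma filt_const:
  assumes T: "tails M N x" and ik: "i \<le> k" "k \<le> M" "anchored k x" and m: "N \<le> m" "M \<le> m" and w: "w (e m) $ l = 0"
  shows "filt i k l (x + s *\<^sub>R e m) = filt i k l x"
proof (rule filt_basis_const)
  fix j assume "j \<in> window i k x"
  then have "tail_type N (proj j x)" using T ik unfolding tails_def by blast
  then obtain r where "blinfun_apply (L (proj j x)) (e m) = r *\<^sub>R w (e m)" using m unfolding tail_type_def by blast
  then show "L (proj j x) (e m) $ l = 0" using w by simp
qed (use ik m in auto)

lemma filt_derivative_pos:
  assumes T: "tails M N x" and k: "k \<le> M" "anchored k x" and m: "N \<le> m" "M \<le> m" and w: "w (e m) $ l > 0"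
    and D: "((\<lambda>y. filt k k l y) has_derivative D) (at x)"
  shows "D (e m) > 0"
proof -
  have pos: "L (proj j x) (e m) $ l > 0" if "j \<in> window k k x" for j
  proof -
    have "tail_type N (proj j x)" using T k that unfolding tails_def by blast
    then obtain r where "r > 0" "blinfun_apply (L (proj j x)) (e m) = r *\<^sub>R w (e m)" using m unfolding tail_type_def by blast
    then show ?thesis using w by simp
  qed
  obtain r where r: "r > 0" "\<And>j. j \<in> window k k x \<Longrightarrow> r \<le> L (proj j x) (e m) $ l"
    using finite_pos_lower_bound[OF finite_window, of k k x "\<lambda>j. L (proj j x) (e m) $ l"] pos by blast
  have "r \<le> D (e m)"
  proof (rule derivative_ge[OF D])
    show "\<forall>\<^sub>F s in at_right 0. s * r \<le> filt k k l (x + s *\<^sub>R e m) - filt k k l x"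
      using eventually_at_right_less[of 0]
    proof eventually_elim
      case (elim s)
      have "filt k k l x + s * r \<le> filt k k l (x + s *\<^sub>R e m)"
        by (rule filt_basis_grow[OF k(2) order_refl _ _ r(2)]) (use k m elim in auto)
      then show ?case by simp
    qed
  qed
  then show ?thesis using r by linarith
qed

lemma G_component_derivative:
  "(G n has_derivative D) (at x) \<Longrightarrow> ((\<lambda>y. filt n n l y) has_derivative (\<lambda>h. D h $ l)) (at x)"
  using bounded_linear.has_derivative[OF bounded_linear_vec_nth[of l], of "G n" D] by (simp add: G_def)

text \<open>Along \<open>e m\<close> the filters are constant, hence so is the thickness; the
  derivative of the phase is that of the clock divided by the thickness.\<close>

lemma phase_derivative_basis:
  assumes x: "x \<in> U" and n: "clock n x < 1/2" and T: "tails (Suc n) N x"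
    and m: "N \<le> m" "Suc n \<le> m" "w (e m) = 0" "coord x m \<noteq> 0" and P: "(phase n has_derivative P) (at x)"
  shows "P (e m) \<noteq> 0"
proof -
  obtain i where a: "anchored n x" "anchored (Suc n) x" "0 < thickness n x" using clock_anchored[OF n] by metis
  obtain S Z where SZ: "((\<lambda>y. clock n y) has_derivative blinfun_apply S) (at x)"
    "((\<lambda>y. thickness n y) has_derivative blinfun_apply Z) (at x)"
    using C1_at_derivative[OF C1_at_clock[OF x]] C1_at_derivative[OF C1_at_thickness[OF a(1,2)]] by metis
  have osc_const: "osc i k (x + s *\<^sub>R e m) = osc i k x"
    if "i \<le> k" "k \<le> Suc n" "anchored i x" "anchored k x" for i k s
    unfolding osc_def using that m T by (simp add: filt_const[OF T])
  have "S (e m) \<noteq> 0"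
    by (rule clock_basis_derivative[OF x n _ m(4) SZ(1)]) (use m osc_const in auto)
  moreover have "Z (e m) = 0"
  proof (rule derivative_0[OF SZ(2)])
    show "thickness n (x + s *\<^sub>R e m) = thickness n x" for s
      using osc_const[of n "Suc n" s] a m by (simp add: thickness_def proj_add_basis)
  qed
  moreover have "(phase n has_derivative (\<lambda>h. ((S h - 0) * thickness n x - (clock n x - 1/4) * Z h) / (thickness n x * thickness n x))) (at x)"
    unfolding phase_def[abs_def] using a(3)
    by (intro has_derivative_divide' has_derivative_diff SZ has_derivative_const) simp
  from has_derivative_unique[OF P this]
  have "P (e m) = ((S (e m) - 0) * thickness n x - (clock n x - 1/4) * Z (e m)) / (thickness n x * thickness n x)" by simp
  ultimately show ?thesis using a(3) by simp
qed

lemma not_surj_orthogonal: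
  fixes D :: "'b::real_vector \<Rightarrow> real ^ 'd"
  assumes "linear D" "\<not> surj D" obtains c where "c \<noteq> 0" "\<And>h. inner c (D h) = 0"
proof -
  have "span (range D) = range D" using assms(1) by (simp add: linear_subspace_image span_eq_iff)
  then obtain c where "c \<noteq> 0" "\<forall>v\<in>span (range D). inner c v = 0"
    using span_not_UNIV_orthogonal[of "range D"] assms(2) by metis
  then show ?thesis using that[of c] by (auto intro: span_base)
qed

lemma surj_glue_derivative:
  assumes x: "x \<in> U" and n: "current n x" "\<And>k. k < n \<Longrightarrow> \<not> current k x" and T: "tails (Suc n) N x"
    and m: "N \<le> m" "Suc n \<le> m" "w (e m) = 0" "coord x m \<noteq> 0"
    and w: "\<And>l. \<exists>m\<ge>max N (Suc n). w (e m) $ l > 0 \<and> (\<forall>k. k \<noteq> l \<longrightarrow> w (e m) $ k = 0)"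
    and D: "(glue has_derivative D) (at x)"
  shows "surj D"
proof (rule ccontr)
  assume "\<not> surj D"
  then obtain c where c: "c \<noteq> 0" "\<And>h. inner c (D h) = 0"
    using not_surj_orthogonal has_derivative_linear[OF D] by metis
  have cl: "clock n x < 1/2" using n(1) by (simp add: current_def)
  obtain i where a: "anchored n x" "anchored (Suc n) x" using clock_anchored[OF cl] by metis
  obtain A B P where AB: "(G n has_derivative blinfun_apply A) (at x)" "(G (Suc n) has_derivative blinfun_apply B) (at x)"
    "(phase n has_derivative blinfun_apply P) (at x)"
    using C1_at_derivative[OF C1_at_G[OF a(1)]] C1_at_derivative[OF C1_at_G[OF a(2)]]
      C1_at_derivative[OF C1_at_phase[OF x cl]] by metis
  let ?t = "step (phase n x)" and ?\<Delta> = "G (Suc n) x - G n x"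
  have Dh: "D h = A h + ?t *\<^sub>R (B h - A h) + (step_deriv (phase n x) * P h) *\<^sub>R ?\<Delta>" for h
    using fun_cong[OF has_derivative_unique[OF D glue_local(2)[OF x n AB]]] .
  have AB0: "A (e q) $ l = 0 \<and> B (e q) $ l = 0" if q: "N \<le> q" "Suc n \<le> q" "w (e q) $ l = 0" for q l
    using derivative_0[OF G_component_derivative[OF AB(1)]] derivative_0[OF G_component_derivative[OF AB(2)]]
      filt_const[OF T] a q by simp
  have "A (e m) = 0" "B (e m) = 0" using AB0[of m] m by (simp_all add: vec_eq_iff)
  then have "(step_deriv (phase n x) * P (e m)) * inner c ?\<Delta> = 0" using c(2)[of "e m"] by (simp add: Dh)
  moreover have "P (e m) \<noteq> 0" by (rule phase_derivative_basis[OF x cl T m AB(3)])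
  ultimately have "step_deriv (phase n x) * inner c ?\<Delta> = 0" by auto
  \<comment> \<open>Either the step is flat at \<open>x\<close> or the increment is orthogonal to
    \<open>c\<close>; in both cases the rank-one term disappears for every direction, including
    those used next.\<close>
  then have K: "inner c ((step_deriv (phase n x) * P h) *\<^sub>R ?\<Delta>) = 0" for h by auto
  have cD: "inner c (A h + ?t *\<^sub>R (B h - A h)) = 0" for h
    using c(2)[of h] unfolding Dh inner_add_right K by simp
  have "c $ l = 0" for l
  proof -
    obtain q where q: "N \<le> q" "Suc n \<le> q" "w (e q) $ l > 0" "\<And>k. k \<noteq> l \<Longrightarrow> w (e q) $ k = 0" using w[of l] by auto
    have pos: "A (e q) $ l > 0" "B (e q) $ l > 0"
      using filt_derivative_pos[OF T _ a(1) q(1,2,3) G_component_derivative[OF AB(1)]]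
        filt_derivative_pos[OF T _ a(2) q(1,2,3) G_component_derivative[OF AB(2)]] by auto
    let ?v = "A (e q) + ?t *\<^sub>R (B (e q) - A (e q))"
    have "?v $ k = 0" if "k \<noteq> l" for k using AB0[OF q(1,2) q(4)[OF that]] by simp
    then have "inner c ?v = (\<Sum>k\<in>UNIV. if k = l then c $ l * ?v $ l else 0)"
      unfolding inner_vec_def by (intro sum.cong) auto
    then have "c $ l * ?v $ l = 0" using cD[of "e q"] by simp
    moreover have "?v $ l > 0"
    proof -
      \<comment> \<open>Both stages increase in this direction, so each convex combination does,
        including the endpoints.\<close>
      have "?v $ l = (1 - ?t) * A (e q) $ l + ?t * B (e q) $ l" by (simp add: algebra_simps)
      moreover have "0 \<le> ?t" "?t \<le> 1" by (rule step_bounds)+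
      ultimately show ?thesis using pos by (cases "?t = 1") (auto intro: add_pos_nonneg)
    qed
    ultimately show ?thesis by simp
  qed
  then show False using c(1) by (simp add: vec_eq_iff)
qed

lemma critical_points_vanish:
  assumes w: "\<And>l q. \<exists>m\<ge>q. w (e m) $ l > 0 \<and> (\<forall>k. k \<noteq> l \<longrightarrow> w (e m) $ k = 0)" and x: "x \<in> U"
  obtains q where "\<forall>\<^sub>F y in nhds x. \<forall>D. (glue has_derivative D) (at y) \<longrightarrow> \<not> surj D \<longrightarrow>
    y \<in> vanishing {m. q \<le> m \<and> w (e m) = 0}"
proof -
  let ?M = "stage x"
  obtain N where "\<forall>\<^sub>F y in nhds x. tails (Suc ?M) N y" using ex_tails[OF x] by blast
  moreover have "\<forall>\<^sub>F y in nhds x. y \<in> U" using x U by (rule eventually_nhds_in_open[rotated])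
  ultimately have "\<forall>\<^sub>F y in nhds x. \<forall>D. (glue has_derivative D) (at y) \<longrightarrow> \<not> surj D \<longrightarrow>
      y \<in> vanishing {m. max N (Suc ?M) \<le> m \<and> w (e m) = 0}"
    using eventually_clock_less[OF x stage[OF x]]
  proof eventually_elim
    case (elim y)
    have s: "stage y \<le> ?M" unfolding stage_def[of y] using elim(3) by (rule Least_le)
    obtain n where n: "current n y" "\<And>k. k < n \<Longrightarrow> \<not> current k y" "n \<le> ?M"
    proof -
      \<comment> \<open>The clock at \<open>?M\<close> stays below 1/4 near \<open>x\<close>, so
        \<open>?M\<close> is current at \<open>y\<close> and the first current index is at most
        \<open>?M\<close>. A single tail threshold therefore serves all nearby points.\<close>
      have c: "clock ?M y < 1/2" using elim(3) by linarith
      have "0 < thickness ?M y" using clock_anchored[OF c] by metis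
      then have "current ?M y" using c elim(3) unfolding current_def by linarith
      then show ?thesis using that ex_current[OF elim(2)] by (metis not_le)
    qed
    have T: "tails (Suc n) N y" using elim(1) n(3) unfolding tails_def by (meson Suc_le_mono order_trans)
    show ?case
    proof (intro allI impI, rule ccontr)
      fix D assume D: "(glue has_derivative D) (at y)" "\<not> surj D"
        and "y \<notin> vanishing {m. max N (Suc ?M) \<le> m \<and> w (e m) = 0}"
      then obtain m where "N \<le> m" "Suc ?M \<le> m" "w (e m) = 0" "coord y m \<noteq> 0" by (auto simp: vanishing_def)
      then have m: "N \<le> m" "Suc n \<le> m" "w (e m) = 0" "coord y m \<noteq> 0" using n(3) by auto
      have "surj D" by (rule surj_glue_derivative[OF elim(2) n(1,2) T m w D(1)])
      then show False using D(2) by simp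
    qed
  qed
  then show ?thesis by (rule that)
qed

end

section \<open>Choice of the data\<close>

context smooth_basis
begin

text \<open>Residue classes modulo the dimension plus one: each axis receives one class, and on the
  remaining class \<open>w\<close> vanishes.\<close>

lemma ex_directions:
  obtains w :: "'a \<Rightarrow>\<^sub>L (real ^ 'd)" where "\<And>q. \<exists>m\<ge>q. w (e m) = 0"
    "\<And>l q. \<exists>m\<ge>q. w (e m) $ l > 0 \<and> (\<forall>k. k \<noteq> l \<longrightarrow> w (e m) $ k = 0)"
proof -
  let ?c = "CARD('d)"
  obtain h :: "'d \<Rightarrow> nat" where h: "bij_betw h UNIV {0..<?c}" using ex_bij_betw_finite_nat[of "UNIV :: 'd set"] by auto
  have hc: "h l < ?c" for l using h by (auto dest: bij_betwE)
  define A where "A r = {m. m mod (?c + 1) = r}" for r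
  have "\<exists>\<phi> :: 'a \<Rightarrow>\<^sub>L real. (\<forall>m\<in>A r. \<phi> (e m) > 0) \<and> (\<forall>m. m \<notin> A r \<longrightarrow> \<phi> (e m) = 0)" for r
    by (rule ex_functional[of "A r"]) auto
  then obtain \<phi> :: "nat \<Rightarrow> 'a \<Rightarrow>\<^sub>L real" where
    \<phi>: "\<And>r m. m \<in> A r \<Longrightarrow> \<phi> r (e m) > 0" "\<And>r m. m \<notin> A r \<Longrightarrow> \<phi> r (e m) = 0" by metis
  define W where "W x = (\<Sum>l\<in>UNIV. \<phi> (h l) x *\<^sub>R axis l (1 :: real))" for x
  have "bounded_linear W"
    unfolding W_def
    by (intro bounded_linear_sum bounded_linear_compose[OF bounded_linear_scaleR_left blinfun.bounded_linear_right])
  then have W: "blinfun_apply (Blinfun W) x $ l = \<phi> (h l) x" for x l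
    by (simp add: bounded_linear_Blinfun_apply W_def axis_def if_distrib cong: if_cong)
  have res: "\<exists>m\<ge>q. m \<in> A r \<and> (\<forall>s. s \<noteq> r \<longrightarrow> m \<notin> A s)" if "r \<le> ?c" for q r
  proof -
    have "(q * (?c + 1) + r) mod (?c + 1) = r" unfolding mod_mult_self3 using that by simp
    then show ?thesis by (intro exI[of _ "q * (?c + 1) + r"]) (auto simp: A_def)
  qed
  show ?thesis
  proof (rule that[of "Blinfun W"])
    fix q
    obtain m where "m \<ge> q" "\<forall>s. s \<noteq> ?c \<longrightarrow> m \<notin> A s" using res[of ?c q] by auto
    then have "Blinfun W (e m) $ l = 0" for l unfolding W using hc[of l] \<phi>(2)[of m "h l"] by auto
    then show "\<exists>m\<ge>q. Blinfun W (e m) = 0" using \<open>m \<ge> q\<close> by (auto simp: vec_eq_iff)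
  next
    fix l q
    obtain m where m: "m \<ge> q" "m \<in> A (h l)" "\<forall>s. s \<noteq> h l \<longrightarrow> m \<notin> A s" using res[of "h l" q] hc[of l] by auto
    have "h k \<noteq> h l" if "k \<noteq> l" for k using h that by (auto simp: bij_betw_def inj_on_def)
    then have "\<forall>k. k \<noteq> l \<longrightarrow> Blinfun W (e m) $ k = 0" unfolding W using \<phi>(2) m(3) by blast
    moreover have "Blinfun W (e m) $ l > 0" unfolding W using \<phi>(1) m(2) by blast
    ultimately show "\<exists>m\<ge>q. Blinfun W (e m) $ l > 0 \<and> (\<forall>k. k \<noteq> l \<longrightarrow> Blinfun W (e m) $ k = 0)"
      using m(1) by blast
  qed
qed

text \<open>The sets \<open>T N\<close> increase with \<open>N\<close> and are convex, because
  positive multipliers survive convex combinations. Finitely many operators share one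
  \<open>N\<close>, and so does their convex hull, where \<open>L\<close> takes its values
  locally.\<close>

lemma ex_tail_proportional_approx:
  fixes F :: "'a \<Rightarrow> 'a \<Rightarrow>\<^sub>L (real ^ 'd)" and w :: "'a \<Rightarrow>\<^sub>L (real ^ 'd)" and \<epsilon> :: "'a \<Rightarrow> real"
  assumes U: "open U" and F: "continuous_on U F" and \<epsilon>: "continuous_on U \<epsilon>" "\<forall>x\<in>U. \<epsilon> x > 0"
  obtains L where "\<And>x. x \<in> U \<Longrightarrow> C1_at L x" "\<And>x. x \<in> U \<Longrightarrow> norm (L x - F x) \<le> \<epsilon> x"
    "\<And>x. x \<in> U \<Longrightarrow> \<exists>N. \<forall>\<^sub>F y in nhds x. \<exists>r>0. \<forall>m\<ge>N. blinfun_apply (L y) (e m) = r *\<^sub>R w (e m)"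
proof -
  define T where "T N = {S :: 'a \<Rightarrow>\<^sub>L (real ^ 'd). \<exists>r>0. \<forall>m\<ge>N. blinfun_apply S (e m) = r *\<^sub>R w (e m)}" for N :: nat
  have T_mono: "T N \<subseteq> T N'" if "N \<le> N'" for N N' using that unfolding T_def by (auto intro: order_trans)
  have T_convex: "convex (T N)" for N
  proof (rule convexI)
    fix R S :: "'a \<Rightarrow>\<^sub>L (real ^ 'd)" and u v :: real
    assume "R \<in> T N" "S \<in> T N" and uv: "0 \<le> u" "0 \<le> v" "u + v = 1"
    then obtain r s where rs: "r > 0" "s > 0" "\<And>m. m \<ge> N \<Longrightarrow> R (e m) = r *\<^sub>R w (e m)" "\<And>m. m \<ge> N \<Longrightarrow> S (e m) = s *\<^sub>R w (e m)"
      unfolding T_def by blast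
    have "u * r + v * s > 0"
      using uv rs by (cases "u = 0") (auto intro: add_pos_nonneg)
    moreover have "(u *\<^sub>R R + v *\<^sub>R S) (e m) = (u * r + v * s) *\<^sub>R w (e m)" if "m \<ge> N" for m
      using rs that by (simp add: blinfun.add_left blinfun.scaleR_left scaleR_add_left)
    ultimately show "u *\<^sub>R R + v *\<^sub>R S \<in> T N" unfolding T_def by blast
  qed
  have dense: "\<exists>S\<in>(\<Union>N. T N). norm (y - S) \<le> d" if "d > 0" for y and d :: real
  proof -
    obtain S n r where "norm (y - S) \<le> d" "r > 0" "\<And>m. m \<ge> n \<Longrightarrow> blinfun_apply S (e m) = r *\<^sub>R w (e m)"
      using operator_approx[OF \<open>d > 0\<close>, of y w] by metis
    then show ?thesis unfolding T_def by blast
  qed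
  have hull: "\<exists>N. convex hull S \<subseteq> T N" if S: "finite S" "S \<subseteq> (\<Union>N. T N)" for S
  proof -
    have "\<exists>N. S \<subseteq> T N" using S
    proof (induction S)
      case (insert s S)
      then obtain N N' where N: "S \<subseteq> T N" "s \<in> T N'" by auto
      then have "insert s S \<subseteq> T (max N N')" using T_mono[of N "max N N'"] T_mono[of N' "max N N'"] by auto
      then show ?case ..
    qed simp
    then show ?thesis using T_convex by (metis hull_minimal)
  qed
  show ?thesis
  proof (rule C1_approx[OF U F \<epsilon>(1) \<epsilon>(2)[rule_format] dense])
    fix L assume L: "\<And>x. x \<in> U \<Longrightarrow> C1_at L x" "\<And>x. x \<in> U \<Longrightarrow> norm (L x - F x) \<le> \<epsilon> x"
      "\<And>x. x \<in> U \<Longrightarrow> \<exists>S\<subseteq>(\<Union>N. T N). finite S \<and> (\<forall>\<^sub>F y in nhds x. L y \<in> convex hull S)"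
    show ?thesis
    proof (rule that[OF L(1,2)])
      fix x assume "x \<in> U"
      then obtain S where S: "S \<subseteq> (\<Union>N. T N)" "finite S" "\<forall>\<^sub>F y in nhds x. L y \<in> convex hull S" using L(3) by blast
      then obtain N where "convex hull S \<subseteq> T N" using hull by blast
      then have "\<forall>\<^sub>F y in nhds x. L y \<in> T N" using S(3) by (auto elim: eventually_mono)
      then show "\<exists>N. \<forall>\<^sub>F y in nhds x. \<exists>r>0. \<forall>m\<ge>N. blinfun_apply (L y) (e m) = r *\<^sub>R w (e m)"
        unfolding T_def mem_Collect_eq by (rule exI)
    qed
  qed
qed

lemma ex_gauge_below:
  fixes \<epsilon> :: "'a \<Rightarrow> real"
  assumes U: "open U" and \<epsilon>: "continuous_on U \<epsilon>" "\<forall>x\<in>U. \<epsilon> x > 0"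
  obtains g where "\<And>x. C1_at g x" "\<And>x y. \<bar>g x - g y\<bar> \<le> norm (x - y) / 100"
    "\<And>x. 0 \<le> g x" "\<And>x. g x > 0 \<longleftrightarrow> x \<in> U" "\<And>x. x \<in> U \<Longrightarrow> g x \<le> \<epsilon> x"
proof -
  have "\<exists>r>0. ball x r \<subseteq> U \<and> (\<forall>y\<in>ball x r. r \<le> \<epsilon> y)" if x: "x \<in> U" for x
  proof -
    have "(\<epsilon> \<longlongrightarrow> \<epsilon> x) (nhds x)" using \<epsilon>(1) U x by (simp add: continuous_on_eq_continuous_at isCont_def tendsto_at_iff_tendsto_nhds)
    then have "\<forall>\<^sub>F y in nhds x. \<epsilon> x / 2 < \<epsilon> y" using \<epsilon>(2)[rule_format, OF x] by (intro order_tendstoD(1)) auto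
    with eventually_nhds_in_open[OF U x] have "\<forall>\<^sub>F y in nhds x. y \<in> U \<and> \<epsilon> x / 2 < \<epsilon> y" by eventually_elim simp
    then obtain d where d: "d > 0" "\<And>y. dist y x < d \<Longrightarrow> y \<in> U \<and> \<epsilon> x / 2 < \<epsilon> y" unfolding eventually_nhds_metric by blast
    then show ?thesis
      using \<epsilon>(2)[rule_format, OF x] by (intro exI[of _ "min d (\<epsilon> x / 2)"]) (force simp: dist_commute)
  qed
  then obtain r where r: "\<And>x. x \<in> U \<Longrightarrow> 0 < r x" "\<And>x. x \<in> U \<Longrightarrow> ball x (r x) \<subseteq> U" "\<And>x y. x \<in> U \<Longrightarrow> y \<in> ball x (r x) \<Longrightarrow> r x \<le> \<epsilon> y"
    by metis
  obtain g :: "'a \<Rightarrow> real" where g: "\<And>x. C1_at g x" "\<And>x y. \<bar>g x - g y\<bar> \<le> norm (x - y) / 100"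
    "\<And>x. 0 \<le> g x" "\<And>x. g x > 0 \<longleftrightarrow> x \<in> U"
    "\<And>z. z \<in> U \<Longrightarrow> \<exists>x\<in>U. g z \<le> r x \<and> cball z (10 * g z) \<subseteq> ball x (r x)"
    by (rule ex_gauge[OF r(1,2)]) (assumption | (rule that; blast))+
  show ?thesis
  proof (rule that[OF g(1-4)])
    fix z assume "z \<in> U"
    then obtain x where x: "x \<in> U" "g z \<le> r x" "cball z (10 * g z) \<subseteq> ball x (r x)" using g(5) by blast
    have "z \<in> ball x (r x)" by (rule subsetD[OF x(3)]) (use g(3)[of z] in simp)
    then show "g z \<le> \<epsilon> z" using r(3)[OF x(1)] x(2) by fastforce
  qed
qed

lemma ex_filter_gauge:
  fixes f' L :: "'a \<Rightarrow> 'a \<Rightarrow>\<^sub>L (real ^ 'd)" and \<epsilon> :: "'a \<Rightarrow> real"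
  assumes U: "open U" and f': "continuous_on U f'" and L: "\<forall>x\<in>U. C1_at L x" "\<forall>x\<in>U. norm (L x - f' x) \<le> \<epsilon> x"
    and \<epsilon>: "\<And>x y. \<bar>\<epsilon> x - \<epsilon> y\<bar> \<le> norm (x - y) / 100" "\<forall>x\<in>U. \<epsilon> x > 0"
  obtains \<eta> where "\<And>x. C1_at \<eta> x" "\<And>x y. \<bar>\<eta> x - \<eta> y\<bar> \<le> norm (x - y) / 100"
    "\<And>x. 0 \<le> \<eta> x" "\<And>x. \<eta> x > 0 \<longleftrightarrow> x \<in> U" "\<And>x. \<eta> x \<le> 1"
    "\<And>z. z \<in> U \<Longrightarrow> \<exists>a>0. \<eta> z \<le> a \<and> (\<forall>y\<in>cball z (10 * \<eta> z). y \<in> U \<and> a \<le> \<epsilon> y \<and> \<epsilon> y \<le> 5/4 * a \<and>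
      norm (f' y - f' z) \<le> a \<and> norm (L y - f' y) \<le> 5/4 * a \<and> (\<exists>K. calm L y K \<and> K * (20 * \<eta> z) \<le> a))"
proof -
  \<comment> \<open>On a ball of radius at most \<open>?a x\<close> the tolerance varies by less
    than 1 percent of its central value, so it stays between \<open>?a x\<close> and
    \<open>5/4 * ?a x\<close>. The bound \<open>?a x / 2\<close> below is halved because two points
    of the ball are compared through its centre.\<close>
  let ?a = "\<lambda>x. 99/100 * \<epsilon> x"
  have "\<forall>x\<in>U. \<exists>r>0. r \<le> 1 \<and> r \<le> ?a x \<and> (\<exists>K\<ge>0. K * (20 * r) \<le> ?a x \<and>
    (\<forall>y\<in>ball x r. y \<in> U \<and> norm (f' y - f' x) \<le> ?a x / 2 \<and> calm L y K))"
  proof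
    fix x assume x: "x \<in> U"
    have a: "?a x > 0" using \<epsilon>(2)[rule_format, OF x] by simp
    obtain W L' where W: "open W" "x \<in> W" "\<And>y. y \<in> W \<Longrightarrow> (L has_derivative blinfun_apply (L' y)) (at y)" "continuous_on W L'"
      using C1_atE[OF L(1)[rule_format, OF x]] by metis
    define K where "K = norm (L' x) + 1"
    have K: "K > 0" by (simp add: K_def add_nonneg_pos)
    have "(f' \<longlongrightarrow> f' x) (nhds x)" using f' U x by (simp add: continuous_on_eq_continuous_at isCont_def tendsto_at_iff_tendsto_nhds)
    then have "((\<lambda>y. norm (f' y - f' x)) \<longlongrightarrow> norm (f' x - f' x)) (nhds x)" by (intro tendsto_intros)
    then have 1: "\<forall>\<^sub>F y in nhds x. norm (f' y - f' x) < ?a x / 2" using a by (intro order_tendstoD(2)) auto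
    have "(L' \<longlongrightarrow> L' x) (nhds x)" using W by (simp add: continuous_on_eq_continuous_at isCont_def tendsto_at_iff_tendsto_nhds)
    then have 2: "\<forall>\<^sub>F y in nhds x. norm (L' y) < K" by (intro order_tendstoD(2)[OF tendsto_norm]) (auto simp: K_def)
    have "\<forall>\<^sub>F y in nhds x. y \<in> U \<and> norm (f' y - f' x) \<le> ?a x / 2 \<and> calm L y K"
      using 1 2 eventually_nhds_in_open[OF U x] eventually_nhds_in_open[OF W(1,2)]
    proof eventually_elim
      case (elim y)
      have "norm (L' y h) \<le> K * norm h" for h
        using norm_blinfun[of "L' y" h] mult_right_mono[of "norm (L' y)" K "norm h"] elim by simp
      then have "calm L y K" by (rule calm_of_derivative[OF W(3)[OF elim(4)]])
      then show ?case using elim by simp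
    qed
    then obtain d where d: "d > 0" "\<And>y. dist y x < d \<Longrightarrow> y \<in> U \<and> norm (f' y - f' x) \<le> ?a x / 2 \<and> calm L y K"
      unfolding eventually_nhds_metric by blast
    define r where "r = Min {d, 1, ?a x, ?a x / (20 * K)}"
    have r: "0 < r" "r \<le> d" "r \<le> 1" "r \<le> ?a x" "r \<le> ?a x / (20 * K)" using a K d(1) by (auto simp: r_def)
    have "K * (20 * r) \<le> ?a x" using r(5) K by (simp add: pos_le_divide_eq ac_simps)
    moreover have "\<forall>y\<in>ball x r. y \<in> U \<and> norm (f' y - f' x) \<le> ?a x / 2 \<and> calm L y K"
      using d(2) r(2) by (auto simp: dist_commute)
    ultimately show "\<exists>r>0. r \<le> 1 \<and> r \<le> ?a x \<and> (\<exists>K\<ge>0. K * (20 * r) \<le> ?a x \<and>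
      (\<forall>y\<in>ball x r. y \<in> U \<and> norm (f' y - f' x) \<le> ?a x / 2 \<and> calm L y K))"
      using r(1,3,4) less_imp_le[OF K] by blast
  qed
  from bchoice[OF this] obtain r where r: "\<And>x. x \<in> U \<Longrightarrow> 0 < r x" "\<And>x. x \<in> U \<Longrightarrow> r x \<le> 1" "\<And>x. x \<in> U \<Longrightarrow> r x \<le> ?a x"
    and ex_K: "\<forall>x\<in>U. \<exists>K\<ge>0. K * (20 * r x) \<le> ?a x \<and>
      (\<forall>y\<in>ball x (r x). y \<in> U \<and> norm (f' y - f' x) \<le> ?a x / 2 \<and> calm L y K)"
    by blast
  from bchoice[OF ex_K] obtain K where K: "\<And>x. x \<in> U \<Longrightarrow> K x \<ge> 0" "\<And>x. x \<in> U \<Longrightarrow> K x * (20 * r x) \<le> ?a x"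
    and near: "\<And>x y. x \<in> U \<Longrightarrow> y \<in> ball x (r x) \<Longrightarrow> y \<in> U \<and> norm (f' y - f' x) \<le> ?a x / 2 \<and> calm L y (K x)"
    by blast
  have r_ball: "ball x (r x) \<subseteq> U" if "x \<in> U" for x using near[OF that] by blast
  obtain \<eta> :: "'a \<Rightarrow> real" where \<eta>: "\<And>x. C1_at \<eta> x" "\<And>x y. \<bar>\<eta> x - \<eta> y\<bar> \<le> norm (x - y) / 100"
    "\<And>x. 0 \<le> \<eta> x" "\<And>x. \<eta> x > 0 \<longleftrightarrow> x \<in> U"
    "\<And>z. z \<in> U \<Longrightarrow> \<exists>x\<in>U. \<eta> z \<le> r x \<and> cball z (10 * \<eta> z) \<subseteq> ball x (r x)"
    by (rule ex_gauge[OF r(1) r_ball]) (assumption | (rule that; blast))+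
  show ?thesis
  proof (rule that[OF \<eta>(1-4)])
    fix z
    show "\<eta> z \<le> 1"
    proof (cases "z \<in> U")
      case True
      then show ?thesis using \<eta>(5) r(2) by (meson order_trans)
    next
      case False
      then show ?thesis using \<eta>(4)[of z] by linarith
    qed
  next
    fix z assume "z \<in> U"
    then obtain x where x: "x \<in> U" "\<eta> z \<le> r x" "cball z (10 * \<eta> z) \<subseteq> ball x (r x)" using \<eta>(5) by blast
    have zz: "z \<in> ball x (r x)" by (rule subsetD[OF x(3)]) (use \<eta>(3)[of z] in simp)
    have a: "?a x > 0" using \<epsilon>(2)[rule_format, OF x(1)] by simp
    have "y \<in> U \<and> ?a x \<le> \<epsilon> y \<and> \<epsilon> y \<le> 5/4 * ?a x \<and>
      norm (f' y - f' z) \<le> ?a x \<and> norm (L y - f' y) \<le> 5/4 * ?a x \<and> (\<exists>K. calm L y K \<and> K * (20 * \<eta> z) \<le> ?a x)"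
      if "y \<in> cball z (10 * \<eta> z)" for y
    proof -
      have y: "y \<in> ball x (r x)" using x(3) that by blast
      have "norm (x - y) \<le> ?a x" using y r(3)[OF x(1)] by (simp add: dist_norm)
      then have e: "?a x \<le> \<epsilon> y" "\<epsilon> y \<le> 5/4 * ?a x" using \<epsilon>(1)[of x y] \<epsilon>(2)[rule_format, OF x(1)] by linarith+
      have "norm (f' y - f' z) \<le> norm (f' y - f' x) + norm (f' z - f' x)"
        using norm_triangle_ineq4[of "f' y - f' x" "f' z - f' x"] by simp
      also have "\<dots> \<le> ?a x" using near[OF x(1) y] near[OF x(1) zz] by linarith
      finally have f: "norm (f' y - f' z) \<le> ?a x" .
      have "K x * (20 * \<eta> z) \<le> K x * (20 * r x)" using K(1)[OF x(1)] x(2) by (intro mult_left_mono) auto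
      then have "K x * (20 * \<eta> z) \<le> ?a x" using K(2)[OF x(1)] by linarith
      then show ?thesis using near[OF x(1) y] e f L(2) by fastforce
    qed
    then show "\<exists>a>0. \<eta> z \<le> a \<and> (\<forall>y\<in>cball z (10 * \<eta> z). y \<in> U \<and> a \<le> \<epsilon> y \<and> \<epsilon> y \<le> 5/4 * a \<and>
      norm (f' y - f' z) \<le> a \<and> norm (L y - f' y) \<le> 5/4 * a \<and> (\<exists>K. calm L y K \<and> K * (20 * \<eta> z) \<le> a))"
      using a order_trans[OF x(2) r(3)[OF x(1)]] by blast
  qed
qed

end

theorem theorem3p2:
  fixes e :: "nat \<Rightarrow> 'a::banach"
    and U :: "'a set"
    and f :: "'a \<Rightarrow> real ^ 'd"
    and f' :: "'a \<Rightarrow> ('a \<Rightarrow>\<^sub>L (real ^ 'd))"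
    and \<epsilon> :: "'a \<Rightarrow> real"
  assumes "infinite_dimensional TYPE('a)"
    and "C1_on (- {0}) (norm :: 'a \<Rightarrow> real)"
    and "strictly_convex_norm TYPE('a)"
    and "one_suppression_unconditional e"
    and "open U"
    and "\<forall>x\<in>U. (f has_derivative blinfun_apply (f' x)) (at x)"
    and "continuous_on U f'"
    and "continuous_on U \<epsilon>"
    and "\<forall>x\<in>U. \<epsilon> x > 0"
  shows "\<exists>g :: 'a \<Rightarrow> real ^ 'd. \<exists>g' :: 'a \<Rightarrow> ('a \<Rightarrow>\<^sub>L (real ^ 'd)).
           (\<forall>x\<in>U. (g has_derivative blinfun_apply (g' x)) (at x)) \<and> continuous_on U g' \<and>
           (\<forall>x\<in>U. norm (f x - g x) \<le> \<epsilon> x) \<and>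
           (\<forall>x\<in>U. norm (f' x - g' x) \<le> \<epsilon> x) \<and>
           (\<forall>x\<in>U. \<exists>V. open V \<and> x \<in> V \<and>
              (\<exists>Es :: 'a set set. finite Es \<and>
                 (\<forall>F\<in>Es. closed F \<and> subspace F \<and> complemented F \<and> infinite_codim F) \<and>
                 {y \<in> U. \<not> surj (blinfun_apply (g' y))} \<inter> V \<subseteq> \<Union>Es))"
proof -
  interpret smooth_basis e by unfold_locales (fact assms)+
  \<comment> \<open>The loss in \<open>glue_close\<close>; the construction runs with a tolerance
    \<open>\<delta>\<close> below \<open>\<epsilon>\<close> divided by it.\<close>
  let ?C = "20000 * (real CARD('d))\<^sup>2"
  have C: "?C > 0" by simp
  obtain w :: "'a \<Rightarrow>\<^sub>L (real ^ 'd)" where w: "\<And>q. \<exists>m\<ge>q. w (e m) = 0"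
    "\<And>l q. \<exists>m\<ge>q. w (e m) $ l > 0 \<and> (\<forall>k. k \<noteq> l \<longrightarrow> w (e m) $ k = 0)"
    by (rule ex_directions) (assumption | (rule that; blast))+
  have cont: "continuous_on U (\<lambda>x. \<epsilon> x / ?C)" by (intro continuous_intros assms) (use C in auto)
  have pos: "\<forall>x\<in>U. \<epsilon> x / ?C > 0" using assms(9) C by (intro ballI divide_pos_pos) auto
  obtain \<delta> :: "'a \<Rightarrow> real" where \<delta>: "\<And>x. C1_at \<delta> x" "\<And>x y. \<bar>\<delta> x - \<delta> y\<bar> \<le> norm (x - y) / 100"
    "\<And>x. 0 \<le> \<delta> x" "\<And>x. \<delta> x > 0 \<longleftrightarrow> x \<in> U" "\<And>x. x \<in> U \<Longrightarrow> \<delta> x \<le> \<epsilon> x / ?C"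
    by (fact ex_gauge_below[OF assms(5) cont pos])
  have \<delta>_cont: "continuous_on U \<delta>" by (rule C1_at_continuous_on) (rule \<delta>)
  have \<delta>_pos: "\<forall>x\<in>U. \<delta> x > 0" using \<delta>(4) by blast
  obtain L :: "'a \<Rightarrow> 'a \<Rightarrow>\<^sub>L (real ^ 'd)" where L: "\<And>x. x \<in> U \<Longrightarrow> C1_at L x" "\<And>x. x \<in> U \<Longrightarrow> norm (L x - f' x) \<le> \<delta> x"
    "\<And>x. x \<in> U \<Longrightarrow> \<exists>N. \<forall>\<^sub>F y in nhds x. \<exists>r>0. \<forall>m\<ge>N. blinfun_apply (L y) (e m) = r *\<^sub>R w (e m)"
    by (fact ex_tail_proportional_approx[OF assms(5,7) \<delta>_cont \<delta>_pos])
  have L_C1: "\<forall>x\<in>U. C1_at L x" and L_near: "\<forall>x\<in>U. norm (L x - f' x) \<le> \<delta> x" using L by auto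
  obtain \<eta> :: "'a \<Rightarrow> real" where \<eta>: "\<And>x. C1_at \<eta> x" "\<And>x y. \<bar>\<eta> x - \<eta> y\<bar> \<le> norm (x - y) / 100"
    "\<And>x. 0 \<le> \<eta> x" "\<And>x. \<eta> x > 0 \<longleftrightarrow> x \<in> U" "\<And>x. \<eta> x \<le> 1"
    "\<And>z. z \<in> U \<Longrightarrow> \<exists>a>0. \<eta> z \<le> a \<and> (\<forall>y\<in>cball z (10 * \<eta> z). y \<in> U \<and> a \<le> \<delta> y \<and> \<delta> y \<le> 5/4 * a \<and>
      norm (f' y - f' z) \<le> a \<and> norm (L y - f' y) \<le> 5/4 * a \<and> (\<exists>K. calm L y K \<and> K * (20 * \<eta> z) \<le> a))"
    by (fact ex_filter_gauge[OF assms(5,7) L_C1 L_near \<delta>(2) \<delta>_pos])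
  have "\<And>x. x \<in> U \<Longrightarrow> (f has_derivative blinfun_apply (f' x)) (at x)" using assms(6) by blast
  then interpret filter_data e U f f' L \<delta> \<eta> w
    by (intro filter_data.intro[OF smooth_basis_axioms] filter_data_axioms.intro[OF assms(5) _ assms(7) L(1,3) \<delta>(1-3) \<eta>])
  have "C1_on U glue" using C1_at_glue C1_on_iff_C1_at[OF assms(5)] by blast
  then obtain g' where g': "\<And>x. x \<in> U \<Longrightarrow> (glue has_derivative blinfun_apply (g' x)) (at x)" "continuous_on U g'"
    unfolding C1_on_def by blast
  have small: "?C * \<delta> x \<le> \<epsilon> x" if "x \<in> U" for x using \<delta>(5)[OF that] C by (simp only: pos_le_divide_eq mult.commute)
  show ?thesis
  proof (intro exI[of _ glue] exI[of _ g'] conjI ballI)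
    fix x assume x: "x \<in> U"
    show "(glue has_derivative blinfun_apply (g' x)) (at x)" by (rule g'(1)[OF x])
    show "norm (f x - glue x) \<le> \<epsilon> x" using glue_close(1)[OF x] small[OF x] by linarith
    show "norm (f' x - g' x) \<le> \<epsilon> x" using glue_close(2)[OF x g'(1)[OF x]] small[OF x] by linarith
    obtain q where "\<forall>\<^sub>F y in nhds x. \<forall>D. (glue has_derivative D) (at y) \<longrightarrow> \<not> surj D \<longrightarrow>
      y \<in> vanishing {m. q \<le> m \<and> w (e m) = 0}"
      by (fact critical_points_vanish[OF w(2) x])
    then obtain V where V: "open V" "x \<in> V" "\<forall>y\<in>V. \<forall>D. (glue has_derivative D) (at y) \<longrightarrow> \<not> surj D \<longrightarrow>
      y \<in> vanishing {m. q \<le> m \<and> w (e m) = 0}"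
      unfolding eventually_nhds by blast
    have "infinite {m. q \<le> m \<and> w (e m) = 0}"
      unfolding infinite_nat_iff_unbounded_le
    proof
      fix k
      obtain m where "max q k \<le> m" "w (e m) = 0" using w(1) by blast
      then show "\<exists>n\<ge>k. n \<in> {m. q \<le> m \<and> w (e m) = 0}" by auto
    qed
    then show "\<exists>V. open V \<and> x \<in> V \<and> (\<exists>Es :: 'a set set. finite Es \<and>
                 (\<forall>F\<in>Es. closed F \<and> subspace F \<and> complemented F \<and> infinite_codim F) \<and>
                 {y \<in> U. \<not> surj (blinfun_apply (g' y))} \<inter> V \<subseteq> \<Union>Es)"
      using V g'(1) infinite_codim_vanishing
      by (intro exI[of _ V] conjI exI[of _ "{vanishing {m. q \<le> m \<and> w (e m) = 0}}"])
        (auto simp: closed_vanishing subspace_vanishing complemented_vanishing)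
  qed (rule g'(2))
qed

end
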